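(* Let $2\le m\le n$, let $(P,\chi)$ be a set of linear evolution data, and let $\phi\in\mathcal C_P$. Then there exist $\epsilon>0$ and a unique real analytic family $\{\phi_t:t\in(-\epsilon,\epsilon)\}$ in $\mathcal C_P$ with $\phi_0=\phi$, satisfying $$\Bigl(\frac{d\phi_t}{dt}(x)\Bigr)^b=(\phi_t)_*(\chi(x))^{a_1\ldots a_{m-1}}(\mathrm{Re}\,\Omega)_{a_1\ldots a_{m-1}a_m}g^{a_mb}$$ for all $x\in\mathbb R^n$. Furthermore, $N=\{\phi_t(p):t\in(-\epsilon,\epsilon),\ p\in P\}$ is a special Lagrangian submanifold in $\mathbb C^m$ wherever it is nonsingular.
   Context: $\mathbb C^m$ has coordinates $(z_1,\dots,z_m)$, metric $g=\sum|dz_j|^2$, $2$-form $\omega=\frac i2\sum dz_j\wedge d\bar z_j$ and complex $m$-form $\Omega=dz_1\wedge\cdots\wedge dz_m$. An oriented real $m$-dimensional submanifold $L$ is special Lagrangian if $\mathrm{Re}\,\Omega|_{T_xL}=\mathrm{vol}_{T_xL}$ for all $x\in L$; a real $m$-dimensional submanifold admits an orientation making it special Lagrangian iff $\omega|_L\equiv0$ and $\mathrm{Im}\,\Omega|_L\equiv 0$. The index notation is for real tensors on $\mathbb C^m\cong\mathbb R^{2m}$, with summation over repeated indices. A set of linear evolution data is a pair $(P,\chi)$, where $P$ is an $(m-1)$-dimensional submanifold of $\mathbb R^n$ (possibly with singular points), and $\chi:\mathbb R^n\to\Lambda^{m-1}\mathbb R^n$ is a linear map such that $\chi(p)$ is a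 nonzero element of $\Lambda^{m-1}T_pP\subset\Lambda^{m-1}\mathbb R^n$ for each nonsingular point $p\in P$; moreover $P$ is not contained in any proper vector subspace of $\mathbb R^n$. $\mathcal C_P$ is the set of linear maps $\phi\in\mathrm{Hom}(\mathbb R^n,\mathbb C^m)$ (real linear) such that (i) $\phi^*(\omega)|_P\equiv 0$, and (ii) $\phi|_{T_pP}:T_pP\to\mathbb C^m$ is injective for all $p$ in a dense open subset of $P$. *)

theory Defs
  imports "HOL-Analysis.Analysis"
begin

text \<open>
  Throughout, \<open>'k\<close> is a finite type with \<open>m - 1\<close> elements and \<open>'k option\<close> is the index type
  with \<open>m\<close> elements, \<open>None\<close> being the last index. It labels both the complex coordinates of
  \<open>\<complex>\<^sup>m\<close> and the argument slots of an \<open>m\<close>-form, while \<open>'k\<close> labels the slots of an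
  \<open>(m-1)\<close>-vector. The library inner product on \<^typ>\<open>complex ^ 'm\<close> is the real inner product
  \<open>g = \<Sum> \<bar>dz\<^sub>j\<bar>\<^sup>2\<close>.
\<close>

type_synonym 'k cspace = "complex ^ ('k option)"

type_synonym ('n, 'k) hom = "(real ^ 'n) \<Rightarrow>\<^sub>L (complex ^ ('k option))"


section \<open>Smooth maps and submanifolds of Euclidean space\<close>

text \<open>Only meant for open \<open>U\<close>.\<close>

primrec Ck_on :: "nat \<Rightarrow> ('a::euclidean_space \<Rightarrow> 'b::euclidean_space) \<Rightarrow> 'a set \<Rightarrow> bool" where
  "Ck_on 0 f U \<longleftrightarrow> continuous_on U f"
| "Ck_on (Suc r) f U \<longleftrightarrow>
     (\<forall>x\<in>U. f differentiable (at x)) \<and> (\<forall>v. Ck_on r (\<lambda>x. frechet_derivative f (at x) v) U)"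

definition smooth_on :: "('a::euclidean_space \<Rightarrow> 'b::euclidean_space) \<Rightarrow> 'a set \<Rightarrow> bool" where
  "smooth_on f U \<longleftrightarrow> (\<forall>r. Ck_on r f U)"

text \<open>
  The nonsingular points of a set, for a given dimension \<open>d\<close>: those near which it is an embedded
  \<open>d\<close>-dimensional smooth submanifold, expressed by a slice chart \<open>\<psi> : U \<rightarrow> V\<close> with inverse \<open>\<psi>'\<close>.
\<close>

definition nonsingular_part :: "nat \<Rightarrow> 'a::euclidean_space set \<Rightarrow> 'a set" where
  "nonsingular_part d M =
     {p \<in> M. \<exists>(U :: 'a set) (V :: 'a set) \<psi> \<psi>' S. open U \<and> open V \<and> p \<in> U \<and>
        homeomorphism U V \<psi> \<psi>' \<and> smooth_on \<psi> U \<and> smooth_on \<psi>' V \<and>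
        subspace S \<and> dim S = d \<and> \<psi> ` (M \<inter> U) = S \<inter> V}"

definition submanifold :: "nat \<Rightarrow> 'a::euclidean_space set \<Rightarrow> bool" where
  "submanifold d M \<longleftrightarrow> nonsingular_part d M = M"

definition singular_submanifold :: "nat \<Rightarrow> 'a::euclidean_space set \<Rightarrow> bool" where
  "singular_submanifold d M \<longleftrightarrow> M \<subseteq> closure (nonsingular_part d M)"

text \<open>Velocities of smooth curves; only meant for nonsingular points \<open>p\<close> of \<open>M\<close>.\<close>

definition tangent_space :: "'a::euclidean_space set \<Rightarrow> 'a \<Rightarrow> 'a set" where
  "tangent_space M p =
     {v. \<exists>\<gamma> \<delta>. \<delta> > 0 \<and> smooth_on \<gamma> {-\<delta><..<\<delta>} \<and> \<gamma> ` {-\<delta><..<\<delta>} \<subseteq> M \<and> \<gamma> 0 = p \<and>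
        (\<gamma> has_vector_derivative v) (at (0::real))}"


section \<open>Orientations and volume forms\<close>

definition ordered_basis :: "'a::euclidean_space set \<Rightarrow> ('i::finite \<Rightarrow> 'a) \<Rightarrow> bool" where
  "ordered_basis T e \<longleftrightarrow> inj e \<and> independent (range e) \<and> span (range e) = T"

text \<open>An orientation is the set of all its positively oriented ordered bases.\<close>

definition vs_orientation :: "'a::euclidean_space set \<Rightarrow> ('i::finite \<Rightarrow> 'a) set \<Rightarrow> bool" where
  "vs_orientation T Or \<longleftrightarrow>
     (\<exists>e. ordered_basis T e \<and>
        Or = {f. ordered_basis T f \<and>
                (\<exists>A :: real ^ 'i ^ 'i. det A > 0 \<and> (\<forall>i. f i = (\<Sum>j\<in>UNIV. A $ i $ j *\<^sub>R e j)))})"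

definition orientation_on ::
    "'a::euclidean_space set \<Rightarrow> ('a \<Rightarrow> ('i::finite \<Rightarrow> 'a) set) \<Rightarrow> bool" where
  "orientation_on L Or \<longleftrightarrow>
     (\<forall>x\<in>L. vs_orientation (tangent_space L x) (Or x)) \<and>
     (\<forall>x\<in>L. \<exists>U e. open U \<and> x \<in> U \<and>
        (\<forall>i. continuous_on (L \<inter> U) (\<lambda>y. e y i)) \<and> (\<forall>y\<in>L \<inter> U. e y \<in> Or y))"

text \<open>The value does not depend on the chosen positively oriented orthonormal basis.\<close>

definition volume_form :: "('i::finite \<Rightarrow> 'a::euclidean_space) set \<Rightarrow> ('i \<Rightarrow> 'a) \<Rightarrow> real" where
  "volume_form Or v =
     (let e = (SOME e. e \<in> Or \<and> (\<forall>i j. e i \<bullet> e j = (if i = j then 1 else 0)))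
      in det (\<chi> i j. v i \<bullet> e j))"


section \<open>Special Lagrangian submanifolds\<close>

definition kaehler_form :: "complex ^ 'm \<Rightarrow> complex ^ 'm \<Rightarrow> complex" where
  "kaehler_form u v = \<i> / 2 * (\<Sum>j\<in>UNIV. u $ j * cnj (v $ j) - v $ j * cnj (u $ j))"

text \<open>
  \<open>dz\<^sub>1 \<and> \<dots> \<and> dz\<^sub>m\<close>. Slots and coordinates carry the same index type, so no enumeration of it is
  needed: relabelling both at once leaves the determinant unchanged.
\<close>

definition Omega :: "('m::finite \<Rightarrow> complex ^ 'm) \<Rightarrow> complex" where
  "Omega v = det (\<chi> i. v i)"

definition special_lagrangian :: "(complex ^ 'm) set \<Rightarrow> bool" where
  "special_lagrangian L \<longleftrightarrow> submanifold CARD('m) L \<and>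
     (\<exists>Or :: complex ^ 'm \<Rightarrow> ('m \<Rightarrow> complex ^ 'm) set. orientation_on L Or \<and>
        (\<forall>x\<in>L. \<forall>v. (\<forall>i. v i \<in> tangent_space L x) \<longrightarrow> Re (Omega v) = volume_form (Or x) v))"


section \<open>Multivectors\<close>

text \<open>
  A contravariant tensor with slots \<open>'k\<close> on \<open>\<real>\<^sup>n\<close> is the array of its components, of type
  \<^typ>\<open>real ^ ('k::finite \<Rightarrow> 'n::finite)\<close>; multivectors are the antisymmetric ones. The wedge product
  is \<open>\<Sum>\<^sub>\<sigma> sgn \<sigma> w\<^bsub>\<sigma> 1\<^esub> \<otimes> \<dots> \<otimes> w\<^bsub>\<sigma> k\<^esub>\<close>.
\<close>

definition wedge :: "('k::finite \<Rightarrow> real ^ 'n) \<Rightarrow> real ^ ('k \<Rightarrow> 'n::finite)" where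
  "wedge w = (\<chi> I. det (\<chi> i j. w i $ I j))"

definition exterior_power :: "(real ^ 'n) set \<Rightarrow> (real ^ ('k::finite \<Rightarrow> 'n::finite)) set" where
  "exterior_power W = span {wedge w | w. range w \<subseteq> W}"

text \<open>
  The component with upper real indices \<open>a\<close> of the push-forward of \<open>T\<close> along \<open>\<phi>\<close>. Real indices on
  \<open>\<complex>\<^sup>m \<cong> \<real>\<^sup>2\<^sup>m\<close> are elements of \<^const>\<open>Basis\<close>.
\<close>

definition pushforward ::
    "('n::finite, 'k::finite) hom \<Rightarrow> real ^ ('k \<Rightarrow> 'n) \<Rightarrow> ('k \<Rightarrow> 'k cspace) \<Rightarrow> real" where
  "pushforward \<phi> T a =
     (\<Sum>I\<in>UNIV. T $ I * (\<Prod>j\<in>UNIV. blinfun_apply \<phi> (axis (I j) 1) \<bullet> a j))"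

text \<open>The covariant component of the real part of \<open>\<Omega>\<close> with indices \<open>a\<close>, and \<open>c\<close> in the last slot.\<close>

definition Re_Omega_comp :: "('k::finite \<Rightarrow> 'k cspace) \<Rightarrow> 'k cspace \<Rightarrow> real" where
  "Re_Omega_comp a c = Re (Omega (\<lambda>s. case s of Some j \<Rightarrow> a j | None \<Rightarrow> c))"


section \<open>Linear evolution data and the evolution equation\<close>

definition linear_evolution_data ::
    "(real ^ 'n) set \<Rightarrow> (real ^ 'n \<Rightarrow> real ^ ('k::finite \<Rightarrow> 'n::finite)) \<Rightarrow> bool" where
  "linear_evolution_data P X \<longleftrightarrow>
     singular_submanifold CARD('k) P \<and>
     linear X \<and> range X \<subseteq> exterior_power UNIV \<and>
     (\<forall>p\<in>nonsingular_part CARD('k) P. X p \<in> exterior_power (tangent_space P p) \<and> X p \<noteq> 0) \<and>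
     (\<forall>S. subspace S \<and> P \<subseteq> S \<longrightarrow> S = UNIV)"

text \<open>The set \<open>\<C>\<^sub>P\<close>. Tangent spaces exist only at nonsingular points.\<close>

definition evolution_maps :: "(real ^ 'n) set \<Rightarrow> ('n::finite, 'k::finite) hom set" where
  "evolution_maps P =
     {\<phi>. (\<forall>p\<in>nonsingular_part CARD('k) P. \<forall>u\<in>tangent_space P p. \<forall>v\<in>tangent_space P p.
            kaehler_form (blinfun_apply \<phi> u) (blinfun_apply \<phi> v) = 0) \<and>
         (\<exists>D. D \<subseteq> nonsingular_part CARD('k) P \<and> openin (top_of_set P) D \<and> P \<subseteq> closure D \<and>
            (\<forall>p\<in>D. inj_on (blinfun_apply \<phi>) (tangent_space P p)))}"

text \<open>
  The vector with components
  \<open>\<phi>\<^sub>*(X(x))\<^bsup>a\<^sub>1 \<dots> a\<^sub>m\<^sub>-\<^sub>1\<^esup> (Re \<Omega>)\<^bsub>a\<^sub>1 \<dots> a\<^sub>m\<^sub>-\<^sub>1 c\<^esub> g\<^bsup>c b\<^esup>\<close>, summed over all index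
  values without combinatorial factors. As \<^const>\<open>Basis\<close> is orthonormal for \<open>g\<close>, the inverse
  metric has components \<open>c \<bullet> b\<close>.
\<close>

definition evolution_rhs ::
    "(real ^ 'n \<Rightarrow> real ^ ('k::finite \<Rightarrow> 'n::finite)) \<Rightarrow> ('n, 'k) hom \<Rightarrow> real ^ 'n \<Rightarrow> 'k cspace" where
  "evolution_rhs X \<phi> x =
     (\<Sum>b\<in>Basis.
        (\<Sum>a\<in>{a. range a \<subseteq> Basis}. \<Sum>c\<in>Basis.
           pushforward \<phi> (X x) a * Re_Omega_comp a c * (c \<bullet> b)) *\<^sub>R b)"

definition real_analytic_on :: "(real \<Rightarrow> 'b::banach) \<Rightarrow> real set \<Rightarrow> bool" where
  "real_analytic_on f I \<longleftrightarrow>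
     (\<forall>t\<in>I. \<exists>r>0. \<exists>c :: nat \<Rightarrow> 'b. \<forall>s. \<bar>s - t\<bar> < r \<longrightarrow> (\<lambda>i. (s - t) ^ i *\<^sub>R c i) sums f s)"

definition evolution_family ::
    "(real ^ 'n) set \<Rightarrow> (real ^ 'n \<Rightarrow> real ^ ('k \<Rightarrow> 'n)) \<Rightarrow> ('n, 'k) hom \<Rightarrow> real \<Rightarrow>
     (real \<Rightarrow> ('n::finite, 'k::finite) hom) \<Rightarrow> bool" where
  "evolution_family P X \<phi> \<epsilon> \<Phi> \<longleftrightarrow>
     real_analytic_on \<Phi> {-\<epsilon><..<\<epsilon>} \<and> (\<forall>t\<in>{-\<epsilon><..<\<epsilon>}. \<Phi> t \<in> evolution_maps P) \<and> \<Phi> 0 = \<phi> \<and>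
     (\<forall>t\<in>{-\<epsilon><..<\<epsilon>}. \<forall>x.
        ((\<lambda>s. blinfun_apply (\<Phi> s) x) has_vector_derivative evolution_rhs X (\<Phi> t) x) (at t))"

end

theory Submission
  imports Defs
begin

text \<open>
  In the components of \<open>\<phi>\<close>, the right-hand side of the evolution equation is a homogeneous polynomial
  of degree \<open>m - 1\<close>. Existence, uniqueness and analyticity of \<open>\<phi>\<^sub>t\<close> are therefore statements about
  polynomial differential equations on a Euclidean space. A formal power series solution exists and
  converges with a radius that depends only on a bound for the initial value
  (\<open>analytic_solution\<close>). Restarting it at \<open>\<phi>\<^sub>t\<close> and comparing with Gronwall's inequality
  (\<open>ode_unique\<close>) gives the expansion of the same solution around every \<open>t\<close>.

  For fixed \<open>t\<close> let \<open>f(x)\<close> be the right-hand side, a linear map of \<open>x\<close>. At a nonsingular point \<open>p\<close>,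
  the multivector \<open>\<chi>(p)\<close>, written \<open>X p\<close> below, is a nonzero multiple of \<open>w\<^sub>1 \<and> \<dots> \<and> w\<^sub>m\<^sub>-\<^sub>1\<close> for a basis \<open>w\<close> of the tangent space, so that
  \<open>g(f(p), c) = \<kappa> Re \<Omega>(\<phi> w\<^sub>1, \<dots>, \<phi> w\<^sub>m\<^sub>-\<^sub>1, c)\<close> with \<open>\<kappa> \<noteq> 0\<close> (\<open>evolution_rhs_nonsingular\<close>). The geometry
  follows from this formula.

  \<^emph>\<open>Isotropy.\<close> Put \<open>\<beta>\<^sub>p(v) = \<omega>(f(p), \<phi> v)\<close>. As \<open>f\<close> and \<open>\<phi>\<close> are linear, the time derivative of
  \<open>\<phi>\<^sup>*\<omega>\<close> is \<open>d\<beta>\<close>. On tangent vectors of \<open>P\<close> the form \<open>\<beta>\<close> vanishes identically, because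
  \<open>\<omega>(f(p), \<phi> v)\<close> is a multiple of \<open>Im \<Omega>(\<phi> w\<^sub>1, \<dots>, \<phi> w\<^sub>m\<^sub>-\<^sub>1, \<phi> v)\<close> and \<open>v\<close> is a combination of the
  \<open>w\<^sub>j\<close>. Hence \<open>d\<beta>\<close> restricts to \<open>0\<close> as well (\<open>vanishing_form_closed\<close>), and the restriction of \<open>\<phi>\<^sup>*\<omega>\<close>
  is constant in time (\<open>isotropy_preserved\<close>).

  \<^emph>\<open>Injectivity.\<close> For isotropic images, \<open>\<phi>\<close> is injective on the tangent space at \<open>p\<close> if and only if
  \<open>f(p) \<noteq> 0\<close> (\<open>evolution_rhs_nonzero_iff\<close>). If \<open>f\<close> vanished at time \<open>t\<close> on all nonsingular points in
  some open set that meets \<open>P\<close>, it would vanish on their span \<open>W\<close>. This span contains the tangent spaces at those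
  points, so \<open>\<chi>\<close> maps \<open>W\<close> into the exterior power of \<open>W\<close>, and the restriction of \<open>\<phi>\<close> to \<open>W\<close> solves an
  autonomous equation of its own. It would sit at an equilibrium at time \<open>t\<close>, hence at all times, and
  \<open>\<phi>\<^sub>0\<close> would not be injective on the tangent spaces at these points (\<open>nondegeneracy_preserved\<close>).
  This works for all \<open>t\<close> in the interval of existence, although \<open>P\<close> need not be compact.

  \<^emph>\<open>Special Lagrangian.\<close> At \<open>y = \<phi>\<^sub>t(p)\<close> with \<open>p\<close> nonsingular and \<open>f(p) \<noteq> 0\<close>, the vectors \<open>\<phi> w\<^sub>j\<close> and
  \<open>f(p)\<close> are velocities of curves in \<open>N\<close> and span the tangent space of \<open>N\<close>; the formula for \<open>f(p)\<close> shows
  that \<open>\<omega>\<close> and \<open>Im \<Omega>\<close> vanish on it (\<open>swept_tangent_plane\<close>). Such points are dense in \<open>N\<close>, and tangent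
  spaces vary continuously, so the same holds at every nonsingular point of \<open>N\<close>
  (\<open>special_planes_closed\<close>). On such planes \<open>Re \<Omega>\<close> is the volume form of the orientation by the frames
  on which it is positive (\<open>special_planes_imp_special_lagrangian\<close>).
\<close>

section \<open>Multilinear maps and the polynomial fields they define\<close>

definition multilinear :: "(('i::finite \<Rightarrow> 'a::real_vector) \<Rightarrow> 'b::real_vector) \<Rightarrow> bool" where
  "multilinear M \<longleftrightarrow> (\<forall>v i. linear (\<lambda>x. M (v(i := x))))"

text \<open>
  Expansion of only the slots in \<open>S\<close>, so that induction on \<open>S\<close> applies.
\<close>

lemma multilinear_expand_on:
  fixes M :: "('i::finite \<Rightarrow> 'a::euclidean_space) \<Rightarrow> 'b::real_vector"
  assumes "multilinear M"
  shows "M v = (\<Sum>g\<in>PiE S (\<lambda>_. Basis). (\<Prod>j\<in>S. v j \<bullet> g j) *\<^sub>R M (\<lambda>j. if j \<in> S then g j else v j))"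
proof -
  have "finite S" by simp
  then show ?thesis
  proof (induction S rule: finite_induct)
    case empty
    then show ?case by simp
  next
    case (insert a S)
    \<comment> \<open>the arguments in which the slots of \<open>S\<close> are already expanded\<close>
    define w where "w g = (\<lambda>j. if j \<in> S then g j else v j)" for g
    have slot: "M (w g) = (\<Sum>b\<in>Basis. (v a \<bullet> b) *\<^sub>R M ((w g)(a := b)))" for g
    proof -
      have "linear (\<lambda>x. M ((w g)(a := x)))"
        using assms by (simp add: multilinear_def)
      then interpret linear "\<lambda>x. M ((w g)(a := x))" .
      have "M ((w g)(a := (\<Sum>b\<in>Basis. (v a \<bullet> b) *\<^sub>R b))) =
          (\<Sum>b\<in>Basis. (v a \<bullet> b) *\<^sub>R M ((w g)(a := b)))"
        by (simp add: sum scale)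
      moreover have "(w g)(a := v a) = w g" using insert by (auto simp: w_def)
      ultimately show ?thesis by (simp add: euclidean_representation)
    qed
    have "(\<Sum>g\<in>PiE (insert a S) (\<lambda>_. Basis).
        (\<Prod>j\<in>insert a S. v j \<bullet> g j) *\<^sub>R M (\<lambda>j. if j \<in> insert a S then g j else v j)) =
      (\<Sum>(b, g)\<in>Basis \<times> PiE S (\<lambda>_. Basis).
        (\<Prod>j\<in>insert a S. v j \<bullet> (g(a := b)) j) *\<^sub>R
          M (\<lambda>j. if j \<in> insert a S then (g(a := b)) j else v j))"
      unfolding PiE_insert_eq
      using inj_combinator[OF insert.hyps(2), of "\<lambda>_. Basis"]
      by (subst sum.reindex) (auto simp: case_prod_unfold)
    also have "\<dots> = (\<Sum>(b, g)\<in>Basis \<times> PiE S (\<lambda>_. Basis).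
        (\<Prod>j\<in>S. v j \<bullet> g j) *\<^sub>R (v a \<bullet> b) *\<^sub>R M ((w g)(a := b)))"
    proof (rule sum.cong[OF refl], clarify)
      fix b :: 'a and g :: "'i \<Rightarrow> 'a"
      have "(\<Prod>j\<in>S. v j \<bullet> (g(a := b)) j) = (\<Prod>j\<in>S. v j \<bullet> g j)"
        using insert by (intro prod.cong) auto
      moreover have "(\<lambda>j. if j \<in> insert a S then (g(a := b)) j else v j) = (w g)(a := b)"
        using insert by (auto simp: w_def)
      ultimately show "(\<Prod>j\<in>insert a S. v j \<bullet> (g(a := b)) j) *\<^sub>R
          M (\<lambda>j. if j \<in> insert a S then (g(a := b)) j else v j) =
        (\<Prod>j\<in>S. v j \<bullet> g j) *\<^sub>R (v a \<bullet> b) *\<^sub>R M ((w g)(a := b))"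
        using insert by (simp add: mult.commute)
    qed
    also have "\<dots> = (\<Sum>g\<in>PiE S (\<lambda>_. Basis). (\<Prod>j\<in>S. v j \<bullet> g j) *\<^sub>R
        (\<Sum>b\<in>Basis. (v a \<bullet> b) *\<^sub>R M ((w g)(a := b))))"
      by (simp add: sum.cartesian_product[symmetric] scaleR_sum_right) (rule sum.swap)
    also have "\<dots> = M v"
      unfolding slot[symmetric] unfolding w_def by (rule insert.IH[symmetric])
    finally show ?case by simp
  qed
qed

lemma PiE_UNIV_Basis: "PiE UNIV (\<lambda>_. B) = {g. range g \<subseteq> B}"
  by (auto simp: PiE_UNIV_domain)

lemma finite_index_tuples [simp]:
  "finite {g :: 'i::finite \<Rightarrow> 'a::euclidean_space. range g \<subseteq> Basis}"
  by (subst PiE_UNIV_Basis[symmetric]) (intro finite_PiE, auto)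

lemma multilinear_expand:
  fixes M :: "('i::finite \<Rightarrow> 'a::euclidean_space) \<Rightarrow> 'b::real_vector"
  assumes "multilinear M"
  shows "M v = (\<Sum>g | range g \<subseteq> Basis. (\<Prod>j\<in>UNIV. v j \<bullet> g j) *\<^sub>R M g)"
  using multilinear_expand_on[OF assms, of v UNIV] by (simp add: PiE_UNIV_Basis)

text \<open>
  After division by the bound for the arguments all coordinates are at most \<open>1\<close>, and
  products of such numbers differ by at most the sum of the differences of the factors.
\<close>

lemma multilinear_diagonal_lipschitz:
  fixes M :: "('i::finite \<Rightarrow> 'a::euclidean_space) \<Rightarrow> 'b::real_normed_vector"
  assumes "multilinear M"
  shows "\<exists>L. \<forall>x y. norm x \<le> R \<longrightarrow> norm y \<le> R \<longrightarrow>
           norm (M (\<lambda>_. x) - M (\<lambda>_. y)) \<le> L * norm (x - y)"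
proof -
  \<comment> \<open>at least \<open>1\<close>, so that dividing by it does not increase differences\<close>
  define Q where "Q = max R 1"
  have Q: "Q \<ge> 1" "Q \<ge> R" by (auto simp: Q_def)
  define L where "L = (\<Sum>g | range g \<subseteq> (Basis :: 'a set). real CARD('i) * Q ^ CARD('i) * norm (M (g :: 'i \<Rightarrow> 'a)))"
  have *: "norm (M (\<lambda>_. x) - M (\<lambda>_. y)) \<le> L * norm (x - y)" if x: "norm x \<le> R" and y: "norm y \<le> R" for x y
  proof -
    have coeff: "\<bar>(\<Prod>j\<in>UNIV. x \<bullet> g j) - (\<Prod>j\<in>UNIV. y \<bullet> g j)\<bar> \<le> real CARD('i) * Q ^ CARD('i) * norm (x - y)"
      if g: "range g \<subseteq> Basis" for g :: "'i \<Rightarrow> 'a"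
    proof -
      have sc: "(\<Prod>j\<in>UNIV. z \<bullet> g j) = Q ^ CARD('i) * (\<Prod>j\<in>UNIV. (z \<bullet> g j) / Q)" for z
        using Q by (simp add: prod_dividef)
      have ng: "\<bar>z \<bullet> g j\<bar> \<le> norm z" for z j
        using g by (intro Basis_le_norm) auto
      have b1: "\<bar>(z \<bullet> g j) / Q\<bar> \<le> 1" if "norm z \<le> R" for z j
        using ng[of z j] that Q by (simp add: divide_simps)
      have "\<bar>(\<Prod>j\<in>UNIV. (x \<bullet> g j) / Q) - (\<Prod>j\<in>UNIV. (y \<bullet> g j) / Q)\<bar> \<le> (\<Sum>j\<in>UNIV. \<bar>(x \<bullet> g j) / Q - (y \<bullet> g j) / Q\<bar>)"
        using norm_prod_diff[of UNIV "\<lambda>j. (x \<bullet> g j) / Q" "\<lambda>j. (y \<bullet> g j) / Q"] b1[OF x] b1[OF y] by simp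
      also have "\<dots> \<le> (\<Sum>j\<in>(UNIV :: 'i set). norm (x - y))"
      proof (rule sum_mono)
        fix j
        have "\<bar>(x \<bullet> g j) / Q - (y \<bullet> g j) / Q\<bar> = \<bar>(x - y) \<bullet> g j\<bar> / Q"
          using Q by (simp add: inner_diff_left flip: diff_divide_distrib)
        also have "\<dots> \<le> \<bar>(x - y) \<bullet> g j\<bar> / 1"
          using Q by (intro divide_left_mono) auto
        also have "\<dots> \<le> norm (x - y)" using ng[of "x - y" j] by simp
        finally show "\<bar>(x \<bullet> g j) / Q - (y \<bullet> g j) / Q\<bar> \<le> norm (x - y)" .
      qed
      finally have "Q ^ CARD('i) * \<bar>(\<Prod>j\<in>UNIV. (x \<bullet> g j) / Q) - (\<Prod>j\<in>UNIV. (y \<bullet> g j) / Q)\<bar> \<le> Q ^ CARD('i) * (real CARD('i) * norm (x - y))"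
        using Q by (intro mult_left_mono) auto
      then show ?thesis unfolding sc right_diff_distrib[symmetric]
        using Q by (simp add: abs_mult mult_ac)
    qed
    have "M (\<lambda>_. x) - M (\<lambda>_. y) = (\<Sum>g | range g \<subseteq> Basis. ((\<Prod>j\<in>UNIV. x \<bullet> g j) - (\<Prod>j\<in>UNIV. y \<bullet> g j)) *\<^sub>R M g)"
      by (simp add: multilinear_expand[OF assms, of "\<lambda>_. x"] multilinear_expand[OF assms, of "\<lambda>_. y"]
          scaleR_diff_left sum_subtractf)
    also have "norm \<dots> \<le> (\<Sum>g | range g \<subseteq> (Basis :: 'a set). real CARD('i) * Q ^ CARD('i) * norm (x - y) * norm (M g))"
      by (rule sum_norm_le) (auto intro!: mult_right_mono coeff)
    also have "\<dots> = L * norm (x - y)" by (simp add: L_def sum_distrib_left sum_distrib_right mult_ac)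
    finally show ?thesis .
  qed
  then show ?thesis by blast
qed

section \<open>Analytic solutions of polynomial differential equations\<close>

text \<open>
  Summable weights that reproduce themselves under convolution up to a constant factor, so that
  bounds of the form \<open>A w\<^sub>n B\<^sup>n\<close> on coefficients survive multiplication
  of power series.
\<close>

definition conv_weight :: "nat \<Rightarrow> real" where
  "conv_weight n = 1 / (real n + 1)^2"

lemma conv_weight_pos: "conv_weight n > 0"
  by (simp add: conv_weight_def)

lemma sum_conv_weight_le: "(\<Sum>i\<le>n. conv_weight i) \<le> 2"
proof -
  have "(\<Sum>i\<le>n. conv_weight i) \<le> 2 - 1 / (real n + 1)"
  proof (induction n)
    case 0
    then show ?case by (simp add: conv_weight_def)
  next
    case (Suc n)
    have "1 / (real n + 2)^2 \<le> 1 / (real n + 1) - 1 / (real n + 2)"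
      by (simp add: divide_simps power2_eq_square)
    then show ?case using Suc by (simp add: conv_weight_def add.commute)
  qed
  also have "\<dots> \<le> 2" by simp
  finally show ?thesis .
qed

text \<open>
  By partial fractions, \<open>1/((i+1)(d+1)) = (1/(i+1) + 1/(d+1)) / (n+2)\<close> for \<open>n =
  i + d\<close>. Squaring this leaves two copies of the sum of all weights, next to a factor that
  does not depend on \<open>i\<close>.
\<close>

lemma conv_weight_convolution:
  "(\<Sum>i\<le>n. conv_weight i * conv_weight (n - i)) \<le> 8 * conv_weight n"
proof -
  have "(\<Sum>i\<le>n. conv_weight i * conv_weight (n - i)) \<le>
      (\<Sum>i\<le>n. 2 * conv_weight n * (conv_weight i + conv_weight (n - i)))"
  proof (rule sum_mono)
    fix i assume "i \<in> {..n}"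
    then obtain d where d: "n = i + d" using le_Suc_ex by auto
    define a b where "a = 1 / (real i + 1)" and "b = 1 / (real d + 1)"
    have ab: "a * b = (a + b) * (1 / (real n + 2))"
      by (simp add: a_def b_def d field_simps)
    have "(a * b)^2 = (a + b)^2 * (1 / (real n + 2))^2"
      unfolding ab power_mult_distrib ..
    also have "\<dots> \<le> (2 * (a^2 + b^2)) * conv_weight n"
    proof (rule mult_mono)
      have "0 \<le> (a - b)^2" by simp
      then show "(a + b)^2 \<le> 2 * (a^2 + b^2)" by (simp add: power2_eq_square algebra_simps)
      show "(1 / (real n + 2))^2 \<le> conv_weight n"
        unfolding conv_weight_def power_divide power_one
        by (intro divide_left_mono power_mono mult_pos_pos) auto
    qed auto
    finally show "conv_weight i * conv_weight (n - i) \<le> 2 * conv_weight n * (conv_weight i + conv_weight (n - i))"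
      by (simp add: a_def b_def d conv_weight_def power_divide power_mult_distrib mult_ac)
  qed
  also have "\<dots> = 2 * conv_weight n * ((\<Sum>i\<le>n. conv_weight i) + (\<Sum>i\<le>n. conv_weight (n - i)))"
    by (simp only: sum_distrib_left[symmetric] sum.distrib)
  also have "(\<Sum>i\<le>n. conv_weight (n - i)) = (\<Sum>i\<le>n. conv_weight i)"
    by (rule sum.nat_diff_reindex[of _ "Suc n", unfolded lessThan_Suc_atMost, simplified])
  also have "2 * conv_weight n * ((\<Sum>i\<le>n. conv_weight i) + (\<Sum>i\<le>n. conv_weight i)) \<le> 2 * conv_weight n * (2 + 2)"
    using conv_weight_pos[of n] by (intro mult_left_mono add_mono sum_conv_weight_le) auto
  finally show ?thesis by simp
qed

text \<open>
  Each multiplication costs the factor \<open>8\<close> of the convolution of weights.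
\<close>

lemma fps_prod_nth_bound:
  fixes Y :: "'j \<Rightarrow> real fps"
  assumes "finite S" "A \<ge> 0" "B > 0"
    and "\<And>j i. j \<in> S \<Longrightarrow> i \<le> n \<Longrightarrow> \<bar>fps_nth (Y j) i\<bar> \<le> A * conv_weight i * B ^ i"
  shows "i \<le> n \<Longrightarrow> \<bar>fps_nth (\<Prod>j\<in>S. Y j) i\<bar> \<le> (8 * A) ^ card S * conv_weight i * B ^ i"
  using assms(1) assms(4)
proof (induction S arbitrary: i rule: finite_induct)
  case empty
  then show ?case using assms conv_weight_pos[of i] by (auto simp: conv_weight_def)
next
  case (insert a S)
  define p where "p = (\<Prod>j\<in>S. Y j)"
  have "\<bar>fps_nth (Y a * p) i\<bar> \<le> (\<Sum>l\<le>i. \<bar>fps_nth (Y a) l * fps_nth p (i - l)\<bar>)"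
    unfolding fps_mult_nth atLeast0AtMost by (rule sum_abs)
  also have "\<dots> \<le> (\<Sum>l\<le>i. (A * conv_weight l * B ^ l) * ((8 * A) ^ card S * conv_weight (i - l) * B ^ (i - l)))"
    unfolding abs_mult p_def using insert assms(2,3) conv_weight_pos
    by (intro sum_mono mult_mono insert) (auto intro!: mult_nonneg_nonneg simp: less_imp_le)
  also have "\<dots> = (\<Sum>l\<le>i. A * (8 * A) ^ card S * B ^ i * (conv_weight l * conv_weight (i - l)))"
  proof (rule sum.cong[OF refl])
    fix l assume "l \<in> {..i}"
    then have "B ^ i = B ^ l * B ^ (i - l)" by (simp flip: power_add)
    then show "(A * conv_weight l * B ^ l) * ((8 * A) ^ card S * conv_weight (i - l) * B ^ (i - l)) =
        A * (8 * A) ^ card S * B ^ i * (conv_weight l * conv_weight (i - l))"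
      by (simp add: mult_ac)
  qed
  also have "\<dots> \<le> A * (8 * A) ^ card S * B ^ i * (8 * conv_weight i)"
    unfolding sum_distrib_left[symmetric] using assms(2,3)
    by (intro mult_left_mono conv_weight_convolution) auto
  finally show ?case using insert by (simp add: p_def mult_ac)
qed

text \<open>
  The vector field \<open>x \<mapsto> M(x, \<dots>, x)\<close> applied to a formal curve, given by
  one power series for each basis direction.
\<close>

definition field_fps ::
    "(('i::finite \<Rightarrow> 'a::euclidean_space) \<Rightarrow> 'a) \<Rightarrow> ('a \<Rightarrow> real fps) \<Rightarrow> 'a \<Rightarrow> real fps" where
  "field_fps M Y b = (\<Sum>g | range g \<subseteq> Basis. fps_const (M g \<bullet> b) * (\<Prod>j\<in>UNIV. Y (g j)))"

lemma fps_prod_nth_cong: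
  fixes Y Z :: "'j \<Rightarrow> 'c::comm_ring_1 fps"
  assumes "finite S" "\<And>j i. j \<in> S \<Longrightarrow> i \<le> n \<Longrightarrow> fps_nth (Y j) i = fps_nth (Z j) i"
  shows "i \<le> n \<Longrightarrow> fps_nth (\<Prod>j\<in>S. Y j) i = fps_nth (\<Prod>j\<in>S. Z j) i"
  using assms
proof (induction S arbitrary: i rule: finite_induct)
  case (insert a S)
  then show ?case by (auto simp: fps_mult_nth intro!: sum.cong)
qed simp

lemma field_fps_nth_cong:
  assumes "\<And>d i. i \<le> n \<Longrightarrow> fps_nth (Y d) i = fps_nth (Z d) i"
  shows "fps_nth (field_fps M Y b) n = fps_nth (field_fps M Z b) n"
  unfolding field_fps_def fps_sum_nth fps_mult_left_const_nth
  by (intro sum.cong refl arg_cong2[of _ _ _ _ "(*)"] fps_prod_nth_cong[of _ n] assms) auto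

text \<open>
  Coefficient \<open>n + 1\<close> of a solution is determined by the coefficients up to
  \<open>n\<close>. Cutting the series off after \<open>n\<close> makes this a terminating
  recursion.
\<close>

fun solution_coeff ::
    "(('i::finite \<Rightarrow> 'a::euclidean_space) \<Rightarrow> 'a) \<Rightarrow> 'a \<Rightarrow> nat \<Rightarrow> 'a \<Rightarrow> real" where
  "solution_coeff M x 0 b = x \<bullet> b"
| "solution_coeff M x (Suc n) b =
     fps_nth (field_fps M (\<lambda>d. Abs_fps (\<lambda>i. if i \<le> n then solution_coeff M x i d else 0)) b) n
       / (real n + 1)"

lemma solution_coeff_Suc:
  "solution_coeff M x (Suc n) b =
     fps_nth (field_fps M (\<lambda>d. Abs_fps (\<lambda>i. solution_coeff M x i d)) b) n / (real n + 1)"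
  unfolding solution_coeff.simps
  by (intro arg_cong2[of _ _ _ _ "(/)"] field_fps_nth_cong) auto

lemma fps_deriv_solution:
  "fps_deriv (Abs_fps (\<lambda>i. solution_coeff M x i b)) =
     field_fps M (\<lambda>d. Abs_fps (\<lambda>i. solution_coeff M x i d)) b"
  by (rule fps_ext) (simp add: solution_coeff_Suc add.commute del: solution_coeff.simps)

text \<open>
  The number \<open>B\<close> absorbs the constants of the product estimate; the factor
  \<open>1/(n+1)\<close> from the integration compensates for the decay from one weight to the
  next, as \<open>(n+2)\<^sup>2 \<le> 4(n+1)\<^sup>3\<close>.
\<close>

lemma solution_coeff_bound:
  fixes M :: "('i::finite \<Rightarrow> 'a::euclidean_space) \<Rightarrow> 'a"
  assumes x: "norm x \<le> A" and A: "A \<ge> 1"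
    and B: "B = 1 + 4 * (8 * A) ^ CARD('i) * (\<Sum>g | range g \<subseteq> Basis. norm (M g))"
    and b: "b \<in> Basis"
  shows "\<bar>solution_coeff M x n b\<bar> \<le> A * conv_weight n * B ^ n"
  using b
proof (induction n arbitrary: b rule: less_induct)
  case (less n)
  have Bpos: "B \<ge> 1" using A by (simp add: B sum_nonneg)
  show ?case
  proof (cases n)
    case 0
    have "\<bar>x \<bullet> b\<bar> \<le> norm x" using less.prems by (rule Basis_le_norm)
    then show ?thesis using 0 x by (simp add: conv_weight_def)
  next
    case (Suc m)
    define Y where "Y d = Abs_fps (\<lambda>i. solution_coeff M x i d)" for d
    define K where "K = (8 * A) ^ CARD('i) * (\<Sum>g | range g \<subseteq> (Basis :: 'a set). norm (M (g :: 'i \<Rightarrow> 'a)))"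
    have K0: "K \<ge> 0" using A by (simp add: K_def sum_nonneg)
    have BK: "4 * K \<le> B" by (simp add: B K_def)
    have "\<bar>fps_nth (field_fps M Y b) m\<bar> \<le>
        (\<Sum>g | range g \<subseteq> (Basis :: 'a set). norm (M g) * ((8 * A) ^ CARD('i) * conv_weight m * B ^ m))"
      unfolding field_fps_def fps_sum_nth fps_mult_left_const_nth
    proof (rule order_trans[OF sum_abs], rule sum_mono)
      fix g :: "'i \<Rightarrow> 'a" assume "g \<in> {g. range g \<subseteq> Basis}"
      then have g: "g j \<in> Basis" for j by auto
      have "\<bar>fps_nth (\<Prod>j\<in>UNIV. Y (g j)) m\<bar> \<le> (8 * A) ^ CARD('i) * conv_weight m * B ^ m"
        by (rule fps_prod_nth_bound[of UNIV A B m])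
          (use A Bpos less.IH g in \<open>auto simp: Y_def Suc\<close>)
      moreover have "\<bar>M g \<bullet> b\<bar> \<le> norm (M g)" using less.prems by (rule Basis_le_norm)
      ultimately show "\<bar>M g \<bullet> b * fps_nth (\<Prod>j\<in>UNIV. Y (g j)) m\<bar> \<le> norm (M g) * ((8 * A) ^ CARD('i) * conv_weight m * B ^ m)"
        unfolding abs_mult by (intro mult_mono) auto
    qed
    also have "\<dots> = K * conv_weight m * B ^ m"
      by (simp add: K_def sum_distrib_left sum_distrib_right mult_ac)
    also have "K \<le> A * (B / 4)"
      using BK A Bpos mult_right_mono[of 1 A "B / 4"] by linarith
    finally have 1: "\<bar>fps_nth (field_fps M Y b) m\<bar> \<le> A * B / 4 * conv_weight m * B ^ m"
      using conv_weight_pos[of m] Bpos by (simp add: mult_right_mono less_imp_le)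
    have w: "conv_weight m / 4 / (real m + 1) \<le> conv_weight (Suc m)"
    proof -
      have "(real m + 2)^2 \<le> (2 * (real m + 1))^2" by (intro power_mono) auto
      also have "\<dots> = 4 * (real m + 1)^2 * 1" by (simp only: power_mult_distrib) simp
      also have "\<dots> \<le> 4 * (real m + 1)^2 * (real m + 1)"
        by (intro mult_left_mono) auto
      finally show ?thesis
        by (simp add: conv_weight_def divide_simps add.commute mult_ac)
    qed
    have "\<bar>solution_coeff M x n b\<bar> = \<bar>fps_nth (field_fps M Y b) m\<bar> / (real m + 1)"
      unfolding Suc solution_coeff_Suc Y_def by simp
    also have "\<dots> \<le> (A * B / 4 * conv_weight m * B ^ m) / (real m + 1)"
      using 1 by (intro divide_right_mono) auto
    also have "\<dots> = A * B ^ Suc m * (conv_weight m / 4 / (real m + 1))"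
      by simp
    also have "\<dots> \<le> A * B ^ Suc m * conv_weight (Suc m)"
      using A Bpos by (intro mult_left_mono w) auto
    finally show ?thesis by (simp add: Suc mult_ac)
  qed
qed

lemma fps_prod_eval:
  fixes Y :: "'j \<Rightarrow> real fps"
  assumes "finite S" "\<And>j. j \<in> S \<Longrightarrow> fps_conv_radius (Y j) \<ge> R" "ereal \<bar>s\<bar> < R"
  shows "fps_conv_radius (\<Prod>j\<in>S. Y j) \<ge> R \<and> eval_fps (\<Prod>j\<in>S. Y j) s = (\<Prod>j\<in>S. eval_fps (Y j) s)"
  using assms
proof (induction S rule: finite_induct)
  case (insert a S)
  have "fps_conv_radius (Y a * prod Y S) \<ge> R"
    using insert by (intro order_trans[OF _ fps_conv_radius_mult]) auto
  moreover have "eval_fps (Y a * prod Y S) s = eval_fps (Y a) s * eval_fps (prod Y S) s"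
    using insert by (intro eval_fps_mult) (auto intro: order_less_le_trans)
  ultimately show ?case using insert by simp
qed auto

lemma fps_sum_eval:
  fixes Y :: "'j \<Rightarrow> real fps"
  assumes "finite S" "\<And>j. j \<in> S \<Longrightarrow> fps_conv_radius (Y j) \<ge> R" "ereal \<bar>s\<bar> < R"
  shows "fps_conv_radius (\<Sum>j\<in>S. Y j) \<ge> R \<and> eval_fps (\<Sum>j\<in>S. Y j) s = (\<Sum>j\<in>S. eval_fps (Y j) s)"
  using assms
proof (induction S rule: finite_induct)
  case (insert a S)
  have "fps_conv_radius (Y a + sum Y S) \<ge> R"
    using insert by (intro order_trans[OF _ fps_conv_radius_add]) auto
  moreover have "eval_fps (Y a + sum Y S) s = eval_fps (Y a) s + eval_fps (sum Y S) s"
    using insert by (intro eval_fps_add) (auto intro: order_less_le_trans)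
  ultimately show ?case using insert by simp
qed auto

lemma field_fps_eval:
  fixes M :: "('i::finite \<Rightarrow> 'a::euclidean_space) \<Rightarrow> 'a"
  assumes "\<And>d. d \<in> Basis \<Longrightarrow> fps_conv_radius (Y d) \<ge> R" "ereal \<bar>s\<bar> < R"
  shows "eval_fps (field_fps M Y b) s =
    (\<Sum>g | range g \<subseteq> Basis. (M g \<bullet> b) * (\<Prod>j\<in>UNIV. eval_fps (Y (g j)) s))"
proof -
  have prd: "fps_conv_radius (\<Prod>j\<in>UNIV. Y (g j)) \<ge> R \<and>
      eval_fps (\<Prod>j\<in>UNIV. Y (g j)) s = (\<Prod>j\<in>UNIV. eval_fps (Y (g j)) s)"
    if "range g \<subseteq> Basis" for g :: "'i \<Rightarrow> 'a"
    using that by (intro fps_prod_eval assms) auto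
  have trm: "fps_conv_radius (fps_const (M g \<bullet> b) * (\<Prod>j\<in>UNIV. Y (g j))) \<ge> R \<and>
      eval_fps (fps_const (M g \<bullet> b) * (\<Prod>j\<in>UNIV. Y (g j))) s = (M g \<bullet> b) * (\<Prod>j\<in>UNIV. eval_fps (Y (g j)) s)"
    if "range g \<subseteq> Basis" for g :: "'i \<Rightarrow> 'a"
  proof
    show "fps_conv_radius (fps_const (M g \<bullet> b) * (\<Prod>j\<in>UNIV. Y (g j))) \<ge> R"
      using prd[OF that] by (intro order_trans[OF _ fps_conv_radius_mult]) auto
    show "eval_fps (fps_const (M g \<bullet> b) * (\<Prod>j\<in>UNIV. Y (g j))) s = (M g \<bullet> b) * (\<Prod>j\<in>UNIV. eval_fps (Y (g j)) s)"
      using prd[OF that] assms(2) by (subst eval_fps_mult) (auto intro: order_less_le_trans)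
  qed
  show ?thesis unfolding field_fps_def
    using trm by (subst fps_sum_eval[THEN conjunct2, of _ R]) (auto intro: assms(2))
qed

text \<open>
  The radius is uniform over the initial values in a ball. This is what allows a solution to be
  restarted at each of its points without losing control of the radius.
\<close>

lemma analytic_solution:
  fixes M :: "('i::finite \<Rightarrow> 'a::euclidean_space) \<Rightarrow> 'a"
  assumes M: "multilinear M"
  shows "\<exists>r>0. \<forall>x. norm x \<le> R \<longrightarrow> (\<exists>y c. y 0 = x \<and> (\<forall>s. \<bar>s\<bar> < r \<longrightarrow>
           (\<lambda>i. s ^ i *\<^sub>R c i) sums y s \<and> (y has_vector_derivative M (\<lambda>_. y s)) (at s)))"
proof -
  define A where "A = max R 1"
  define B where "B = 1 + 4 * (8 * A) ^ CARD('i) * (\<Sum>g | range g \<subseteq> (Basis :: 'a set). norm (M (g :: 'i \<Rightarrow> 'a)))"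
  have A: "A \<ge> 1" "R \<le> A" by (auto simp: A_def)
  have B: "B \<ge> 1" using A by (simp add: B_def sum_nonneg)
  have "\<exists>y c. y 0 = x \<and> (\<forall>s. \<bar>s\<bar> < 1 / B \<longrightarrow>
           (\<lambda>i. s ^ i *\<^sub>R c i) sums y s \<and> (y has_vector_derivative M (\<lambda>_. y s)) (at s))"
    if x: "norm x \<le> R" for x
  proof -
    define Y where "Y d = Abs_fps (\<lambda>i. solution_coeff M x i d)" for d
    have rad: "fps_conv_radius (Y d) \<ge> ereal (1 / B)" if d: "d \<in> Basis" for d
      unfolding fps_conv_radius_def
    proof (rule conv_radius_geI_ex')
      fix r :: real assume r: "0 < r" "ereal r < ereal (1 / B)"
      then have rB: "B * r < 1" using B by (simp add: field_simps)
      show "summable (\<lambda>n. fps_nth (Y d) n * of_real r ^ n)"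
      proof (rule summable_comparison_test')
        show "summable (\<lambda>n. A * (B * r) ^ n)"
          using rB r B by (intro summable_mult summable_geometric) auto
        show "norm (fps_nth (Y d) n * of_real r ^ n) \<le> A * (B * r) ^ n" for n
        proof -
          have w1: "conv_weight n \<le> 1" by (simp add: conv_weight_def)
          have "\<bar>solution_coeff M x n d\<bar> \<le> A * conv_weight n * B ^ n"
            by (rule solution_coeff_bound[OF _ _ B_def d]) (use x A in auto)
          also have "\<dots> \<le> A * 1 * B ^ n"
            using w1 A B by (intro mult_right_mono mult_left_mono) auto
          finally have "\<bar>solution_coeff M x n d\<bar> * r ^ n \<le> A * 1 * B ^ n * r ^ n"
            using r by (intro mult_right_mono) auto
          then show ?thesis using r by (simp add: Y_def abs_mult power_mult_distrib mult_ac)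
        qed
      qed
    qed
    define y where "y s = (\<Sum>b\<in>Basis. eval_fps (Y b) s *\<^sub>R b)" for s
    define c where "c i = (\<Sum>b\<in>Basis. fps_nth (Y b) i *\<^sub>R b)" for i
    have yb: "y s \<bullet> b = eval_fps (Y b) s" if "b \<in> Basis" for s b
      using that by (simp add: y_def)
    have "(\<lambda>i. s ^ i *\<^sub>R c i) sums y s \<and> (y has_vector_derivative M (\<lambda>_. y s)) (at s)"
      if s: "\<bar>s\<bar> < 1 / B" for s
    proof
      have sR: "ereal \<bar>s\<bar> < fps_conv_radius (Y d)" if "d \<in> Basis" for d
        using rad[OF that] s by (metis ereal_less(1) less_ereal.simps(1) order_less_le_trans)
      have "(\<lambda>i. \<Sum>b\<in>Basis. (fps_nth (Y b) i * s ^ i) *\<^sub>R b) sums y s"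
        unfolding y_def
        by (intro sums_sum bounded_linear.sums[OF bounded_linear_scaleR_left] sums_eval_fps)
          (use sR in auto)
      then show "(\<lambda>i. s ^ i *\<^sub>R c i) sums y s"
        by (simp add: c_def scaleR_sum_right mult.commute)
      have "M (\<lambda>_. y s) \<bullet> b = eval_fps (fps_deriv (Y b)) s" if b: "b \<in> Basis" for b
      proof -
        have "M (\<lambda>_. y s) \<bullet> b = (\<Sum>g | range g \<subseteq> Basis. (M g \<bullet> b) * (\<Prod>j\<in>UNIV. y s \<bullet> g j))"
          unfolding multilinear_expand[OF M, of "\<lambda>_. y s"] by (simp add: inner_sum_left mult.commute)
        also have "\<dots> = (\<Sum>g | range g \<subseteq> Basis. (M g \<bullet> b) * (\<Prod>j\<in>UNIV. eval_fps (Y (g j)) s))"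
          by (intro sum.cong refl arg_cong2[of _ _ _ _ "(*)"] prod.cong yb) auto
        also have "\<dots> = eval_fps (field_fps M Y b) s"
          by (rule field_fps_eval[symmetric, where R = "ereal (1 / B)"]) (use rad s in auto)
        also have "field_fps M Y b = fps_deriv (Y b)"
          unfolding Y_def fps_deriv_solution ..
        finally show ?thesis .
      qed
      then have "M (\<lambda>_. y s) = (\<Sum>b\<in>Basis. eval_fps (fps_deriv (Y b)) s *\<^sub>R b)"
        by (subst euclidean_representation[symmetric]) (auto intro!: sum.cong)
      moreover have "(y has_vector_derivative (\<Sum>b\<in>Basis. eval_fps (fps_deriv (Y b)) s *\<^sub>R b)) (at s)"
        unfolding y_def
        by (auto intro!: derivative_eq_intros has_field_derivative_eval_fps sR)
      ultimately show "(y has_vector_derivative M (\<lambda>_. y s)) (at s)" by simp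
    qed
    moreover have "y 0 = x"
      by (simp add: y_def eval_fps_at_0 Y_def euclidean_representation)
    ultimately show ?thesis by blast
  qed
  then show ?thesis using B by (intro exI[of _ "1 / B"]) auto
qed

section \<open>Uniqueness of solutions\<close>

text \<open>
  Under the hypotheses \<open>\<bar>f\<bar>\<^sup>2 e\<^sup>-\<^sup>2\<^sup>C\<^sup>t\<close> is
  nonincreasing and \<open>\<bar>f\<bar>\<^sup>2 e\<^sup>2\<^sup>C\<^sup>t\<close> is
  nondecreasing.
\<close>

lemma gronwall_zero:
  fixes f :: "real \<Rightarrow> 'a::euclidean_space"
  assumes d: "\<And>t. t \<in> {a..b} \<Longrightarrow> (f has_vector_derivative f' t) (at t)"
    and le: "\<And>t. t \<in> {a..b} \<Longrightarrow> norm (f' t) \<le> C * norm (f t)"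
    and t0: "t0 \<in> {a..b}" "f t0 = 0" and t: "t \<in> {a..b}"
  shows "f t = 0"
proof -
  define g where "g s t = f t \<bullet> f t * exp (- 2 * s * C * t)" for s t
  have g: "(g s has_real_derivative (2 * (f t \<bullet> f' t) - 2 * s * C * (f t \<bullet> f t)) * exp (- 2 * s * C * t)) (at t)"
    if "t \<in> {a..b}" for s t
    unfolding g_def has_real_derivative_iff_has_vector_derivative
    using d[OF that] unfolding has_vector_derivative_def
    by (auto intro!: derivative_eq_intros simp: algebra_simps inner_commute)
  have cs: "\<bar>f t \<bullet> f' t\<bar> \<le> C * (f t \<bullet> f t)" if "t \<in> {a..b}" for t
  proof -
    have "\<bar>f t \<bullet> f' t\<bar> \<le> norm (f t) * norm (f' t)" by (rule Cauchy_Schwarz_ineq2)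
    also have "\<dots> \<le> norm (f t) * (C * norm (f t))" using le[OF that] by (intro mult_left_mono) auto
    finally show ?thesis by (simp add: dot_square_norm power2_eq_square mult_ac)
  qed
  have g0: "g s t0 = 0" for s using t0 by (simp add: g_def)
  show ?thesis
  proof (cases "t0 \<le> t")
    case True
    have "g 1 t \<le> g 1 t0"
    proof (rule DERIV_nonpos_imp_nonincreasing[OF True])
      fix x assume x: "t0 \<le> x" "x \<le> t"
      then have "x \<in> {a..b}" using t t0 by auto
      with g[of x 1] cs[of x] show "\<exists>y. (g 1 has_real_derivative y) (at x) \<and> y \<le> 0"
        by (intro exI conjI) (auto intro!: mult_nonpos_nonneg)
    qed
    then have "f t \<bullet> f t \<le> 0" using g0 by (simp add: g_def mult_le_0_iff)
    then show ?thesis by (metis inner_gt_zero_iff not_less)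
  next
    case False
    then have "t \<le> t0" by simp
    then have "g (-1) t \<le> g (-1) t0"
    proof (rule DERIV_nonneg_imp_nondecreasing)
      fix x assume x: "t \<le> x" "x \<le> t0"
      then have "x \<in> {a..b}" using t t0 by auto
      with g[of x "-1"] cs[of x] show "\<exists>y. (g (-1) has_real_derivative y) (at x) \<and> y \<ge> 0"
        by (intro exI conjI) (auto intro!: mult_nonneg_nonneg)
    qed
    then have "f t \<bullet> f t \<le> 0" using g0 by (simp add: g_def mult_le_0_iff)
    then show ?thesis by (metis inner_gt_zero_iff not_less)
  qed
qed

text \<open>
  On the compact interval between \<open>t0\<close> and \<open>t\<close> both solutions stay in a
  ball, where a single Lipschitz constant applies.
\<close>

lemma ode_unique:
  fixes y z :: "real \<Rightarrow> 'a::euclidean_space" and F :: "'a \<Rightarrow> 'a"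
  assumes lip: "\<And>R. \<exists>L. \<forall>u v. norm u \<le> R \<longrightarrow> norm v \<le> R \<longrightarrow> norm (F u - F v) \<le> L * norm (u - v)"
    and y: "\<And>t. t \<in> {a<..<b} \<Longrightarrow> (y has_vector_derivative F (y t)) (at t)"
    and z: "\<And>t. t \<in> {a<..<b} \<Longrightarrow> (z has_vector_derivative F (z t)) (at t)"
    and t0: "t0 \<in> {a<..<b}" "y t0 = z t0" and t: "t \<in> {a<..<b}"
  shows "y t = z t"
proof -
  define p q where "p = min t0 t" and "q = max t0 t"
  have pq: "{p..q} \<subseteq> {a<..<b}" using t0 t by (auto simp: p_def q_def)
  have "continuous_on {p..q} y" "continuous_on {p..q} z"
    using y z pq by (meson continuous_at_imp_continuous_on has_vector_derivative_continuous subsetD)+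
  then have "compact (y ` {p..q})" "compact (z ` {p..q})"
    by (auto intro: compact_continuous_image)
  then have "bounded (y ` {p..q} \<union> z ` {p..q})" by (simp add: compact_imp_bounded)
  then obtain R where R: "\<And>u. u \<in> y ` {p..q} \<union> z ` {p..q} \<Longrightarrow> norm u \<le> R"
    unfolding bounded_iff by blast
  obtain L where L: "\<And>u v. norm u \<le> R \<Longrightarrow> norm v \<le> R \<Longrightarrow> norm (F u - F v) \<le> L * norm (u - v)"
    using lip by blast
  have "y t - z t = 0"
  proof (rule gronwall_zero[where f = "\<lambda>t. y t - z t" and a = p and b = q and ?t0.0 = t0 and C = L])
    fix t assume "t \<in> {p..q}"
    then show "((\<lambda>t. y t - z t) has_vector_derivative F (y t) - F (z t)) (at t)"
      using pq by (intro has_vector_derivative_diff y z) auto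
    show "norm (F (y t) - F (z t)) \<le> L * norm (y t - z t)"
      using \<open>t \<in> {p..q}\<close> by (intro L R) auto
  qed (use t0 t in \<open>auto simp: p_def q_def\<close>)
  then show ?thesis by simp
qed

text \<open>
  A solution given by a series around \<open>0\<close> has series around all other points: the
  solution restarted at \<open>y t\<close> is a power series around \<open>t\<close>, and it
  agrees with \<open>y\<close> by uniqueness.
\<close>

lemma analytic_flow:
  fixes M :: "('i::finite \<Rightarrow> 'a::euclidean_space) \<Rightarrow> 'a"
  assumes M: "multilinear M"
  shows "\<exists>\<epsilon>>0. \<exists>y. y 0 = x \<and> real_analytic_on y {-\<epsilon><..<\<epsilon>} \<and>
           (\<forall>t\<in>{-\<epsilon><..<\<epsilon>}. (y has_vector_derivative M (\<lambda>_. y t)) (at t))"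
proof -
  obtain r y where r: "r > 0" and y0: "y 0 = x"
    and dy: "\<And>s. \<bar>s\<bar> < r \<Longrightarrow> (y has_vector_derivative M (\<lambda>_. y s)) (at s)"
    using analytic_solution[OF M, of "norm x"] by blast
  \<comment> \<open>a smaller interval, on whose closure the solution is bounded\<close>
  define e where "e = r / 2"
  have e: "e > 0" "e < r" using r by (auto simp: e_def)
  have "continuous_on {-e..e} y"
    by (intro continuous_at_imp_continuous_on ballI has_vector_derivative_continuous[OF dy])
      (use e in auto)
  then have "bounded (y ` {-e..e})" by (intro compact_imp_bounded compact_continuous_image) auto
  then obtain R where R: "\<And>s. s \<in> {-e..e} \<Longrightarrow> norm (y s) \<le> R"
    unfolding bounded_iff by blast
  obtain d where d: "d > 0" and sol: "\<And>x. norm x \<le> R \<Longrightarrow> (\<exists>y c. y 0 = x \<and> (\<forall>s. \<bar>s\<bar> < d \<longrightarrow>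
      (\<lambda>i. s ^ i *\<^sub>R c i) sums y s \<and> (y has_vector_derivative M (\<lambda>_. y s)) (at s)))"
    using analytic_solution[OF M, of R] by blast
  have "real_analytic_on y {-e<..<e}"
    unfolding real_analytic_on_def
  proof
    fix t assume t: "t \<in> {-e<..<e}"
    then have "norm (y t) \<le> R" by (intro R) auto
    then obtain z c where z0: "z 0 = y t" and zs: "\<And>s. \<bar>s\<bar> < d \<Longrightarrow> (\<lambda>i. s ^ i *\<^sub>R c i) sums z s"
      and dz: "\<And>s. \<bar>s\<bar> < d \<Longrightarrow> (z has_vector_derivative M (\<lambda>_. z s)) (at s)"
      using sol by blast
    \<comment> \<open>within the radius of the restarted series and within the interval of the solution\<close>
    define \<rho> where "\<rho> = min d (min (t + e) (e - t))"
    have \<rho>: "\<rho> > 0" "\<rho> \<le> d" "\<rho> \<le> t + e" "\<rho> \<le> e - t" using t d by (auto simp: \<rho>_def)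
    have eq: "z (s - t) = y s" if s: "\<bar>s - t\<bar> < \<rho>" for s
    proof (rule ode_unique[where F = "\<lambda>u. M (\<lambda>_. u)" and a = "t - \<rho>" and b = "t + \<rho>" and ?t0.0 = t])
      fix \<tau> assume \<tau>: "\<tau> \<in> {t - \<rho><..<t + \<rho>}"
      have "((\<lambda>\<tau>. z (\<tau> - t)) has_vector_derivative 1 *\<^sub>R M (\<lambda>_. z (\<tau> - t))) (at \<tau>)"
        using vector_diff_chain_at[of "\<lambda>\<tau>. \<tau> - t" 1 \<tau> z, OF _ dz] \<tau> \<rho>
        by (auto simp: o_def has_vector_derivative_diff_const)
      then show "((\<lambda>\<tau>. z (\<tau> - t)) has_vector_derivative M (\<lambda>_. z (\<tau> - t))) (at \<tau>)" by simp
      show "(y has_vector_derivative M (\<lambda>_. y \<tau>)) (at \<tau>)"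
        using \<tau> \<rho> e by (intro dy) auto
    qed (use multilinear_diagonal_lipschitz[OF M] s \<rho> z0 in auto)
    have "(\<lambda>i. (s - t) ^ i *\<^sub>R c i) sums y s" if "\<bar>s - t\<bar> < \<rho>" for s
      using zs[of "s - t"] eq[OF that] that \<rho> by auto
    then show "\<exists>r>0. \<exists>c. \<forall>s. \<bar>s - t\<bar> < r \<longrightarrow> (\<lambda>i. (s - t) ^ i *\<^sub>R c i) sums y s"
      using \<rho> by blast
  qed
  then show ?thesis using e y0 dy by (intro exI[of _ e]) (auto intro!: exI[of _ y])
qed

section \<open>Calculus of smooth maps\<close>

lemma Ck_on_cong:
  assumes "open U" "\<And>x. x \<in> U \<Longrightarrow> f x = g x" "Ck_on n f U"
  shows "Ck_on n g U"
  using assms(2,3)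
proof (induction n arbitrary: f g)
  case 0
  then show ?case by (auto cong: continuous_on_cong)
next
  case (Suc n)
  have d: "(g has_derivative frechet_derivative f (at x)) (at x)" if "x \<in> U" for x
    using Suc.prems(2) that
    by (intro has_derivative_transform_within_open[OF _ assms(1) that Suc.prems(1)])
      (auto simp: frechet_derivative_works[symmetric])
  have eq: "frechet_derivative f (at x) = frechet_derivative g (at x)" if "x \<in> U" for x
    using d[OF that] by (rule frechet_derivative_at)
  have "Ck_on n (\<lambda>x. frechet_derivative g (at x) v) U" for v
    by (rule Suc.IH[of "\<lambda>x. frechet_derivative f (at x) v"]) (use eq Suc.prems(2) in auto)
  then show ?case using d by (auto simp: differentiable_def)
qed

lemma Ck_on_subset: "Ck_on n f U \<Longrightarrow> T \<subseteq> U \<Longrightarrow> Ck_on n f T"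
  by (induction n arbitrary: f) (auto intro: continuous_on_subset)

lemma smooth_on_subset: "smooth_on f U \<Longrightarrow> T \<subseteq> U \<Longrightarrow> smooth_on f T"
  by (auto simp: smooth_on_def intro: Ck_on_subset)

lemma smooth_on_has_derivative:
  "smooth_on f U \<Longrightarrow> x \<in> U \<Longrightarrow> (f has_derivative frechet_derivative f (at x)) (at x)"
  unfolding smooth_on_def by (metis Ck_on.simps(2) frechet_derivative_works)

lemma smooth_on_continuous: "smooth_on f U \<Longrightarrow> continuous_on U f"
  unfolding smooth_on_def by (metis Ck_on.simps(1))

lemma smooth_on_directional: "smooth_on f U \<Longrightarrow> smooth_on (\<lambda>x. frechet_derivative f (at x) v) U"
  unfolding smooth_on_def by (metis Ck_on.simps(2))

lemma smooth_on_linear_compose: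
  assumes A: "linear A" and U: "open U" and f: "smooth_on f U"
  shows "smooth_on (\<lambda>x. A (f x)) U"
proof -
  have bl: "bounded_linear A" using A by (simp add: linear_conv_bounded_linear)
  have "Ck_on n f U \<Longrightarrow> Ck_on n (\<lambda>x. A (f x)) U" for n
  proof (induction n arbitrary: f)
    case 0
    then show ?case by (auto intro: bounded_linear.continuous_on[OF bl])
  next
    case (Suc n)
    have d: "((\<lambda>x. A (f x)) has_derivative (\<lambda>v. A (frechet_derivative f (at x) v))) (at x)" if "x \<in> U" for x
      using Suc.prems that
      by (intro bounded_linear.has_derivative[OF bl]) (auto simp: frechet_derivative_works[symmetric])
    have "Ck_on n (\<lambda>x. frechet_derivative (\<lambda>x. A (f x)) (at x) v) U" for v
      by (rule Ck_on_cong[OF U _ Suc.IH[of "\<lambda>x. frechet_derivative f (at x) v"]])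
        (use Suc.prems frechet_derivative_at[OF d] in \<open>auto simp: fun_eq_iff\<close>)
    then show ?case using d by (auto simp: differentiable_def)
  qed
  then show ?thesis using f by (auto simp: smooth_on_def)
qed

lemma smooth_on_line:
  fixes f :: "'a::euclidean_space \<Rightarrow> 'b::euclidean_space"
  assumes V: "open V" and f: "smooth_on f V" and T: "open T" "\<And>\<tau>. \<tau> \<in> T \<Longrightarrow> a + \<tau> *\<^sub>R w \<in> V"
  shows "smooth_on (\<lambda>\<tau>::real. f (a + \<tau> *\<^sub>R w)) T"
proof -
  have "Ck_on n f V \<Longrightarrow> Ck_on n (\<lambda>\<tau>::real. f (a + \<tau> *\<^sub>R w)) T" for n
  proof (induction n arbitrary: f)
    case 0
    then show ?case using T
      by (auto intro!: continuous_on_compose2[of V f] continuous_intros)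
  next
    case (Suc n)
    have d: "((\<lambda>\<tau>. f (a + \<tau> *\<^sub>R w)) has_derivative (\<lambda>h. frechet_derivative f (at (a + \<tau> *\<^sub>R w)) (h *\<^sub>R w))) (at \<tau>)"
      if "\<tau> \<in> T" for \<tau>
    proof -
      have "((\<lambda>\<tau>. a + \<tau> *\<^sub>R w) has_derivative (\<lambda>h. h *\<^sub>R w)) (at \<tau>)"
        by (auto intro!: derivative_eq_intros)
      moreover have "(f has_derivative frechet_derivative f (at (a + \<tau> *\<^sub>R w))) (at (a + \<tau> *\<^sub>R w))"
        using Suc.prems T(2)[OF that] by (auto simp: frechet_derivative_works[symmetric])
      ultimately show ?thesis by (rule has_derivative_compose)
    qed
    have "Ck_on n (\<lambda>x. frechet_derivative (\<lambda>\<tau>. f (a + \<tau> *\<^sub>R w)) (at x) v) T" for v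
      by (rule Ck_on_cong[OF T(1) _ Suc.IH[of "\<lambda>x. frechet_derivative f (at x) (v *\<^sub>R w)"]])
        (use Suc.prems frechet_derivative_at[OF d] in \<open>auto simp: fun_eq_iff\<close>)
    then show ?case using d by (auto simp: differentiable_def)
  qed
  then show ?thesis using f by (auto simp: smooth_on_def)
qed

lemma power_series_has_vector_derivative:
  fixes f :: "real \<Rightarrow> 'b::euclidean_space"
  assumes f: "\<And>s. \<bar>s\<bar> < r \<Longrightarrow> (\<lambda>i. s ^ i *\<^sub>R c i) sums f s"
  shows "\<exists>f'. \<forall>s. \<bar>s\<bar> < r \<longrightarrow> (f has_vector_derivative f' s) (at s) \<and>
           (\<lambda>i. s ^ i *\<^sub>R (real (Suc i) *\<^sub>R c (Suc i))) sums f' s"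
proof -
  define g where "g b s = (\<Sum>n. diffs (\<lambda>i. c i \<bullet> b) n * s ^ n)" for b s
  have sm: "(\<lambda>i. (c i \<bullet> b) * s ^ i) sums (f s \<bullet> b)" if "\<bar>s\<bar> < r" for s b
    using bounded_linear.sums[OF bounded_linear_inner_left f[OF that], of b]
    by (simp add: mult.commute)
  have g: "((\<lambda>s. f s \<bullet> b) has_real_derivative g b s) (at s)" if s: "\<bar>s\<bar> < r" for s b
  proof -
    have "((\<lambda>s. \<Sum>n. (c n \<bullet> b) * s ^ n) has_real_derivative g b s) (at s)"
      unfolding g_def by (rule termdiffs_strong'[where K = r]) (use sm s in \<open>auto simp: sums_iff\<close>)
    then show ?thesis
    proof (rule has_field_derivative_transform_within_open)
      show "open {-r<..<r}" "s \<in> {-r<..<r}" using s by auto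
      show "(\<Sum>n. (c n \<bullet> b) * t ^ n) = f t \<bullet> b" if "t \<in> {-r<..<r}" for t
        using sm[of t b] that by (auto simp: sums_iff)
    qed
  qed
  have gs: "(\<lambda>n. diffs (\<lambda>i. c i \<bullet> b) n * s ^ n) sums g b s" if s: "\<bar>s\<bar> < r" for s b
    unfolding g_def
    by (intro summable_sums termdiff_converges[of s r]) (use sm s in \<open>auto simp: sums_iff\<close>)
  define f' where "f' s = (\<Sum>b\<in>Basis. g b s *\<^sub>R b)" for s
  have "(f has_vector_derivative f' s) (at s) \<and>
      (\<lambda>i. s ^ i *\<^sub>R (real (Suc i) *\<^sub>R c (Suc i))) sums f' s" if s: "\<bar>s\<bar> < r" for s
  proof
    have "((\<lambda>s. \<Sum>b\<in>Basis. (f s \<bullet> b) *\<^sub>R b) has_vector_derivative f' s) (at s)"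
      unfolding f'_def using g[OF s]
      by (auto intro!: derivative_eq_intros)
    then show "(f has_vector_derivative f' s) (at s)" by (simp add: euclidean_representation)
    have "(\<lambda>n. \<Sum>b\<in>Basis. (diffs (\<lambda>i. c i \<bullet> b) n * s ^ n) *\<^sub>R b) sums f' s"
      unfolding f'_def
      by (intro sums_sum bounded_linear.sums[OF bounded_linear_scaleR_left] gs s)
    moreover have "(\<Sum>b\<in>Basis. (diffs (\<lambda>i. c i \<bullet> b) n * s ^ n) *\<^sub>R b) = s ^ n *\<^sub>R (real (Suc n) *\<^sub>R c (Suc n))" for n
      by (rule euclidean_eqI) (simp add: diffs_def inner_sum_left inner_Basis if_distrib cong: if_cong)
    ultimately show "(\<lambda>i. s ^ i *\<^sub>R (real (Suc i) *\<^sub>R c (Suc i))) sums f' s" by simp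
  qed
  then show ?thesis by blast
qed

text \<open>
  The derivative of a convergent series is again one, with the same radius.
\<close>

lemma power_series_smooth:
  fixes f :: "real \<Rightarrow> 'b::euclidean_space"
  assumes f: "\<And>s. \<bar>s\<bar> < r \<Longrightarrow> (\<lambda>i. s ^ i *\<^sub>R c i) sums f s"
  shows "smooth_on f {-r<..<r}"
proof -
  have "Ck_on n f {-r<..<r}" for n
    using f
  proof (induction n arbitrary: f c)
    case (0 f c)
    obtain f' where "\<And>s. \<bar>s\<bar> < r \<Longrightarrow> (f has_vector_derivative f' s) (at s)"
      using power_series_has_vector_derivative[of r c f] 0 by blast
    then have "isCont f s" if "\<bar>s\<bar> < r" for s
      using that has_vector_derivative_continuous by blast
    then show ?case by (auto intro!: continuous_at_imp_continuous_on)
  next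
    case (Suc n f c)
    obtain f' where d: "\<And>s. \<bar>s\<bar> < r \<Longrightarrow> (f has_vector_derivative f' s) (at s)"
      and f': "\<And>s. \<bar>s\<bar> < r \<Longrightarrow> (\<lambda>i. s ^ i *\<^sub>R (real (Suc i) *\<^sub>R c (Suc i))) sums f' s"
      using power_series_has_vector_derivative[of r c f] Suc.prems by blast
    have fr: "frechet_derivative f (at s) v = v *\<^sub>R f' s" if "\<bar>s\<bar> < r" for s v
      using frechet_derivative_at[OF d[OF that, unfolded has_vector_derivative_def]] by (metis (no_types))
    have "Ck_on n (\<lambda>x. frechet_derivative f (at x) v) {-r<..<r}" for v
    proof (rule Suc.IH)
      fix s assume s: "\<bar>s\<bar> < r"
      have "(\<lambda>i. v *\<^sub>R (s ^ i *\<^sub>R (real (Suc i) *\<^sub>R c (Suc i)))) sums (v *\<^sub>R f' s)"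
        by (intro sums_scaleR_right f' s)
      then show "(\<lambda>i. s ^ i *\<^sub>R (v *\<^sub>R (real (Suc i) *\<^sub>R c (Suc i)))) sums frechet_derivative f (at s) v"
        by (simp only: fr[OF s] scaleR_scaleR mult_ac)
    qed
    moreover have "f differentiable (at s)" if "\<bar>s\<bar> < r" for s
      using d[OF that] by (auto simp: differentiable_def has_vector_derivative_def)
    ultimately show ?case by (auto simp: abs_less_iff)
  qed
  then show ?thesis by (simp add: smooth_on_def)
qed

text \<open>
  Two applications of the mean value theorem: in the direction \<open>u\<close> to the increment
  along \<open>v\<close>, then in the direction \<open>v\<close> to the derivative along
  \<open>u\<close>.
\<close>

lemma second_difference_mean_value:
  fixes f :: "'a::euclidean_space \<Rightarrow> real"
  assumes V: "open V" and f: "smooth_on f V" and h: "h > 0"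
    and seg: "\<And>s t. 0 \<le> s \<Longrightarrow> s \<le> h \<Longrightarrow> 0 \<le> t \<Longrightarrow> t \<le> h \<Longrightarrow> x + s *\<^sub>R u + t *\<^sub>R v \<in> V"
  shows "\<exists>s t. 0 \<le> s \<and> s \<le> h \<and> 0 \<le> t \<and> t \<le> h \<and>
    f (x + h *\<^sub>R u + h *\<^sub>R v) - f (x + h *\<^sub>R u) - f (x + h *\<^sub>R v) + f x =
      h * h * frechet_derivative (\<lambda>y. frechet_derivative f (at y) u) (at (x + s *\<^sub>R u + t *\<^sub>R v)) v"
proof -
  define fu where "fu y = frechet_derivative f (at y) u" for y
  have fu: "smooth_on fu V" unfolding fu_def by (rule smooth_on_directional[OF f])
  have line: "((\<lambda>s. g (a + s *\<^sub>R w)) has_real_derivative frechet_derivative g (at (a + s *\<^sub>R w)) w) (at s)"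
    if "smooth_on g V" "a + s *\<^sub>R w \<in> V" for g :: "'a \<Rightarrow> real" and a w s
  proof -
    have "((\<lambda>s. a + s *\<^sub>R w) has_derivative (\<lambda>h. h *\<^sub>R w)) (at s)"
      by (auto intro!: derivative_eq_intros)
    from has_derivative_compose[OF this smooth_on_has_derivative[OF that]]
    have "((\<lambda>s. g (a + s *\<^sub>R w)) has_derivative (\<lambda>h. frechet_derivative g (at (a + s *\<^sub>R w)) (h *\<^sub>R w))) (at s)" .
    moreover have "linear (frechet_derivative g (at (a + s *\<^sub>R w)))"
      using smooth_on_has_derivative[OF that] by (rule has_derivative_linear)
    ultimately show ?thesis
      by (simp add: has_field_derivative_def linear_cmul mult.commute[of _ "frechet_derivative g _ w"] cong: )
  qed
  define q where "q s = f ((x + h *\<^sub>R v) + s *\<^sub>R u) - f (x + s *\<^sub>R u)" for s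
  have "\<exists>z>0. z < h \<and> q h - q 0 = (h - 0) * (fu ((x + h *\<^sub>R v) + z *\<^sub>R u) - fu (x + z *\<^sub>R u))"
  proof (rule MVT2[OF h])
    fix s assume s: "0 \<le> s" "s \<le> h"
    show "(q has_real_derivative fu ((x + h *\<^sub>R v) + s *\<^sub>R u) - fu (x + s *\<^sub>R u)) (at s)"
      unfolding q_def fu_def
      by (intro DERIV_diff line f) (use seg[of s h] seg[of s 0] s h in \<open>auto simp: algebra_simps\<close>)
  qed
  then obtain s where s: "0 < s" "s < h"
    and q: "q h - q 0 = h * (fu ((x + s *\<^sub>R u) + h *\<^sub>R v) - fu ((x + s *\<^sub>R u) + 0 *\<^sub>R v))"
    by (auto simp: algebra_simps)
  have "\<exists>z>0. z < h \<and> fu ((x + s *\<^sub>R u) + h *\<^sub>R v) - fu ((x + s *\<^sub>R u) + 0 *\<^sub>R v) =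
      (h - 0) * frechet_derivative fu (at ((x + s *\<^sub>R u) + z *\<^sub>R v)) v"
    by (rule MVT2[OF h], rule line[OF fu], rule seg) (use s in auto)
  then obtain t where t: "0 < t" "t < h"
    and "fu ((x + s *\<^sub>R u) + h *\<^sub>R v) - fu ((x + s *\<^sub>R u) + 0 *\<^sub>R v) =
      h * frechet_derivative fu (at ((x + s *\<^sub>R u) + t *\<^sub>R v)) v" by auto
  then have "q h - q 0 = h * h * frechet_derivative fu (at (x + s *\<^sub>R u + t *\<^sub>R v)) v"
    using q by simp
  then show ?thesis
    using s t unfolding fu_def[symmetric]
    by (intro exI[of _ s] exI[of _ t]) (simp add: q_def algebra_simps)
qed

lemma second_difference_limit:
  fixes f :: "'a::euclidean_space \<Rightarrow> real"
  assumes V: "open V" and f: "smooth_on f V" and x: "x \<in> V"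
  shows "((\<lambda>h. (f (x + h *\<^sub>R u + h *\<^sub>R v) - f (x + h *\<^sub>R u) - f (x + h *\<^sub>R v) + f x) / (h * h)) \<longlongrightarrow>
    frechet_derivative (\<lambda>y. frechet_derivative f (at y) u) (at x) v) (at_right 0)"
proof (rule tendstoI)
  fix e :: real assume e: "e > 0"
  define G where "G y = frechet_derivative (\<lambda>y. frechet_derivative f (at y) u) (at y) v" for y
  have "continuous_on V G"
    unfolding G_def by (intro smooth_on_continuous smooth_on_directional f)
  then have "continuous (at x) G" using V x by (simp add: continuous_on_eq_continuous_at)
  then obtain d1 where d1: "d1 > 0" "\<And>y. dist y x < d1 \<Longrightarrow> dist (G y) (G x) < e"
    using e unfolding continuous_at_eps_delta by blast
  obtain d2 where d2: "d2 > 0" "ball x d2 \<subseteq> V" using V x openE by blast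
  \<comment> \<open>bounds the displacement \<open>s u + t v\<close> by \<open>h K\<close>\<close>
  define K where "K = 1 + norm u + norm v"
  have K: "K > 0" by (simp add: K_def add_pos_nonneg)
  define d where "d = min d1 d2 / K"
  have d: "d > 0" using d1 d2 K by (simp add: d_def)
  have near: "dist (x + s *\<^sub>R u + t *\<^sub>R v) x < min d1 d2" if "0 \<le> s" "s \<le> h" "0 \<le> t" "t \<le> h" "h < d" "0 < h" for s t h
  proof -
    have "dist (x + s *\<^sub>R u + t *\<^sub>R v) x = norm (s *\<^sub>R u + t *\<^sub>R v)" by (simp add: dist_norm)
    also have "\<dots> \<le> s * norm u + t * norm v"
      using norm_triangle_ineq[of "s *\<^sub>R u" "t *\<^sub>R v"] that by simp
    also have "\<dots> \<le> h * norm u + h * norm v"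
      using that by (intro add_mono mult_right_mono) auto
    also have "\<dots> < h * K" using that by (simp add: K_def algebra_simps)
    also have "\<dots> < d * K" using that K by simp
    finally show ?thesis using K by (simp add: d_def)
  qed
  have "dist ((f (x + h *\<^sub>R u + h *\<^sub>R v) - f (x + h *\<^sub>R u) - f (x + h *\<^sub>R v) + f x) / (h * h)) (G x) < e"
    if h: "0 < h" "h < d" for h
  proof -
    have "\<exists>s t. 0 \<le> s \<and> s \<le> h \<and> 0 \<le> t \<and> t \<le> h \<and>
      f (x + h *\<^sub>R u + h *\<^sub>R v) - f (x + h *\<^sub>R u) - f (x + h *\<^sub>R v) + f x =
        h * h * G (x + s *\<^sub>R u + t *\<^sub>R v)"
      unfolding G_def
    proof (rule second_difference_mean_value[OF V f h(1)])
      show "x + s *\<^sub>R u + t *\<^sub>R v \<in> V" if "0 \<le> s" "s \<le> h" "0 \<le> t" "t \<le> h" for s t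
        using near[OF that h(2,1)] d2(2) by (auto simp: dist_commute)
    qed
    then obtain s t where st: "0 \<le> s" "s \<le> h" "0 \<le> t" "t \<le> h"
      and eq: "f (x + h *\<^sub>R u + h *\<^sub>R v) - f (x + h *\<^sub>R u) - f (x + h *\<^sub>R v) + f x =
        h * h * G (x + s *\<^sub>R u + t *\<^sub>R v)" by blast
    show ?thesis unfolding eq using d1(2) near[OF st h(2,1)] h by simp
  qed
  then show "\<forall>\<^sub>F h in at_right 0. dist ((f (x + h *\<^sub>R u + h *\<^sub>R v) - f (x + h *\<^sub>R u) - f (x + h *\<^sub>R v) + f x) / (h * h))
      (frechet_derivative (\<lambda>y. frechet_derivative f (at y) u) (at x) v) < e"
    unfolding G_def[symmetric] eventually_at_right_field using d by blast
qed

text \<open>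
  Both sides are limits of the same second difference quotient, which is symmetric in
  \<open>u\<close> and \<open>v\<close>.
\<close>

lemma second_derivative_symmetric:
  fixes f :: "'a::euclidean_space \<Rightarrow> 'b::euclidean_space"
  assumes V: "open V" and f: "smooth_on f V" and x: "x \<in> V"
  shows "frechet_derivative (\<lambda>y. frechet_derivative f (at y) u) (at x) v =
         frechet_derivative (\<lambda>y. frechet_derivative f (at y) v) (at x) u"
proof (rule euclidean_eqI)
  fix b :: 'b
  define g where "g y = f y \<bullet> b" for y
  have g: "smooth_on g V"
    unfolding g_def by (rule smooth_on_linear_compose[OF _ V f]) (simp add: bounded_linear.linear bounded_linear_inner_left)
  have inner_der: "frechet_derivative (\<lambda>y. F y \<bullet> b) (at z) w = frechet_derivative F (at z) w \<bullet> b"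
    if "smooth_on F V" "z \<in> V" for F :: "'a \<Rightarrow> 'b" and z w
    using frechet_derivative_at[OF has_derivative_inner_left[OF smooth_on_has_derivative[OF that]], of b]
    by (metis (no_types))
  have gg: "frechet_derivative (\<lambda>y. frechet_derivative g (at y) u) (at x) v =
      frechet_derivative (\<lambda>y. frechet_derivative f (at y) u) (at x) v \<bullet> b" for u v
  proof -
    have "((\<lambda>y. frechet_derivative f (at y) u \<bullet> b) has_derivative
        (\<lambda>v. frechet_derivative (\<lambda>y. frechet_derivative f (at y) u) (at x) v \<bullet> b)) (at x)"
      by (intro has_derivative_inner_left smooth_on_has_derivative[OF smooth_on_directional[OF f] x])
    then have "((\<lambda>y. frechet_derivative g (at y) u) has_derivative
        (\<lambda>v. frechet_derivative (\<lambda>y. frechet_derivative f (at y) u) (at x) v \<bullet> b)) (at x)"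
      by (rule has_derivative_transform_within_open[OF _ V x]) (simp add: g_def[abs_def] inner_der[OF f])
    then show ?thesis using fun_cong[OF frechet_derivative_at[symmetric]] by blast
  qed
  have "frechet_derivative (\<lambda>y. frechet_derivative g (at y) u) (at x) v =
      frechet_derivative (\<lambda>y. frechet_derivative g (at y) v) (at x) u"
  proof (rule tendsto_unique[OF _ second_difference_limit[OF V g x, of u v]])
    show "((\<lambda>h. (g (x + h *\<^sub>R u + h *\<^sub>R v) - g (x + h *\<^sub>R u) - g (x + h *\<^sub>R v) + g x) / (h * h)) \<longlongrightarrow>
        frechet_derivative (\<lambda>y. frechet_derivative g (at y) v) (at x) u) (at_right 0)"
      using second_difference_limit[OF V g x, of v u] by (simp add: algebra_simps)
  qed simp
  then show "frechet_derivative (\<lambda>y. frechet_derivative f (at y) u) (at x) v \<bullet> b =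
      frechet_derivative (\<lambda>y. frechet_derivative f (at y) v) (at x) u \<bullet> b"
    by (simp add: gg)
qed

section \<open>Slice charts and tangent spaces\<close>

definition slice_chart ::
    "nat \<Rightarrow> 'a::euclidean_space set \<Rightarrow> 'a set \<Rightarrow> 'a set \<Rightarrow> ('a \<Rightarrow> 'a) \<Rightarrow> ('a \<Rightarrow> 'a) \<Rightarrow> 'a set \<Rightarrow> bool" where
  "slice_chart d M U V \<psi> \<psi>' S \<longleftrightarrow> open U \<and> open V \<and> homeomorphism U V \<psi> \<psi>' \<and>
     smooth_on \<psi> U \<and> smooth_on \<psi>' V \<and> subspace S \<and> dim S = d \<and> \<psi> ` (M \<inter> U) = S \<inter> V"

lemma nonsingular_part_chart:
  "nonsingular_part d M = {p \<in> M. \<exists>U V \<psi> \<psi>' S. p \<in> U \<and> slice_chart d M U V \<psi> \<psi>' S}"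
  unfolding nonsingular_part_def slice_chart_def by blast

lemma nonsingular_part_subset: "nonsingular_part d M \<subseteq> M"
  by (auto simp: nonsingular_part_def)

lemma chart_domain_nonsingular: "slice_chart d M U V \<psi> \<psi>' S \<Longrightarrow> M \<inter> U \<subseteq> nonsingular_part d M"
  unfolding nonsingular_part_chart by blast

lemma nonsingular_part_nhd:
  assumes "p \<in> nonsingular_part d M"
  obtains U where "open U" "p \<in> U" "M \<inter> U \<subseteq> nonsingular_part d M"
  using assms chart_domain_nonsingular unfolding nonsingular_part_chart slice_chart_def by blast

lemma nonsingular_part_idem: "nonsingular_part d (nonsingular_part d M) = nonsingular_part d M"
proof
  show "nonsingular_part d M \<subseteq> nonsingular_part d (nonsingular_part d M)"
  proof
    fix p assume p: "p \<in> nonsingular_part d M"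
    then obtain U V \<psi> \<psi>' S where c: "p \<in> U" "slice_chart d M U V \<psi> \<psi>' S"
      unfolding nonsingular_part_chart by blast
    have "nonsingular_part d M \<inter> U = M \<inter> U"
      using chart_domain_nonsingular[OF c(2)] nonsingular_part_subset[of d M] by blast
    then have "slice_chart d (nonsingular_part d M) U V \<psi> \<psi>' S"
      using c(2) by (simp add: slice_chart_def)
    then show "p \<in> nonsingular_part d (nonsingular_part d M)"
      using p c(1) unfolding nonsingular_part_chart[of d "nonsingular_part d M"] by blast
  qed
qed (rule nonsingular_part_subset)

lemma curve_near:
  fixes \<gamma> :: "real \<Rightarrow> 'a::euclidean_space"
  assumes "smooth_on \<gamma> {-\<delta><..<\<delta>}" "\<delta> > 0" "open U" "\<gamma> 0 \<in> U"
  obtains e where "0 < e" "e \<le> \<delta>" "\<gamma> ` {-e<..<e} \<subseteq> U"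
proof -
  have "continuous_on {-\<delta><..<\<delta>} \<gamma>" by (rule smooth_on_continuous[OF assms(1)])
  then have "open ({-\<delta><..<\<delta>} \<inter> \<gamma> -` U)"
    using assms(3) by (intro continuous_open_preimage) auto
  then obtain d where d: "d > 0" "ball 0 d \<subseteq> {-\<delta><..<\<delta>} \<inter> \<gamma> -` U"
    using assms(2,4) openE[of _ 0] by (metis IntI greaterThanLessThan_iff neg_less_0_iff_less vimageI)
  then have "\<And>t. \<bar>t\<bar> < d \<Longrightarrow> \<gamma> t \<in> U"
    by (auto simp: subset_iff dist_real_def)
  with d(1) have d: "d > 0" "\<And>t. \<bar>t\<bar> < d \<Longrightarrow> \<gamma> t \<in> U" by auto
  then show ?thesis using assms(2) by (intro that[of "min d \<delta>"]) (auto simp: abs_less_iff)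
qed

text \<open>
  Tangent vectors depend only on the germ of the set, since curves can be restricted to short
  intervals.
\<close>

lemma tangent_space_local:
  assumes W: "open W" "p \<in> W" "M \<inter> W \<subseteq> M'" "M' \<subseteq> M"
  shows "tangent_space M' p = tangent_space M p"
proof
  show "tangent_space M' p \<subseteq> tangent_space M p"
    unfolding tangent_space_def using W(4) by fastforce
  show "tangent_space M p \<subseteq> tangent_space M' p"
  proof
    fix v assume "v \<in> tangent_space M p"
    then obtain \<gamma> \<delta> where g: "\<delta> > 0" "smooth_on \<gamma> {-\<delta><..<\<delta>}" "\<gamma> ` {-\<delta><..<\<delta>} \<subseteq> M" "\<gamma> 0 = p"
        "(\<gamma> has_vector_derivative v) (at (0::real))"
      unfolding tangent_space_def by blast
    obtain e where e: "0 < e" "e \<le> \<delta>" "\<gamma> ` {-e<..<e} \<subseteq> W"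
      using curve_near[OF g(2,1) W(1)] W(2) g(4) by blast
    have "{-e<..<e} \<subseteq> {-\<delta><..<\<delta>}" using e by auto
    then have "smooth_on \<gamma> {-e<..<e}" "\<gamma> ` {-e<..<e} \<subseteq> M'"
      using smooth_on_subset[OF g(2)] e(3) g(3) W(3) by blast+
    then show "v \<in> tangent_space M' p" unfolding tangent_space_def using e(1) g(4,5) by blast
  qed
qed

lemma tangent_space_nonsingular_part:
  assumes "p \<in> nonsingular_part d M"
  shows "tangent_space (nonsingular_part d M) p = tangent_space M p"
  using assms nonsingular_part_subset[of d M]
  by (meson nonsingular_part_nhd tangent_space_local)

text \<open>
  The difference quotients lie in \<open>S\<close>, which is closed.
\<close>

lemma vector_derivative_in_subspace:
  fixes \<gamma> :: "real \<Rightarrow> 'a::euclidean_space"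
  assumes "subspace S" "(\<gamma> has_vector_derivative v) (at 0)" "e > 0" "\<And>t. \<bar>t\<bar> < e \<Longrightarrow> \<gamma> t \<in> S"
  shows "v \<in> S"
proof -
  have "((\<lambda>t. (\<gamma> t - \<gamma> 0) /\<^sub>R t) \<longlongrightarrow> v) (at 0)"
  proof -
    have "((\<lambda>t. norm ((\<gamma> t - \<gamma> 0 - t *\<^sub>R v) /\<^sub>R norm t)) \<longlongrightarrow> 0) (at 0)"
      using assms(2) unfolding has_vector_derivative_def has_derivative_at
      by (auto simp: divide_inverse mult.commute)
    then have "((\<lambda>t. norm ((\<gamma> t - \<gamma> 0) /\<^sub>R t - v)) \<longlongrightarrow> 0) (at 0)"
    proof (rule Lim_transform_eventually)
      show "\<forall>\<^sub>F t in at 0. norm ((\<gamma> t - \<gamma> 0 - t *\<^sub>R v) /\<^sub>R norm t) = norm ((\<gamma> t - \<gamma> 0) /\<^sub>R t - v)"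
      proof (rule eventually_mono[OF eventually_at_ball'[of 1 "0::real" UNIV]])
        fix t :: real assume t: "t \<in> ball 0 1 \<and> t \<noteq> 0 \<and> t \<in> UNIV"
        have "(\<gamma> t - \<gamma> 0) /\<^sub>R t - v = (\<gamma> t - \<gamma> 0 - t *\<^sub>R v) /\<^sub>R t"
          using t by (simp add: scaleR_diff_right)
        then show "norm ((\<gamma> t - \<gamma> 0 - t *\<^sub>R v) /\<^sub>R norm t) = norm ((\<gamma> t - \<gamma> 0) /\<^sub>R t - v)"
          by simp
      qed simp
    qed
    then show ?thesis by (simp add: tendsto_norm_zero_iff LIM_zero_iff)
  qed
  moreover have "\<forall>\<^sub>F t in at 0. (\<gamma> t - \<gamma> 0) /\<^sub>R t \<in> S"
    using assms by (intro eventually_at_ball'[of e 0 UNIV, THEN eventually_mono])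
      (auto simp: dist_real_def intro!: subspace_scale subspace_diff)
  ultimately show ?thesis
    using Lim_in_closed_set[OF closed_subspace[OF assms(1)]] by (metis at_neq_bot)
qed

lemma chart_inverse:
  assumes "slice_chart d M U V \<psi> \<psi>' S"
  shows "y \<in> U \<Longrightarrow> \<psi> y \<in> V" "y \<in> U \<Longrightarrow> \<psi>' (\<psi> y) = y" "z \<in> V \<Longrightarrow> \<psi>' z \<in> U" "z \<in> V \<Longrightarrow> \<psi> (\<psi>' z) = z"
    "y \<in> M \<Longrightarrow> y \<in> U \<Longrightarrow> \<psi> y \<in> S" "z \<in> S \<Longrightarrow> z \<in> V \<Longrightarrow> \<psi>' z \<in> M"
proof -
  have h: "homeomorphism U V \<psi> \<psi>'" and im: "\<psi> ` (M \<inter> U) = S \<inter> V"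
    using assms by (auto simp: slice_chart_def)
  show 1: "y \<in> U \<Longrightarrow> \<psi> y \<in> V" "y \<in> U \<Longrightarrow> \<psi>' (\<psi> y) = y" "z \<in> V \<Longrightarrow> \<psi>' z \<in> U" "z \<in> V \<Longrightarrow> \<psi> (\<psi>' z) = z" for y z
    using h by (auto simp: homeomorphism_def)
  show "y \<in> M \<Longrightarrow> y \<in> U \<Longrightarrow> \<psi> y \<in> S" using im by blast
  assume z: "z \<in> S" "z \<in> V"
  then obtain y where "y \<in> M" "y \<in> U" "z = \<psi> y" using im by blast
  then show "\<psi>' z \<in> M" using 1 by simp
qed

lemma chart_derivative_inverse:
  assumes c: "slice_chart d M U V \<psi> \<psi>' S" and p: "p \<in> U"
  shows "frechet_derivative \<psi> (at p) (frechet_derivative \<psi>' (at (\<psi> p)) w) = w"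
    and "frechet_derivative \<psi>' (at (\<psi> p)) (frechet_derivative \<psi> (at p) w) = w"
proof -
  have o: "open U" "open V" and s: "smooth_on \<psi> U" "smooth_on \<psi>' V" using c by (auto simp: slice_chart_def)
  have d: "(\<psi> has_derivative frechet_derivative \<psi> (at p)) (at (\<psi>' (\<psi> p)))"
    using smooth_on_has_derivative[OF s(1) p] chart_inverse(2)[OF c p] by simp
  have d': "(\<psi>' has_derivative frechet_derivative \<psi>' (at (\<psi> p))) (at (\<psi> p))"
    by (rule smooth_on_has_derivative[OF s(2) chart_inverse(1)[OF c p]])
  have "((\<lambda>z. \<psi> (\<psi>' z)) has_derivative (\<lambda>w. frechet_derivative \<psi> (at p) (frechet_derivative \<psi>' (at (\<psi> p)) w))) (at (\<psi> p))"
    by (rule has_derivative_compose[OF d' d])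
  then have "((\<lambda>z. z) has_derivative (\<lambda>w. frechet_derivative \<psi> (at p) (frechet_derivative \<psi>' (at (\<psi> p)) w))) (at (\<psi> p))"
    by (rule has_derivative_transform_within_open[OF _ o(2)]) (use chart_inverse[OF c] p in auto)
  from has_derivative_unique[OF this has_derivative_ident]
  show "frechet_derivative \<psi> (at p) (frechet_derivative \<psi>' (at (\<psi> p)) w) = w" by (metis (no_types))
  have "((\<lambda>y. \<psi>' (\<psi> y)) has_derivative (\<lambda>w. frechet_derivative \<psi>' (at (\<psi> p)) (frechet_derivative \<psi> (at p) w))) (at p)"
    by (rule has_derivative_compose[OF smooth_on_has_derivative[OF s(1) p] d'])
  then have "((\<lambda>z. z) has_derivative (\<lambda>w. frechet_derivative \<psi>' (at (\<psi> p)) (frechet_derivative \<psi> (at p) w))) (at p)"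
    by (rule has_derivative_transform_within_open[OF _ o(1) p]) (use chart_inverse[OF c] in auto)
  from has_derivative_unique[OF this has_derivative_ident]
  show "frechet_derivative \<psi>' (at (\<psi> p)) (frechet_derivative \<psi> (at p) w) = w" by (metis (no_types))
qed

lemma slice_line:
  assumes c: "slice_chart d M U V \<psi> \<psi>' S" and p: "p \<in> M" "p \<in> U" and s: "s \<in> S"
  obtains e where "e > 0" "\<And>\<tau>. \<bar>\<tau>\<bar> < e \<Longrightarrow> \<psi> p + \<tau> *\<^sub>R s \<in> S \<inter> V"
proof -
  have "open V" "subspace S" using c by (auto simp: slice_chart_def)
  obtain r where r: "r > 0" "ball (\<psi> p) r \<subseteq> V"
    using \<open>open V\<close> chart_inverse(1)[OF c p(2)] openE by blast
  show ?thesis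
  proof (rule that[of "r / (1 + norm s)"])
    show "r / (1 + norm s) > 0" using r by (simp add: add_pos_nonneg)
    fix \<tau> :: real assume "\<bar>\<tau>\<bar> < r / (1 + norm s)"
    then have "\<bar>\<tau>\<bar> * (1 + norm s) < r" by (simp add: pos_less_divide_eq add_pos_nonneg)
    then have "\<bar>\<tau>\<bar> * norm s < r" by (simp add: distrib_left)
    then have "\<psi> p + \<tau> *\<^sub>R s \<in> ball (\<psi> p) r" by (simp add: dist_norm)
    then show "\<psi> p + \<tau> *\<^sub>R s \<in> S \<inter> V"
      using r(2) subspace_add[OF \<open>subspace S\<close> chart_inverse(5)[OF c p] subspace_scale[OF \<open>subspace S\<close> s]]
      by blast
  qed
qed

text \<open>
  The chart turns curves in \<open>M\<close> into curves in the linear slice; conversely, straight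
  lines in the slice give curves in \<open>M\<close> for all tangent vectors.
\<close>

lemma tangent_space_chart:
  assumes c: "slice_chart d M U V \<psi> \<psi>' S" and p: "p \<in> M" "p \<in> U"
  shows "tangent_space M p = frechet_derivative \<psi>' (at (\<psi> p)) ` S"
proof
  have o: "open U" "open V" and s: "smooth_on \<psi> U" "smooth_on \<psi>' V" and S: "subspace S"
    using c by (auto simp: slice_chart_def)
  show "tangent_space M p \<subseteq> frechet_derivative \<psi>' (at (\<psi> p)) ` S"
  proof
    fix v assume "v \<in> tangent_space M p"
    then obtain \<gamma> \<delta> where g: "\<delta> > 0" "smooth_on \<gamma> {-\<delta><..<\<delta>}" "\<gamma> ` {-\<delta><..<\<delta>} \<subseteq> M" "\<gamma> 0 = p"
        "(\<gamma> has_vector_derivative v) (at (0::real))"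
      unfolding tangent_space_def by blast
    obtain e where e: "0 < e" "e \<le> \<delta>" "\<gamma> ` {-e<..<e} \<subseteq> U"
      using curve_near[OF g(2,1) o(1)] p(2) g(4) by blast
    have "((\<lambda>t. \<psi> (\<gamma> t)) has_derivative (\<lambda>h. frechet_derivative \<psi> (at p) (h *\<^sub>R v))) (at 0)"
      using has_derivative_compose[OF g(5)[unfolded has_vector_derivative_def], of \<psi> "frechet_derivative \<psi> (at p)"]
        smooth_on_has_derivative[OF s(1) p(2)] g(4) by simp
    moreover have "linear (frechet_derivative \<psi> (at p))"
      using smooth_on_has_derivative[OF s(1) p(2)] by (rule has_derivative_linear)
    ultimately have "((\<lambda>t. \<psi> (\<gamma> t)) has_vector_derivative frechet_derivative \<psi> (at p) v) (at 0)"
      by (simp add: has_vector_derivative_def linear_cmul)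
    then have "frechet_derivative \<psi> (at p) v \<in> S"
    proof (rule vector_derivative_in_subspace[OF S _ e(1)])
      fix t :: real assume "\<bar>t\<bar> < e"
      then have "\<gamma> t \<in> U" "\<gamma> t \<in> M" using e g(3) by (auto simp: image_subset_iff abs_less_iff)
      then show "\<psi> (\<gamma> t) \<in> S" by (intro chart_inverse(5)[OF c])
    qed
    then show "v \<in> frechet_derivative \<psi>' (at (\<psi> p)) ` S"
      using chart_derivative_inverse(2)[OF c p(2), of v] by (metis imageI)
  qed
  show "frechet_derivative \<psi>' (at (\<psi> p)) ` S \<subseteq> tangent_space M p"
  proof
    fix v assume "v \<in> frechet_derivative \<psi>' (at (\<psi> p)) ` S"
    then obtain w where w: "w \<in> S" "v = frechet_derivative \<psi>' (at (\<psi> p)) w" by blast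
    obtain e where e: "e > 0" "\<And>\<tau>. \<bar>\<tau>\<bar> < e \<Longrightarrow> \<psi> p + \<tau> *\<^sub>R w \<in> S \<inter> V"
      using slice_line[OF c p w(1)] by blast
    define \<gamma> where "\<gamma> \<tau> = \<psi>' (\<psi> p + \<tau> *\<^sub>R w)" for \<tau> :: real
    have "smooth_on \<gamma> {-e<..<e}"
      unfolding \<gamma>_def by (rule smooth_on_line[OF o(2) s(2)]) (use e in auto)
    moreover have "\<gamma> ` {-e<..<e} \<subseteq> M"
      unfolding \<gamma>_def using e chart_inverse(6)[OF c] by (auto simp: abs_less_iff)
    moreover have "\<gamma> 0 = p" by (simp add: \<gamma>_def chart_inverse(2)[OF c p(2)])
    moreover have "(\<gamma> has_vector_derivative v) (at 0)"
    proof -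
      have "((\<lambda>\<tau>. \<psi> p + \<tau> *\<^sub>R w) has_derivative (\<lambda>h. h *\<^sub>R w)) (at 0)"
        by (auto intro!: derivative_eq_intros)
      moreover have d: "(\<psi>' has_derivative frechet_derivative \<psi>' (at (\<psi> p))) (at (\<psi> p))"
        by (rule smooth_on_has_derivative[OF s(2) chart_inverse(1)[OF c p(2)]])
      ultimately have "(\<gamma> has_derivative (\<lambda>h. frechet_derivative \<psi>' (at (\<psi> p)) (h *\<^sub>R w))) (at 0)"
        unfolding \<gamma>_def using has_derivative_compose[of "\<lambda>\<tau>. \<psi> p + \<tau> *\<^sub>R w" "\<lambda>h. h *\<^sub>R w" 0 UNIV \<psi>'] by simp
      then show ?thesis
        using has_derivative_linear[OF d] by (simp add: has_vector_derivative_def linear_cmul w)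
    qed
    ultimately show "v \<in> tangent_space M p" unfolding tangent_space_def using e(1) by blast
  qed
qed

lemma tangent_space_nonsingular:
  assumes "p \<in> nonsingular_part d M"
  shows "subspace (tangent_space M p)" "dim (tangent_space M p) = d"
proof -
  obtain U V \<psi> \<psi>' S where p: "p \<in> M" "p \<in> U" and c: "slice_chart d M U V \<psi> \<psi>' S"
    using assms unfolding nonsingular_part_chart by blast
  have s: "smooth_on \<psi>' V" and S: "subspace S" "dim S = d"
    using c by (auto simp: slice_chart_def)
  have l: "linear (frechet_derivative \<psi>' (at (\<psi> p)))"
    by (rule has_derivative_linear[OF smooth_on_has_derivative[OF s chart_inverse(1)[OF c p(2)]]])
  have "inj (frechet_derivative \<psi>' (at (\<psi> p)))"
    by (rule inj_on_inverseI) (rule chart_derivative_inverse(1)[OF c p(2)])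
  then show "subspace (tangent_space M p)" "dim (tangent_space M p) = d"
    unfolding tangent_space_chart[OF c p]
    by (auto intro: linear_subspace_image[OF l S(1)] simp: dim_image_eq[OF l] S(2) inj_on_subset)
qed

lemma chart_frame_continuous:
  assumes c: "slice_chart d M U V \<psi> \<psi>' S"
  shows "continuous_on U (\<lambda>y. frechet_derivative \<psi>' (at (\<psi> y)) w)"
proof -
  have "continuous_on V (\<lambda>z. frechet_derivative \<psi>' (at z) w)" "continuous_on U \<psi>"
    using c by (auto simp: slice_chart_def intro: smooth_on_continuous smooth_on_directional)
  then show ?thesis
    by (rule continuous_on_compose2) (use chart_inverse(1)[OF c] in auto)
qed

text \<open>
  If the \<open>1\<close>-form \<open>w \<mapsto> B x w\<close> restricts to \<open>0\<close> on
  \<open>M\<close>, so does its exterior derivative \<open>B u v - B v u\<close>. In a chart,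
  differentiating \<open>B(\<sigma>, \<partial>\<^sub>a\<sigma>) = 0\<close> along
  \<open>b\<close> gives \<open>B(\<partial>\<^sub>b\<sigma>, \<partial>\<^sub>a\<sigma>) = -
  B(\<sigma>, \<partial>\<^sub>b\<partial>\<^sub>a\<sigma>)\<close>, and the right-hand side is
  symmetric in \<open>a\<close> and \<open>b\<close>.
\<close>

lemma vanishing_form_closed:
  fixes B :: "'a::euclidean_space \<Rightarrow> 'a \<Rightarrow> real"
  assumes B: "bounded_bilinear B"
    and van: "\<And>q w. q \<in> nonsingular_part d M \<Longrightarrow> w \<in> tangent_space M q \<Longrightarrow> B q w = 0"
    and p: "p \<in> nonsingular_part d M" and u: "u \<in> tangent_space M p" and v: "v \<in> tangent_space M p"
  shows "B u v = B v u"
proof -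
  obtain U V \<psi> \<psi>' S where pU: "p \<in> M" "p \<in> U" and c: "slice_chart d M U V \<psi> \<psi>' S"
    using p unfolding nonsingular_part_chart by blast
  have s: "open V" "smooth_on \<psi>' V" using c by (auto simp: slice_chart_def)
  note zV = chart_inverse(1)[OF c pU(2)]
  define D2 where "D2 a b = frechet_derivative (\<lambda>y. frechet_derivative \<psi>' (at y) a) (at (\<psi> p)) b" for a b
  define D where "D = frechet_derivative \<psi>' (at (\<psi> p))"
  have key: "B (D b) (D a) = - B p (D2 a b)" if a: "a \<in> S" and b: "b \<in> S" for a b
  proof -
    obtain e where e: "e > 0" "\<And>\<tau>. \<bar>\<tau>\<bar> < e \<Longrightarrow> \<psi> p + \<tau> *\<^sub>R b \<in> S \<inter> V"
      using slice_line[OF c pU b] by blast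
    define H where "H z = B (\<psi>' z) (frechet_derivative \<psi>' (at z) a)" for z
    have "(H has_derivative (\<lambda>h. B p (D2 a h) + B (D h) (D a))) (at (\<psi> p))"
      using bounded_bilinear.FDERIV[OF B smooth_on_has_derivative[OF s(2) zV]
          smooth_on_has_derivative[OF smooth_on_directional[OF s(2), of a] zV]]
      by (simp add: H_def[abs_def] D2_def D_def chart_inverse(2)[OF c pU(2)])
    moreover have "((\<lambda>\<tau>::real. \<psi> p + \<tau> *\<^sub>R b) has_derivative (\<lambda>h. h *\<^sub>R b)) (at 0)"
      by (auto intro!: derivative_eq_intros)
    ultimately have 1: "((\<lambda>\<tau>::real. H (\<psi> p + \<tau> *\<^sub>R b)) has_derivative (\<lambda>h. B p (D2 a (h *\<^sub>R b)) + B (D (h *\<^sub>R b)) (D a))) (at 0)"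
      using has_derivative_compose[of "\<lambda>\<tau>. \<psi> p + \<tau> *\<^sub>R b" "\<lambda>h. h *\<^sub>R b" 0 UNIV H] by simp
    have 2: "((\<lambda>\<tau>::real. H (\<psi> p + \<tau> *\<^sub>R b)) has_derivative (\<lambda>h. 0)) (at 0)"
    proof (rule has_derivative_transform_within_open[OF has_derivative_const[of 0]])
      show "open {-e<..<e}" "0 \<in> {-e<..<e}" using e by auto
      fix \<tau> assume "\<tau> \<in> {-e<..<e}"
      then have z: "\<psi> p + \<tau> *\<^sub>R b \<in> S" "\<psi> p + \<tau> *\<^sub>R b \<in> V" using e by (auto simp: abs_less_iff)
      let ?q = "\<psi>' (\<psi> p + \<tau> *\<^sub>R b)"
      have q: "?q \<in> M" "?q \<in> U" using chart_inverse[OF c] z by auto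
      have "frechet_derivative \<psi>' (at (\<psi> ?q)) a \<in> tangent_space M ?q"
        unfolding tangent_space_chart[OF c q] using a by blast
      then have "B ?q (frechet_derivative \<psi>' (at (\<psi> ?q)) a) = 0"
        by (rule van[rotated]) (use chart_domain_nonsingular[OF c] q in blast)
      then show "0 = H (\<psi> p + \<tau> *\<^sub>R b)" by (simp add: H_def chart_inverse(4)[OF c z(2)])
    qed
    have "B p (D2 a (1 *\<^sub>R b)) + B (D (1 *\<^sub>R b)) (D a) = 0"
      using has_derivative_unique[OF 1 2] by meson
    then show ?thesis by simp
  qed
  have sym: "D2 a b = D2 b a" for a b
    unfolding D2_def by (rule second_derivative_symmetric[OF s zV])
  obtain a b where "a \<in> S" "b \<in> S" "u = D a" "v = D b"
    using u v unfolding tangent_space_chart[OF c pU] D_def by blast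
  then show ?thesis using key[of a b] key[of b a] sym by simp
qed

section \<open>Multilinear algebra of the evolution field\<close>

lemma multilinear_expand_axis:
  fixes N :: "('k::finite \<Rightarrow> real ^ 'n::finite) \<Rightarrow> 'b::real_vector"
  assumes "multilinear N"
  shows "N v = (\<Sum>I\<in>UNIV. (\<Prod>j\<in>UNIV. v j $ I j) *\<^sub>R N (\<lambda>j. axis (I j) 1))"
proof -
  have "bij_betw (\<lambda>I j. axis (I j) (1::real)) UNIV {g :: 'k \<Rightarrow> real ^ 'n. range g \<subseteq> Basis}"
  proof (rule bij_betwI')
    show "((\<lambda>j. axis (I j) (1::real)) = (\<lambda>j. axis (I' j) 1)) = (I = I')" for I I' :: "'k \<Rightarrow> 'n"
      by (auto simp: fun_eq_iff axis_eq_axis)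
    show "(\<lambda>j. axis (I j) (1::real)) \<in> {g. range g \<subseteq> Basis}" for I :: "'k \<Rightarrow> 'n"
      by (auto simp: Basis_vec_def)
    fix g :: "'k \<Rightarrow> real ^ 'n" assume "g \<in> {g. range g \<subseteq> Basis}"
    then have "\<forall>j. \<exists>i. g j = axis i 1" by (auto simp: Basis_vec_def)
    then show "\<exists>I\<in>UNIV. g = (\<lambda>j. axis (I j) 1)" by (auto simp: fun_eq_iff dest!: choice)
  qed
  then have "(\<Sum>g | range g \<subseteq> Basis. (\<Prod>j\<in>UNIV. v j \<bullet> g j) *\<^sub>R N g) =
      (\<Sum>I\<in>UNIV. (\<Prod>j\<in>UNIV. v j \<bullet> axis (I j) 1) *\<^sub>R N (\<lambda>j. axis (I j) 1))"
    by (rule sum.reindex_bij_betw[symmetric])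
  then show ?thesis by (simp add: multilinear_expand[OF assms, of v] inner_axis)
qed

lemma multilinear_compose_linear:
  assumes "multilinear M" "linear \<phi>"
  shows "multilinear (\<lambda>v. M (\<lambda>j. \<phi> (v j)))"
proof -
  have "linear (\<lambda>x. M (\<lambda>j. \<phi> ((v(i := x)) j)))" for v i
  proof -
    have "(\<lambda>j. \<phi> ((v(i := x)) j)) = (\<lambda>j. \<phi> (v j))(i := \<phi> x)" for x
      by auto
    moreover have "linear (\<lambda>x. M ((\<lambda>j. \<phi> (v j))(i := x)))"
      using assms(1) by (simp add: multilinear_def)
    ultimately show ?thesis using linear_compose[OF assms(2)] by (simp only: o_def)
  qed
  then show ?thesis by (simp add: multilinear_def)
qed

text \<open>
  Permutations are products of transpositions.
\<close>

lemma swap_alternating_imp_sign: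
  fixes M :: "('k::finite \<Rightarrow> 'a) \<Rightarrow> real"
  assumes "\<And>v a b. a \<noteq> b \<Longrightarrow> M (\<lambda>j. v (Transposition.transpose a b j)) = - M v" and "p permutes UNIV"
  shows "M (\<lambda>j. v (p j)) = of_int (sign p) * M v"
  using assms(2) finite[of "UNIV :: 'k set"]
proof (induction p arbitrary: v rule: permutes_induct)
  case id
  then show ?case by simp
next
  case (swap a b p)
  then have p: "permutation p" by (simp add: permutation_permutes) blast
  show ?case
  proof (cases "a = b")
    case True
    then show ?thesis using swap by simp
  next
    case False
    have "M (\<lambda>j. v ((Transposition.transpose a b \<circ> p) j)) = of_int (sign p) * M (\<lambda>j. v (Transposition.transpose a b j))"
      using swap.IH[of "\<lambda>j. v (Transposition.transpose a b j)"] by simp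
    moreover have "sign (Transposition.transpose a b \<circ> p) = - sign p"
      using False p by (simp only: sign_compose permutation_swap_id sign_swap_id) simp
    ultimately show ?thesis
      using assms(1)[OF False] by (simp only:)
  qed
qed

text \<open>
  The components of the wedge product are summed over all indices without the usual factor; each
  permutation in the determinant contributes the same term.
\<close>

lemma wedge_contraction:
  fixes M :: "('k::finite \<Rightarrow> real ^ 'n::finite) \<Rightarrow> real"
  assumes M: "multilinear M"
    and alt: "\<And>v a b. a \<noteq> b \<Longrightarrow> M (\<lambda>j. v (Transposition.transpose a b j)) = - M v"
  shows "(\<Sum>I\<in>UNIV. wedge w $ I * M (\<lambda>j. axis (I j) 1)) = fact CARD('k) * M w"
proof -
  have w: "wedge w $ I = (\<Sum>p | p permutes UNIV. of_int (sign p) * (\<Prod>j\<in>UNIV. w (p j) $ I j))" for I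
  proof -
    have "wedge w $ I = det (Finite_Cartesian_Product.transpose (\<chi> i j. w i $ I j))"
      by (simp add: wedge_def)
    then show ?thesis by (simp add: det_def Finite_Cartesian_Product.transpose_def)
  qed
  have "(\<Sum>I\<in>UNIV. wedge w $ I * M (\<lambda>j. axis (I j) 1)) =
      (\<Sum>I\<in>UNIV. \<Sum>p | p permutes UNIV. of_int (sign p) * ((\<Prod>j\<in>UNIV. w (p j) $ I j) * M (\<lambda>j. axis (I j) 1)))"
    by (simp add: w sum_distrib_right mult.assoc)
  also have "\<dots> = (\<Sum>p | p permutes UNIV. of_int (sign p) * (\<Sum>I\<in>UNIV. (\<Prod>j\<in>UNIV. w (p j) $ I j) * M (\<lambda>j. axis (I j) 1)))"
    by (subst sum.swap) (simp add: sum_distrib_left)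
  also have "\<dots> = (\<Sum>p | p permutes (UNIV :: 'k set). of_int (sign p) * M (\<lambda>j. w (p j)))"
    by (intro sum.cong refl) (simp add: multilinear_expand_axis[OF M, of "\<lambda>j. w (_ j)"])
  also have "\<dots> = (\<Sum>p | p permutes (UNIV :: 'k set). M w)"
  proof (rule sum.cong[OF refl])
    fix p :: "'k \<Rightarrow> 'k" assume "p \<in> {p. p permutes UNIV}"
    then have "M (\<lambda>j. w (p j)) = of_int (sign p) * M w"
      by (intro swap_alternating_imp_sign alt) auto
    then show "of_int (sign p) * M (\<lambda>j. w (p j)) = M w"
      by (simp add: mult.assoc[symmetric] flip: of_int_mult)
  qed
  also have "\<dots> = fact CARD('k) * M w"
    by (simp add: card_permutations[of UNIV "CARD('k)"])
  finally show ?thesis .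
qed

lemma ordered_basis_exists:
  fixes T :: "'a::euclidean_space set"
  assumes "subspace T" "dim T = CARD('i::finite)"
  obtains e :: "'i::finite \<Rightarrow> 'a" where "ordered_basis T e"
proof -
  obtain B where B: "B \<subseteq> T" "independent B" "T \<subseteq> span B" "card B = dim T"
    using basis_exists by blast
  have "finite B" using B(2) independent_imp_finite by blast
  then obtain e :: "'i \<Rightarrow> 'a" where e: "bij_betw e UNIV B"
    using B(4) assms(2) by (metis bij_betw_iff_card finite_class.finite_UNIV)
  have "span B = T" using B assms(1) by (metis span_minimal subset_antisym)
  then have "ordered_basis T e"
    using e B(2) by (simp add: ordered_basis_def bij_betw_def)
  then show ?thesis by (rule that)
qed

lemma ordered_basis_coords:
  fixes e :: "'i::finite \<Rightarrow> 'a::euclidean_space"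
  assumes "ordered_basis T e" "x \<in> T"
  obtains r where "x = (\<Sum>j\<in>UNIV. r j *\<^sub>R e j)"
proof -
  have "x \<in> span (range e)" "inj e" using assms by (auto simp: ordered_basis_def)
  then obtain u where "x = (\<Sum>v\<in>range e. u v *\<^sub>R v)" by (auto simp: span_finite)
  then have "x = (\<Sum>j\<in>UNIV. u (e j) *\<^sub>R e j)" using \<open>inj e\<close> by (simp add: sum.reindex)
  then show ?thesis by (rule that)
qed

lemma ordered_basis_independent:
  fixes e :: "'i::finite \<Rightarrow> 'a::euclidean_space"
  assumes "ordered_basis T e" "(\<Sum>j\<in>UNIV. r j *\<^sub>R e j) = 0"
  shows "r i = 0"
proof -
  have e: "inj e" "independent (range e)" using assms by (auto simp: ordered_basis_def)
  have "(\<Sum>v\<in>range e. r (inv e v) *\<^sub>R v) = 0" using assms(2) e(1) by (simp add: sum.reindex)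
  then have "r (inv e (e i)) = 0"
    by (intro independentD[OF e(2) _ order_refl, where u = "\<lambda>v. r (inv e v)"]) auto
  then show ?thesis using e(1) by simp
qed

lemma ordered_basis_subset: "ordered_basis T e \<Longrightarrow> e i \<in> T"
  using span_base[of "e i" "range e"] by (auto simp: ordered_basis_def)

text \<open>
  The top exterior power is a line: changing the basis multiplies the wedge product by a
  determinant.
\<close>

lemma exterior_power_line:
  fixes T :: "real ^ ('k::finite \<Rightarrow> 'n::finite)"
  assumes w: "ordered_basis W w" and T: "T \<in> exterior_power W"
  shows "\<exists>\<kappa>. T = \<kappa> *\<^sub>R wedge w"
proof -
  have "{wedge w' | w' :: 'k \<Rightarrow> real ^ 'n. range w' \<subseteq> W} \<subseteq> span {wedge w}"
  proof clarify
    fix w' :: "'k \<Rightarrow> real ^ 'n" assume w': "range w' \<subseteq> W"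
    have "\<forall>i. \<exists>r. w' i = (\<Sum>j\<in>UNIV. r j *\<^sub>R w j)"
      using ordered_basis_coords[OF w] w' by (metis rangeI subsetD)
    then obtain A where A: "\<And>i. w' i = (\<Sum>j\<in>UNIV. A i j *\<^sub>R w j)" by metis
    have "wedge w' = det (\<chi> i j. A i j) *\<^sub>R wedge w"
    proof (rule vec_eq_iff[THEN iffD2, rule_format])
      fix I :: "'k \<Rightarrow> 'n"
      have "(\<chi> i l. w' i $ I l) = (\<chi> i j. A i j) ** (\<chi> j l. w j $ I l)"
        by (simp add: A matrix_matrix_mult_def vec_eq_iff)
      then show "wedge w' $ I = (det (\<chi> i j. A i j) *\<^sub>R wedge w) $ I"
        by (simp add: wedge_def det_mul)
    qed
    then show "wedge w' \<in> span {wedge w}" by (simp add: span_breakdown_eq)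
  qed
  then have "exterior_power W \<subseteq> span {wedge w}"
    unfolding exterior_power_def by (intro span_minimal) auto
  then show ?thesis using T by (auto simp: span_singleton)
qed

lemma Omega_multilinear: "multilinear Omega"
  unfolding multilinear_def
proof (intro allI linearI)
  fix v :: "'m::finite \<Rightarrow> complex ^ 'm" and i x y and r :: real
  have O: "Omega (v(i := z)) = det (\<chi> k. if k = i then z else v k)" for z
    unfolding Omega_def by (rule arg_cong[of _ _ det]) (simp add: vec_eq_iff)
  show "Omega (v(i := x + y)) = Omega (v(i := x)) + Omega (v(i := y))"
    unfolding O by (rule det_row_add)
  have "Omega (v(i := of_real r *s x)) = of_real r * Omega (v(i := x))"
    unfolding O by (rule det_row_mul)
  moreover have "of_real r *s x = r *\<^sub>R x"
    by (simp add: vec_eq_iff) (simp add: scaleR_conv_of_real)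
  ultimately show "Omega (v(i := r *\<^sub>R x)) = r *\<^sub>R Omega (v(i := x))"
    by (simp add: scaleR_conv_of_real)
qed

lemma Omega_scale: "Omega (v(i := z *s x)) = z * Omega (v(i := x))"
proof -
  have O: "Omega (v(i := z)) = det (\<chi> k. if k = i then z else v k)" for z
    unfolding Omega_def by (rule arg_cong[of _ _ det]) (simp add: vec_eq_iff)
  show ?thesis unfolding O by (rule det_row_mul)
qed

lemma Omega_swap:
  "a \<noteq> b \<Longrightarrow> Omega (\<lambda>s. v (Transposition.transpose a b s)) = - Omega v"
  using det_permute_rows[of "Transposition.transpose a b" "\<chi> i. v i"]
  by (simp add: Omega_def sign_swap_id permutes_swap_id)

text \<open>
  A determinant is nonzero if and only if its rows are linearly independent over
  \<open>\<complex>\<close>.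
\<close>

lemma Omega_nonzero_iff:
  "Omega v \<noteq> 0 \<longleftrightarrow> (\<forall>z. (\<Sum>i\<in>UNIV. z i *s v i) = 0 \<longrightarrow> (\<forall>i. z i = 0))"
proof -
  define A where "A = Finite_Cartesian_Product.transpose (\<chi> i. v i)"
  have Av: "A *v x = (\<Sum>i\<in>UNIV. x $ i *s v i)" for x
    by (simp add: A_def matrix_vector_mult_def Finite_Cartesian_Product.transpose_def vec_eq_iff mult.commute)
  have "Omega v \<noteq> 0 \<longleftrightarrow> (\<exists>B. B ** A = mat 1)"
    unfolding Omega_def A_def
    by (metis det_transpose invertible_det_nz invertible_left_inverse)
  also have "\<dots> \<longleftrightarrow> (\<forall>x. A *v x = 0 \<longrightarrow> x = 0)"
    by (rule matrix_left_invertible_ker)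
  also have "\<dots> \<longleftrightarrow> (\<forall>z. (\<Sum>i\<in>UNIV. z i *s v i) = 0 \<longrightarrow> (\<forall>i. z i = 0))"
    unfolding Av
  proof (intro iffI allI impI)
    fix z i assume h: "\<forall>x. (\<Sum>i\<in>UNIV. x $ i *s v i) = 0 \<longrightarrow> x = 0" and "(\<Sum>i\<in>UNIV. z i *s v i) = 0"
    then have "(\<chi> i. z i) = 0" by simp
    then show "z i = 0" by (simp add: vec_eq_iff)
  next
    fix x assume h: "\<forall>z. (\<Sum>i\<in>UNIV. z i *s v i) = 0 \<longrightarrow> (\<forall>i. z i = 0)" and "(\<Sum>i\<in>UNIV. x $ i *s v i) = 0"
    then show "x = 0" by (simp add: vec_eq_iff)
  qed
  finally show ?thesis .
qed

text \<open>
  Arguments of an \<open>m\<close>-form, of which \<open>c\<close> occupies the last slot.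
\<close>

definition slots :: "('k \<Rightarrow> 'a) \<Rightarrow> 'a \<Rightarrow> 'k option \<Rightarrow> 'a" where
  "slots a c = (\<lambda>s. case s of Some j \<Rightarrow> a j | None \<Rightarrow> c)"

lemma slots_simps [simp]: "slots a c (Some j) = a j" "slots a c None = c"
  by (simp_all add: slots_def)

lemma slots_upd: "slots (a(j := x)) c = (slots a c)(Some j := x)"
  by (auto simp: slots_def fun_eq_iff split: option.split)

lemma slots_None_upd: "slots a x = (slots a 0)(None := x)"
  by (auto simp: slots_def fun_eq_iff split: option.split)

lemma linear_Omega_slots: "linear (\<lambda>c. Omega (slots a c))"
proof -
  have "(\<lambda>c. Omega (slots a c)) = (\<lambda>c. Omega ((slots a 0)(None := c)))"
    by (rule ext, rule arg_cong[OF slots_None_upd])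
  then show ?thesis using Omega_multilinear by (simp only: multilinear_def) blast
qed

lemma Omega_slots_scale: "Omega (slots a (z *s c)) = z * Omega (slots a c)"
  using Omega_scale[of "slots a 0" None z c]
  unfolding slots_None_upd[of a "z *s c", symmetric] slots_None_upd[of a c, symmetric] .

lemma sum_option: "(\<Sum>s\<in>UNIV. f s) = f None + (\<Sum>j\<in>UNIV. f (Some j))" for f :: "'k::finite option \<Rightarrow> 'a::comm_monoid_add"
  by (simp add: UNIV_option_conv sum.reindex)

lemma Re_Omega_comp_slots: "Re_Omega_comp a c = Re (Omega (slots a c))"
  by (simp add: Re_Omega_comp_def slots_def)

lemma linear_Re: "linear Re"
  by (simp add: bounded_linear.linear bounded_linear_Re)

lemma Re_Omega_comp_multilinear:
  fixes c :: "'k::finite cspace"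
  shows "multilinear (\<lambda>a. Re_Omega_comp a c)"
  unfolding multilinear_def
proof (intro allI)
  fix a :: "'k \<Rightarrow> 'k cspace" and j
  have "linear (\<lambda>x. Omega ((slots a c)(Some j := x)))"
    using Omega_multilinear unfolding multilinear_def by blast
  from linear_compose[OF this linear_Re]
  show "linear (\<lambda>x. Re_Omega_comp (a(j := x)) c)"
    by (simp only: Re_Omega_comp_slots slots_upd o_def)
qed

lemma Re_Omega_comp_linear: "linear (Re_Omega_comp a)"
proof -
  have "Re_Omega_comp a = (\<lambda>c. Re (Omega (slots a c)))"
    by (rule ext) (rule Re_Omega_comp_slots)
  then show ?thesis
    using linear_compose[OF linear_Omega_slots linear_Re, of a] by (simp only: o_def)
qed

lemma Re_Omega_comp_swap:
  assumes "a \<noteq> b"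
  shows "Re_Omega_comp (\<lambda>j. v (Transposition.transpose a b j)) c = - Re_Omega_comp v c"
proof -
  have "slots (\<lambda>j. v (Transposition.transpose a b j)) c =
      (\<lambda>s. slots v c (Transposition.transpose (Some a) (Some b) s))"
    by (auto simp: fun_eq_iff slots_def Transposition.transpose_def split: option.split)
  then show ?thesis using Omega_swap[of "Some a" "Some b" "slots v c"] assms
    by (simp add: Re_Omega_comp_slots)
qed

text \<open>
  Summation over an orthonormal basis of real indices evaluates \<open>Re \<Omega>\<close> on the
  images of the coordinate axes.
\<close>

lemma evolution_rhs_inner:
  fixes X :: "real ^ 'n::finite \<Rightarrow> real ^ ('k::finite \<Rightarrow> 'n)"
  shows "evolution_rhs X \<phi> x \<bullet> c =
    (\<Sum>I\<in>UNIV. X x $ I * Re_Omega_comp (\<lambda>j. blinfun_apply \<phi> (axis (I j) 1)) c)"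
proof -
  let ?A = "{a :: 'k \<Rightarrow> 'k cspace. range a \<subseteq> Basis}"
  have lin: "(\<Sum>d\<in>Basis. Re_Omega_comp a d * (d \<bullet> c)) = Re_Omega_comp a c" for a
  proof -
    have "Re_Omega_comp a (\<Sum>d\<in>Basis. (c \<bullet> d) *\<^sub>R d) = (\<Sum>d\<in>Basis. (c \<bullet> d) *\<^sub>R Re_Omega_comp a d)"
      by (simp only: linear_sum[OF Re_Omega_comp_linear] linear_scale[OF Re_Omega_comp_linear])
    then show ?thesis
      by (simp only: euclidean_representation) (simp only: inner_commute mult.commute real_scaleR_def)
  qed
  have "evolution_rhs X \<phi> x \<bullet> c =
      (\<Sum>b\<in>Basis. \<Sum>a\<in>?A. \<Sum>d\<in>Basis. pushforward \<phi> (X x) a * Re_Omega_comp a d * ((d \<bullet> b) * (b \<bullet> c)))"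
    unfolding evolution_rhs_def inner_sum_left inner_scaleR_left sum_distrib_right mult.assoc ..
  also have "\<dots> = (\<Sum>a\<in>?A. \<Sum>b\<in>Basis. \<Sum>d\<in>Basis. pushforward \<phi> (X x) a * Re_Omega_comp a d * ((d \<bullet> b) * (b \<bullet> c)))"
    by (rule sum.swap)
  also have "\<dots> = (\<Sum>a\<in>?A. \<Sum>d\<in>Basis. \<Sum>b\<in>Basis. pushforward \<phi> (X x) a * Re_Omega_comp a d * ((d \<bullet> b) * (b \<bullet> c)))"
    by (rule sum.cong[OF refl], rule sum.swap)
  also have "\<dots> = (\<Sum>a\<in>?A. pushforward \<phi> (X x) a * (\<Sum>d\<in>Basis. Re_Omega_comp a d * (d \<bullet> c)))"
  proof (intro sum.cong refl)
    fix a :: "'k \<Rightarrow> 'k cspace"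
    have "(\<Sum>b\<in>Basis. (d \<bullet> b) * (b \<bullet> c)) = d \<bullet> c" for d :: "'k cspace"
      using euclidean_inner[of d c] by (simp add: inner_commute)
    then show "(\<Sum>d\<in>Basis. \<Sum>b\<in>Basis. pushforward \<phi> (X x) a * Re_Omega_comp a d * ((d \<bullet> b) * (b \<bullet> c))) =
        pushforward \<phi> (X x) a * (\<Sum>d\<in>Basis. Re_Omega_comp a d * (d \<bullet> c))"
      by (simp only: sum_distrib_left[symmetric] mult.assoc)
  qed
  also have "\<dots> = (\<Sum>a\<in>?A. \<Sum>I\<in>UNIV. X x $ I * ((\<Prod>j\<in>UNIV. blinfun_apply \<phi> (axis (I j) 1) \<bullet> a j) * Re_Omega_comp a c))"
    by (simp only: lin pushforward_def sum_distrib_right mult.assoc)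
  also have "\<dots> = (\<Sum>I\<in>UNIV. X x $ I * (\<Sum>a\<in>?A. (\<Prod>j\<in>UNIV. blinfun_apply \<phi> (axis (I j) 1) \<bullet> a j) * Re_Omega_comp a c))"
    by (subst sum.swap) (simp only: sum_distrib_left)
  also have "\<dots> = (\<Sum>I\<in>UNIV. X x $ I * Re_Omega_comp (\<lambda>j. blinfun_apply \<phi> (axis (I j) 1)) c)"
  proof (intro sum.cong refl arg_cong2[of _ _ _ _ "(*)"])
    fix I :: "'k \<Rightarrow> 'n"
    show "(\<Sum>a\<in>?A. (\<Prod>j\<in>UNIV. blinfun_apply \<phi> (axis (I j) 1) \<bullet> a j) * Re_Omega_comp a c) =
        Re_Omega_comp (\<lambda>j. blinfun_apply \<phi> (axis (I j) 1)) c"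
      by (rule trans[OF _ multilinear_expand[OF Re_Omega_comp_multilinear, symmetric]])
        (simp only: real_scaleR_def)
  qed
  finally show ?thesis .
qed

lemma evolution_rhs_wedge:
  fixes X :: "real ^ 'n::finite \<Rightarrow> real ^ ('k::finite \<Rightarrow> 'n)"
  assumes "X x = \<kappa> *\<^sub>R wedge w"
  shows "evolution_rhs X \<phi> x \<bullet> c = \<kappa> * fact CARD('k) * Re_Omega_comp (\<lambda>j. blinfun_apply \<phi> (w j)) c"
proof -
  define M where "M v = Re_Omega_comp (\<lambda>j. blinfun_apply \<phi> (v j)) c" for v :: "'k \<Rightarrow> real ^ 'n"
  have "multilinear M"
    unfolding M_def[abs_def]
    by (rule multilinear_compose_linear[OF Re_Omega_comp_multilinear]) (simp add: blinfun.bounded_linear_right bounded_linear.linear)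
  moreover have "M (\<lambda>j. v (Transposition.transpose a b j)) = - M v" if "a \<noteq> b" for v a b
    unfolding M_def by (rule Re_Omega_comp_swap[OF that])
  ultimately have "(\<Sum>I\<in>UNIV. wedge w $ I * M (\<lambda>j. axis (I j) 1)) = fact CARD('k) * M w"
    by (rule wedge_contraction)
  then show ?thesis
    by (simp add: evolution_rhs_inner assms mult.assoc M_def flip: sum_distrib_left)
qed

text \<open>
  The equation only sees the restriction of the map to a subspace whose exterior power contains
  \<open>X x\<close>; invariant subspaces therefore carry an equation of their own.
\<close>

lemma evolution_rhs_cong:
  fixes X :: "real ^ 'n::finite \<Rightarrow> real ^ ('k::finite \<Rightarrow> 'n)"
  assumes x: "X x \<in> exterior_power W" and eq: "\<And>y. y \<in> W \<Longrightarrow> blinfun_apply \<phi> y = blinfun_apply \<phi>' y"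
  shows "evolution_rhs X \<phi> x = evolution_rhs X \<phi>' x"
proof (rule euclidean_eqI)
  fix c :: "'k cspace"
  define L where "L \<phi> T = (\<Sum>I\<in>UNIV. T $ I * Re_Omega_comp (\<lambda>j. blinfun_apply \<phi> (axis (I j) 1)) c)"
    for \<phi> :: "('n, 'k) hom" and T :: "real ^ ('k \<Rightarrow> 'n)"
  have lin: "linear (L \<phi>)" for \<phi>
    by (auto simp: L_def linear_iff distrib_right sum.distrib sum_distrib_left mult.assoc)
  have "L \<phi> T = L \<phi>' T" if T: "T \<in> exterior_power W" for T
  proof (rule linear_eq_on_span[OF lin lin _ T[unfolded exterior_power_def]])
    fix T :: "real ^ ('k \<Rightarrow> 'n)" assume "T \<in> {wedge w | w. range w \<subseteq> W}"
    then obtain w where w: "T = wedge w" "range w \<subseteq> W" by blast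
    have "L \<phi> T = fact CARD('k) * Re_Omega_comp (\<lambda>j. blinfun_apply \<phi> (w j)) c" for \<phi>
      using evolution_rhs_wedge[of "\<lambda>_. T" undefined 1 w \<phi> c] by (simp add: evolution_rhs_inner L_def w)
    moreover have "blinfun_apply \<phi> (w j) = blinfun_apply \<phi>' (w j)" for j
      using w(2) by (intro eq) auto
    ultimately show "L \<phi> T = L \<phi>' T" by simp
  qed
  then show "evolution_rhs X \<phi> x \<bullet> c = evolution_rhs X \<phi>' x \<bullet> c"
    using x by (simp add: evolution_rhs_inner L_def)
qed

lemma evolution_rhs_linear:
  assumes "linear X"
  shows "linear (evolution_rhs X \<phi>)"
proof (rule linearI)
  fix x y and r :: real
  show "evolution_rhs X \<phi> (x + y) = evolution_rhs X \<phi> x + evolution_rhs X \<phi> y"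
    by (rule euclidean_eqI)
      (simp add: evolution_rhs_inner linear_add[OF assms] inner_add_left distrib_right sum.distrib)
  show "evolution_rhs X \<phi> (r *\<^sub>R x) = r *\<^sub>R evolution_rhs X \<phi> x"
    by (rule euclidean_eqI)
      (simp add: evolution_rhs_inner linear_scale[OF assms] sum_distrib_left mult.assoc)
qed

section \<open>Isotropic subspaces and the holomorphic volume form\<close>

lemma inner_complex_vec: "u \<bullet> v = Re (\<Sum>j\<in>UNIV. u $ j * cnj (v $ j))" for u v :: "complex ^ 'm"
  by (simp add: inner_vec_def inner_complex_def)

text \<open>
  This is the identity \<open>\<omega>(u, v) = g(i u, v)\<close>; it reduces conditions on
  \<open>\<omega>\<close> to real inner products.
\<close>

lemma kaehler_form_inner: "kaehler_form u v = of_real ((\<i> *s u) \<bullet> v)"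
proof -
  define S where "S = (\<Sum>j\<in>UNIV. u $ j * cnj (v $ j))"
  have "kaehler_form u v = \<i> / 2 * (S - cnj S)"
    by (simp add: kaehler_form_def S_def sum_subtractf mult.commute)
  also have "\<dots> = of_real (- Im S)" by (simp add: complex_eq_iff)
  also have "- Im S = Re (\<i> * S)" by simp
  also have "Re (\<i> * S) = (\<i> *s u) \<bullet> v"
    by (simp add: inner_complex_vec S_def sum_distrib_left mult.assoc)
  finally show ?thesis .
qed

lemma inner_ii: "(\<i> *s u) \<bullet> v = - (u \<bullet> (\<i> *s v))" for u v :: "complex ^ 'm"
  by (simp add: inner_vec_def inner_complex_def sum_negf[symmetric] algebra_simps)

lemma linear_ii: "linear (\<lambda>v :: complex ^ 'm. \<i> *s v)"
  by (auto simp: linear_iff vec_eq_iff algebra_simps)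

text \<open>
  A complex relation has the form \<open>x + i y = 0\<close> with \<open>x\<close> and
  \<open>y\<close> in the real span. Isotropy makes \<open>i y\<close> orthogonal to
  \<open>x\<close>, so both vanish.
\<close>

lemma complex_independent_of_isotropic:
  fixes a :: "'k::finite \<Rightarrow> complex ^ 'm::finite"
  assumes iso: "\<And>i j. (\<i> *s a i) \<bullet> a j = 0"
    and ind: "\<And>r. (\<Sum>j\<in>UNIV. r j *\<^sub>R a j) = 0 \<Longrightarrow> (\<forall>j. r j = 0)"
    and z: "(\<Sum>j\<in>UNIV. z j *s a j) = 0"
  shows "z j = 0"
proof -
  define x where "x = (\<Sum>j\<in>UNIV. Re (z j) *\<^sub>R a j)"
  define y where "y = (\<Sum>j\<in>UNIV. Im (z j) *\<^sub>R a j)"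
  have z': "x + \<i> *s y = 0"
  proof -
    have "z j *s a j = Re (z j) *\<^sub>R a j + \<i> *s (Im (z j) *\<^sub>R a j)" for j
      by (simp add: vec_eq_iff complex_eq_iff)
    then have "(\<Sum>j\<in>UNIV. z j *s a j) = x + (\<Sum>j\<in>UNIV. \<i> *s (Im (z j) *\<^sub>R a j))"
      by (simp add: x_def sum.distrib)
    also have "(\<Sum>j\<in>UNIV. \<i> *s (Im (z j) *\<^sub>R a j)) = \<i> *s y"
      unfolding y_def by (rule linear_sum[OF linear_ii, symmetric])
    finally show ?thesis using z by simp
  qed
  have "(\<i> *s x) \<bullet> y = (\<Sum>j\<in>UNIV. \<Sum>i\<in>UNIV. Im (z j) * (Re (z i) * ((\<i> *s a i) \<bullet> a j)))"
    unfolding x_def y_def linear_sum[OF linear_ii] linear_scale[OF linear_ii]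
    by (simp add: inner_sum_left inner_sum_right sum_distrib_left)
  then have "(\<i> *s x) \<bullet> y = 0" by (simp only: iso mult_zero_right sum.neutral_const)
  then have xy: "x \<bullet> (\<i> *s y) = 0" by (simp add: inner_ii)
  have "x \<bullet> x = x \<bullet> (x + \<i> *s y)" using xy by (simp add: inner_add_right)
  then have "x = 0" by (simp add: z')
  then have "\<i> *s y = 0" using z' by simp
  then have "y = 0" by (simp add: vec_eq_iff)
  have "Re (z j) = 0" using ind[of "\<lambda>j. Re (z j)"] \<open>x = 0\<close> by (simp add: x_def)
  moreover have "Im (z j) = 0" using ind[of "\<lambda>j. Im (z j)"] \<open>y = 0\<close> by (simp add: y_def)
  ultimately show ?thesis by (simp add: complex_eq_iff)
qed

text \<open>
  As there are fewer than \<open>m\<close> vectors, some nonzero \<open>x\<close> has bilinear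
  pairing \<open>0\<close> with all of them. Its conjugate is then Hermitian orthogonal to them
  and completes them to a basis.
\<close>

lemma Omega_slots_nonzero:
  fixes a :: "'k::finite \<Rightarrow> 'k cspace"
  assumes "\<And>z. (\<Sum>j\<in>UNIV. z j *s a j) = 0 \<Longrightarrow> (\<forall>j. z j = 0)"
  shows "\<exists>c. Omega (slots a c) \<noteq> 0"
proof -
  \<comment> \<open>the zero vector in the last slot makes the matrix singular and leaves its kernel as the annihilator of \<open>a\<close>\<close>
  define A where "A = (\<chi> i. slots a 0 i)"
  have "row None A = 0" by (simp add: A_def row_def vec_eq_iff)
  then have "det A = 0" by (rule det_zero_row)
  then have "\<not> (\<exists>B. B ** A = mat 1)"
    using invertible_det_nz[of A] by (simp add: invertible_left_inverse)
  then obtain x where x: "A *v x = 0" "x \<noteq> 0"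
    unfolding matrix_left_invertible_ker by blast
  have ax: "(\<Sum>l\<in>UNIV. a j $ l * x $ l) = 0" for j
    using x(1) by (simp add: vec_eq_iff matrix_vector_mult_def A_def) (metis slots_simps(1))
  define c where "c = (\<chi> l. cnj (x $ l))"
  have cx: "(\<Sum>l\<in>UNIV. c $ l * x $ l) = of_real (norm x ^ 2)"
  proof -
    have "(\<Sum>l\<in>UNIV. c $ l * x $ l) = of_real (\<Sum>l\<in>UNIV. norm (x $ l) ^ 2)"
      by (simp only: c_def vec_lambda_beta of_real_sum complex_norm_square) (simp only: mult.commute)
    also have "(\<Sum>l\<in>UNIV. norm (x $ l) ^ 2) = norm x ^ 2"
      by (simp add: norm_vec_def L2_set_def sum_nonneg)
    finally show ?thesis .
  qed
  have "Omega (slots a c) \<noteq> 0"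
    unfolding Omega_nonzero_iff
  proof (intro allI impI)
    fix z s assume "(\<Sum>i\<in>UNIV. z i *s slots a c i) = 0"
    then have z: "z None *s c + (\<Sum>j\<in>UNIV. z (Some j) *s a j) = 0" by (simp add: sum_option)
    have "0 = (\<Sum>l\<in>UNIV. (z None *s c + (\<Sum>j\<in>UNIV. z (Some j) *s a j)) $ l * x $ l)"
      by (simp add: z)
    also have "\<dots> = z None * (\<Sum>l\<in>UNIV. c $ l * x $ l) + (\<Sum>l\<in>UNIV. \<Sum>j\<in>UNIV. z (Some j) * (a j $ l * x $ l))"
      by (simp add: distrib_right sum.distrib sum_distrib_left sum_distrib_right mult.assoc)
    also have "(\<Sum>l\<in>UNIV. \<Sum>j\<in>UNIV. z (Some j) * (a j $ l * x $ l)) = (\<Sum>j\<in>UNIV. z (Some j) * (\<Sum>l\<in>UNIV. a j $ l * x $ l))"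
      by (subst sum.swap) (simp add: sum_distrib_left)
    finally have z0: "z None = 0" using x(2) by (simp add: ax cx)
    then show "z s = 0"
      using assms[of "\<lambda>j. z (Some j)"] z by (cases s) auto
  qed
  then show ?thesis ..
qed

lemma Re_Omega_comp_nonzero_imp_independent:
  fixes a :: "'k::finite \<Rightarrow> 'k cspace"
  assumes "Re_Omega_comp a c \<noteq> 0" "(\<Sum>j\<in>UNIV. r j *\<^sub>R a j) = 0"
  shows "r j = 0"
proof -
  have "Omega (slots a c) \<noteq> 0" using assms(1) by (auto simp: Re_Omega_comp_slots)
  moreover have "(\<Sum>s\<in>UNIV. (case s of Some j \<Rightarrow> complex_of_real (r j) | None \<Rightarrow> 0) *s slots a c s) = 0"
    using assms(2) by (simp add: sum_option vec_eq_iff) (simp add: scaleR_conv_of_real)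
  ultimately have "\<forall>s. (case s of Some j \<Rightarrow> complex_of_real (r j) | None \<Rightarrow> 0) = 0"
    unfolding Omega_nonzero_iff by blast
  then show ?thesis by (metis of_real_eq_0_iff option.simps(5))
qed

lemma Omega_slots_span:
  fixes a :: "'k::finite \<Rightarrow> 'k cspace"
  assumes "c \<in> span (range a)"
  shows "Omega (slots a c) = 0"
proof -
  have "Omega (slots a (a j)) = 0" for j
    unfolding Omega_def by (rule det_identical_rows[of None "Some j"]) (simp_all add: row_def)
  then show ?thesis
    using linear_eq_0_on_span[OF linear_Omega_slots _ assms] by auto
qed

lemma Re_Omega_comp_ii: "Re_Omega_comp a (\<i> *s c) = - Im (Omega (slots a c))"
  by (simp add: Re_Omega_comp_slots Omega_slots_scale)

section \<open>The evolution equation as a polynomial differential equation\<close>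

text \<open>
  Linear maps are identified with the tuples of images of the coordinate axes, which form a
  Euclidean space with a \<^const>\<open>Basis\<close>.
\<close>

definition hom_of :: "('k::finite cspace) ^ 'n::finite \<Rightarrow> ('n, 'k) hom" where
  "hom_of V = Blinfun (\<lambda>x. \<Sum>i\<in>UNIV. x $ i *\<^sub>R V $ i)"

definition hom_coords :: "('n::finite, 'k::finite) hom \<Rightarrow> ('k cspace) ^ 'n" where
  "hom_coords \<phi> = (\<chi> i. blinfun_apply \<phi> (axis i 1))"

lemma hom_of_apply: "blinfun_apply (hom_of V) x = (\<Sum>i\<in>UNIV. x $ i *\<^sub>R V $ i)"
proof -
  have "linear (\<lambda>x. \<Sum>i\<in>UNIV. x $ i *\<^sub>R V $ i)"
    by (auto simp: linear_iff scaleR_add_left sum.distrib scaleR_sum_right)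
  then have "bounded_linear (\<lambda>x. \<Sum>i\<in>UNIV. x $ i *\<^sub>R V $ i)"
    by (simp add: linear_conv_bounded_linear)
  then show ?thesis by (simp add: hom_of_def bounded_linear_Blinfun_apply)
qed

lemma hom_apply_axes: "blinfun_apply \<phi> x = (\<Sum>i\<in>UNIV. x $ i *\<^sub>R blinfun_apply \<phi> (axis i 1))"
proof -
  have "blinfun_apply \<phi> (\<Sum>i\<in>UNIV. x $ i *\<^sub>R axis i 1) = (\<Sum>i\<in>UNIV. x $ i *\<^sub>R blinfun_apply \<phi> (axis i 1))"
    by (simp add: blinfun.sum_right blinfun.scaleR_right)
  then show ?thesis
    using basis_expansion[of x] by (simp add: scalar_mult_eq_scaleR)
qed

lemma hom_of_coords: "hom_of (hom_coords \<phi>) = \<phi>"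
  by (rule blinfun_eqI)
    (simp only: hom_of_apply hom_coords_def vec_lambda_beta hom_apply_axes[symmetric])

lemma hom_of_axis: "blinfun_apply (hom_of V) (axis i 1) = V $ i"
proof -
  have "(\<Sum>l\<in>UNIV. axis i (1::real) $ l *\<^sub>R V $ l) = (\<Sum>l\<in>UNIV. if l = i then V $ l else 0)"
    by (rule sum.cong) (auto simp: axis_def)
  then show ?thesis by (simp add: hom_of_apply)
qed

lemma linear_hom_of: "linear hom_of"
  by (rule linearI; rule blinfun_eqI)
    (simp_all add: hom_of_apply blinfun.add_left blinfun.scaleR_left scaleR_add_right sum.distrib
      scaleR_sum_right mult.commute)

text \<open>
  The right-hand side in coordinates is the value of this multilinear form on the diagonal.
\<close>

definition evolution_form ::
    "(real ^ 'n \<Rightarrow> real ^ ('k \<Rightarrow> 'n)) \<Rightarrow> ('k::finite \<Rightarrow> ('k cspace) ^ 'n::finite) \<Rightarrow> ('k cspace) ^ 'n" where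
  "evolution_form X v = (\<chi> i. \<Sum>c\<in>Basis.
     (\<Sum>I\<in>UNIV. X (axis i 1) $ I * Re_Omega_comp (\<lambda>j. v j $ I j) c) *\<^sub>R c)"

lemma evolution_form_multilinear:
  fixes X :: "real ^ 'n::finite \<Rightarrow> real ^ ('k::finite \<Rightarrow> 'n)"
  shows "multilinear (evolution_form X)"
  unfolding multilinear_def
proof (intro allI)
  fix v :: "'k \<Rightarrow> ('k cspace) ^ 'n" and j
  have slot: "linear (\<lambda>x. Re_Omega_comp (\<lambda>l. (v(j := x)) l $ I l) c)" for I :: "'k \<Rightarrow> 'n" and c
  proof -
    have "(\<lambda>l. (v(j := x)) l $ I l) = (\<lambda>l. v l $ I l)(j := x $ I j)" for x
      by auto
    moreover have "linear (\<lambda>y. Re_Omega_comp ((\<lambda>l. v l $ I l)(j := y)) c)"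
      using Re_Omega_comp_multilinear[of c] unfolding multilinear_def by blast
    moreover have "linear (\<lambda>x :: ('k cspace) ^ 'n. x $ I j)" by (auto simp: linear_iff)
    ultimately show ?thesis using linear_compose[of "\<lambda>x. x $ I j"] by (simp only: o_def)
  qed
  have "linear (\<lambda>x. \<Sum>c\<in>Basis. (\<Sum>I\<in>UNIV. X (axis i 1) $ I * Re_Omega_comp (\<lambda>l. (v(j := x)) l $ I l) c) *\<^sub>R c)" for i
    by (rule linearI)
      (simp_all only: linear_add[OF slot] linear_scale[OF slot] scaleR_sum_left sum_distrib_left
        distrib_left sum.distrib scaleR_add_left scaleR_sum_right scaleR_scaleR real_scaleR_def mult.left_commute)
  then show "linear (\<lambda>x. evolution_form X (v(j := x)))"
    unfolding evolution_form_def linear_iff by (simp add: vec_eq_iff del: fun_upd_apply)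
qed

lemma evolution_form_hom:
  fixes X :: "real ^ 'n::finite \<Rightarrow> real ^ ('k::finite \<Rightarrow> 'n)"
  assumes X: "linear X"
  shows "blinfun_apply (hom_of (evolution_form X (\<lambda>_. V))) x = evolution_rhs X (hom_of V) x"
proof -
  have ax: "evolution_form X (\<lambda>_. V) $ i = evolution_rhs X (hom_of V) (axis i 1)" for i
    by (rule euclidean_eqI) (simp add: evolution_form_def evolution_rhs_inner hom_of_axis)
  have "evolution_rhs X (hom_of V) (\<Sum>i\<in>UNIV. x $ i *\<^sub>R axis i 1) =
      (\<Sum>i\<in>UNIV. x $ i *\<^sub>R evolution_rhs X (hom_of V) (axis i 1))"
    by (simp add: linear_sum[OF evolution_rhs_linear[OF X]] linear_scale[OF evolution_rhs_linear[OF X]])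
  then show ?thesis
    using basis_expansion[of x] by (simp add: hom_of_apply ax scalar_mult_eq_scaleR)
qed

definition solves_evolution ::
    "(real ^ 'n \<Rightarrow> real ^ ('k \<Rightarrow> 'n)) \<Rightarrow> (real \<Rightarrow> ('n::finite, 'k::finite) hom) \<Rightarrow> real set \<Rightarrow> bool" where
  "solves_evolution X \<Phi> T \<longleftrightarrow> (\<forall>t\<in>T. \<forall>x.
     ((\<lambda>s. blinfun_apply (\<Phi> s) x) has_vector_derivative evolution_rhs X (\<Phi> t) x) (at t))"

lemma has_vector_derivative_vec:
  fixes f :: "'n::finite \<Rightarrow> real \<Rightarrow> 'a::euclidean_space"
  assumes "\<And>i. (f i has_vector_derivative f' i) (at t)"
  shows "((\<lambda>s. \<chi> i. f i s) has_vector_derivative (\<chi> i. f' i)) (at t)"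
proof -
  have lin: "bounded_linear (axis i :: 'a \<Rightarrow> 'a ^ 'n)" for i
    unfolding linear_conv_bounded_linear[symmetric] by (auto simp: linear_iff axis_def vec_eq_iff)
  have sum: "(\<chi> i. g i) = (\<Sum>i\<in>UNIV. axis i (g i))" for g :: "'n \<Rightarrow> 'a"
  proof (rule vec_eq_iff[THEN iffD2, rule_format])
    fix l
    have "(\<Sum>i\<in>UNIV. axis i (g i) $ l) = (\<Sum>i\<in>UNIV. if i = l then g i else 0)"
      by (rule sum.cong) (auto simp: axis_def)
    then show "(\<chi> i. g i) $ l = (\<Sum>i\<in>UNIV. axis i (g i)) $ l" by simp
  qed
  show ?thesis
    unfolding sum
    by (intro has_vector_derivative_sum bounded_linear.has_vector_derivative[OF lin] assms)
qed

lemma evolution_coords: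
  fixes X :: "real ^ 'n::finite \<Rightarrow> real ^ ('k::finite \<Rightarrow> 'n)"
  assumes X: "linear X" and sol: "solves_evolution X \<Phi> T" and t: "t \<in> T"
  shows "((\<lambda>s. hom_coords (\<Phi> s)) has_vector_derivative evolution_form X (\<lambda>_. hom_coords (\<Phi> t))) (at t)"
proof -
  have eq: "evolution_form X (\<lambda>_. hom_coords (\<Phi> t)) = (\<chi> i. evolution_rhs X (\<Phi> t) (axis i 1))"
  proof (rule vec_eq_iff[THEN iffD2, rule_format])
    fix i
    have "evolution_form X (\<lambda>_. hom_coords (\<Phi> t)) $ i =
        blinfun_apply (hom_of (evolution_form X (\<lambda>_. hom_coords (\<Phi> t)))) (axis i 1)"
      by (simp only: hom_of_axis)
    then show "evolution_form X (\<lambda>_. hom_coords (\<Phi> t)) $ i = (\<chi> i. evolution_rhs X (\<Phi> t) (axis i 1)) $ i"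
      by (simp only: evolution_form_hom[OF X] hom_of_coords vec_lambda_beta)
  qed
  show ?thesis
    unfolding eq unfolding hom_coords_def
    by (rule has_vector_derivative_vec) (use sol t in \<open>simp add: solves_evolution_def\<close>)
qed

lemma evolution_unique:
  fixes X :: "real ^ 'n::finite \<Rightarrow> real ^ ('k::finite \<Rightarrow> 'n)"
  assumes X: "linear X" and "solves_evolution X \<Phi> {a<..<b}" "solves_evolution X \<Psi> {a<..<b}"
    and "t0 \<in> {a<..<b}" "\<Phi> t0 = \<Psi> t0" "t \<in> {a<..<b}"
  shows "\<Phi> t = \<Psi> t"
proof -
  have "hom_coords (\<Phi> t) = hom_coords (\<Psi> t)"
    by (rule ode_unique[where F = "\<lambda>V. evolution_form X (\<lambda>_. V)" and a = a and b = b and ?t0.0 = t0])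
      (use assms multilinear_diagonal_lipschitz[OF evolution_form_multilinear] in \<open>auto intro: evolution_coords\<close>)
  then show ?thesis by (metis hom_of_coords)
qed

lemma evolution_exists:
  fixes X :: "real ^ 'n::finite \<Rightarrow> real ^ ('k::finite \<Rightarrow> 'n)"
  assumes X: "linear X"
  shows "\<exists>\<epsilon>>0. \<exists>\<Phi>. \<Phi> 0 = \<phi> \<and> real_analytic_on \<Phi> {-\<epsilon><..<\<epsilon>} \<and> solves_evolution X \<Phi> {-\<epsilon><..<\<epsilon>}"
proof -
  obtain \<epsilon> y where \<epsilon>: "\<epsilon> > 0" and y0: "y 0 = hom_coords \<phi>" and an: "real_analytic_on y {-\<epsilon><..<\<epsilon>}"
    and d: "\<And>t. t \<in> {-\<epsilon><..<\<epsilon>} \<Longrightarrow> (y has_vector_derivative evolution_form X (\<lambda>_. y t)) (at t)"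
    using analytic_flow[OF evolution_form_multilinear[of X], of "hom_coords \<phi>"] by blast
  have bl: "bounded_linear (hom_of :: ('k cspace) ^ 'n \<Rightarrow> ('n, 'k) hom)"
    using linear_hom_of by (simp add: linear_conv_bounded_linear)
  define \<Phi> where "\<Phi> t = hom_of (y t)" for t
  have "real_analytic_on \<Phi> {-\<epsilon><..<\<epsilon>}"
    unfolding real_analytic_on_def
  proof
    fix t assume "t \<in> {-\<epsilon><..<\<epsilon>}"
    then obtain r c where rc: "r > 0" "\<And>s. \<bar>s - t\<bar> < r \<Longrightarrow> (\<lambda>i. (s - t) ^ i *\<^sub>R c i) sums y s"
      using an unfolding real_analytic_on_def by blast
    have "(\<lambda>i. (s - t) ^ i *\<^sub>R hom_of (c i)) sums \<Phi> s" if "\<bar>s - t\<bar> < r" for s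
      using bounded_linear.sums[OF bl rc(2)[OF that]]
      by (simp only: \<Phi>_def linear_scale[OF linear_hom_of])
    then show "\<exists>r>0. \<exists>c. \<forall>s. \<bar>s - t\<bar> < r \<longrightarrow> (\<lambda>i. (s - t) ^ i *\<^sub>R c i) sums \<Phi> s"
      by (intro exI[of _ r] conjI rc(1) exI[of _ "\<lambda>i. hom_of (c i)"] allI impI)
  qed
  moreover have "solves_evolution X \<Phi> {-\<epsilon><..<\<epsilon>}"
    unfolding solves_evolution_def
  proof (intro ballI allI)
    fix t x assume t: "t \<in> {-\<epsilon><..<\<epsilon>}"
    have "((\<lambda>s. hom_of (y s)) has_vector_derivative hom_of (evolution_form X (\<lambda>_. y t))) (at t)"
      by (rule bounded_linear.has_vector_derivative[OF bl d[OF t]])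
    then have "((\<lambda>s. blinfun_apply (hom_of (y s)) x) has_vector_derivative blinfun_apply (hom_of (evolution_form X (\<lambda>_. y t))) x) (at t)"
      by (rule bounded_linear.has_vector_derivative[OF blinfun.bounded_linear_left])
    then show "((\<lambda>s. blinfun_apply (\<Phi> s) x) has_vector_derivative evolution_rhs X (\<Phi> t) x) (at t)"
      by (simp add: \<Phi>_def evolution_form_hom[OF X])
  qed
  moreover have "\<Phi> 0 = \<phi>" by (simp add: \<Phi>_def y0 hom_of_coords)
  ultimately show ?thesis using \<epsilon> by blast
qed

lemma linear_retraction_exists:
  fixes W :: "'a::euclidean_space set"
  assumes "subspace W"
  obtains \<pi> :: "'a \<Rightarrow> 'a" where "linear \<pi>" "\<And>x. \<pi> x \<in> W" "\<And>x. x \<in> W \<Longrightarrow> \<pi> x = x"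
  using linear_exists_left_inverse_on[OF linear_ident assms inj_on_id2] that by (metis rangeI subsetD)

text \<open>
  Composing the family with a retraction \<open>\<pi>\<close> onto \<open>W\<close> yields a
  solution of a locally Lipschitz autonomous equation, which is constant as it meets an
  equilibrium at \<open>t0\<close>.
\<close>

lemma stationary_subspace:
  fixes X :: "real ^ 'n::finite \<Rightarrow> real ^ ('k::finite \<Rightarrow> 'n)"
  assumes X: "linear X" and W: "subspace W" "\<And>x. x \<in> W \<Longrightarrow> X x \<in> exterior_power W"
    and sol: "solves_evolution X \<Phi> {a<..<b}" and t0: "t0 \<in> {a<..<b}"
    and stat: "\<And>x. x \<in> W \<Longrightarrow> evolution_rhs X (\<Phi> t0) x = 0"
    and t: "t \<in> {a<..<b}" and x: "x \<in> W"
  shows "evolution_rhs X (\<Phi> t) x = 0"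
proof -
  obtain \<pi> :: "real ^ 'n \<Rightarrow> real ^ 'n" where \<pi>: "linear \<pi>" "\<And>x. \<pi> x \<in> W" "\<And>x. x \<in> W \<Longrightarrow> \<pi> x = x"
    using linear_retraction_exists[OF W(1)] by blast
  define y where "y t = (\<chi> i. blinfun_apply (\<Phi> t) (\<pi> (axis i 1)))" for t
  have y: "blinfun_apply (hom_of (y t)) x = blinfun_apply (\<Phi> t) (\<pi> x)" for t x
  proof -
    have "\<pi> x = \<pi> (\<Sum>i\<in>UNIV. x $ i *\<^sub>R axis i 1)"
      using basis_expansion[of x] by (simp add: scalar_mult_eq_scaleR)
    also have "\<dots> = (\<Sum>i\<in>UNIV. x $ i *\<^sub>R \<pi> (axis i 1))"
      by (simp add: linear_sum[OF \<pi>(1)] linear_scale[OF \<pi>(1)])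
    finally show ?thesis
      by (simp add: hom_of_apply y_def blinfun.sum_right blinfun.scaleR_right)
  qed
  have rhs: "evolution_rhs X (hom_of (y t)) z = evolution_rhs X (\<Phi> t) z" if "z \<in> W" for t z
    by (rule evolution_rhs_cong[where X = X and W = W, OF W(2)[OF that]]) (simp add: y \<pi>(3))
  define G where "G U = (\<chi> i. blinfun_apply (hom_of U) (\<pi> (axis i 1)))" for U :: "('k cspace) ^ 'n"
  \<comment> \<open>the equation for the restriction to \<open>W\<close>, extended by \<open>\<pi>\<close> to all maps\<close>
  define F where "F V = G (evolution_form X (\<lambda>_. V))" for V
  have linG: "linear G"
    by (auto simp: G_def linear_iff vec_eq_iff linear_add[OF linear_hom_of] linear_scale[OF linear_hom_of]
        blinfun.add_left blinfun.scaleR_left)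
  then obtain K where K: "K > 0" "\<And>u. norm (G u) \<le> K * norm u"
    using linear_bounded_pos by blast
  have lip: "\<exists>L. \<forall>u v. norm u \<le> R \<longrightarrow> norm v \<le> R \<longrightarrow> norm (F u - F v) \<le> L * norm (u - v)" for R
  proof -
    obtain L where L: "\<And>u v. norm u \<le> R \<Longrightarrow> norm v \<le> R \<Longrightarrow>
        norm (evolution_form X (\<lambda>_. u) - evolution_form X (\<lambda>_. v)) \<le> L * norm (u - v)"
      using multilinear_diagonal_lipschitz[OF evolution_form_multilinear[of X], of R] by blast
    have "norm (F u - F v) \<le> (K * L) * norm (u - v)" if "norm u \<le> R" "norm v \<le> R" for u v
    proof -
      have "norm (F u - F v) \<le> K * norm (evolution_form X (\<lambda>_. u) - evolution_form X (\<lambda>_. v))"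
        unfolding F_def linear_diff[OF linG, symmetric] by (rule K(2))
      also have "\<dots> \<le> K * (L * norm (u - v))" using K(1) L[OF that] by (intro mult_left_mono) auto
      finally show ?thesis by (simp add: mult.assoc)
    qed
    then show ?thesis by blast
  qed
  have Fy: "F (y t) = (\<chi> i. evolution_rhs X (\<Phi> t) (\<pi> (axis i 1)))" for t
    unfolding F_def G_def evolution_form_hom[OF X] by (simp add: rhs \<pi>(2))
  have "y t = y t0"
  proof (rule ode_unique[OF lip, where y = y and z = "\<lambda>_. y t0" and a = a and b = b and ?t0.0 = t0])
    fix t assume "t \<in> {a<..<b}"
    then show "(y has_vector_derivative F (y t)) (at t)"
      unfolding Fy unfolding y_def using sol
      by (intro has_vector_derivative_vec) (auto simp: solves_evolution_def)
    show "((\<lambda>_. y t0) has_vector_derivative F (y t0)) (at t)"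
    proof -
      have "F (y t0) = 0" by (simp add: Fy stat \<pi>(2) vec_eq_iff)
      then show ?thesis by simp
    qed
  qed (use t t0 in auto)
  then have "evolution_rhs X (\<Phi> t) x = evolution_rhs X (\<Phi> t0) x"
    using rhs[OF x, of t] rhs[OF x, of t0] by simp
  then show ?thesis using stat[OF x] by simp
qed

section \<open>The evolution preserves the admissible maps\<close>

text \<open>
  The formula behind all geometric properties of the evolution: up to a nonzero factor, the
  velocity at \<open>p\<close> is the contraction of \<open>Re \<Omega>\<close> with the image of
  the tangent space.
\<close>

lemma evolution_rhs_nonsingular:
  fixes X :: "real ^ 'n::finite \<Rightarrow> real ^ ('k::finite \<Rightarrow> 'n)"
  assumes "linear_evolution_data P X" and p: "p \<in> nonsingular_part CARD('k) P"
  obtains w :: "'k \<Rightarrow> real ^ 'n" and \<kappa> where "ordered_basis (tangent_space P p) w" "\<kappa> \<noteq> 0"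
    "\<forall>\<phi> c. evolution_rhs X \<phi> p \<bullet> c = \<kappa> * Re_Omega_comp (\<lambda>j. blinfun_apply \<phi> (w j)) c"
proof -
  obtain w :: "'k \<Rightarrow> real ^ 'n" where w: "ordered_basis (tangent_space P p) w"
    using ordered_basis_exists[OF tangent_space_nonsingular[OF p]] .
  have Xp: "X p \<in> exterior_power (tangent_space P p)" "X p \<noteq> 0"
    using assms by (auto simp: linear_evolution_data_def)
  obtain \<kappa> where \<kappa>: "X p = \<kappa> *\<^sub>R wedge w"
    using exterior_power_line[OF w Xp(1)] by blast
  then have "\<kappa> \<noteq> 0" using Xp(2) by auto
  then show ?thesis
    by (intro that[of w "\<kappa> * fact CARD('k)"] w allI evolution_rhs_wedge[of X p \<kappa> w] \<kappa>) simp
qed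

text \<open>
  The condition \<open>\<omega> = 0\<close> on \<open>T\<close>, by
  \<open>kaehler_form_inner\<close>.
\<close>

definition isotropic :: "(complex ^ 'm) set \<Rightarrow> bool" where
  "isotropic T \<longleftrightarrow> (\<forall>u\<in>T. \<forall>v\<in>T. (\<i> *s u) \<bullet> v = 0)"

lemma evolution_maps_isotropic:
  assumes "\<phi> \<in> evolution_maps P" "p \<in> nonsingular_part CARD('k) P"
  shows "isotropic (blinfun_apply (\<phi> :: ('n::finite, 'k::finite) hom) ` tangent_space P p)"
  using assms by (auto simp: evolution_maps_def isotropic_def kaehler_form_inner)

lemma image_of_basis:
  assumes "ordered_basis T w" "u \<in> T" "linear f"
  shows "f u \<in> span (range (\<lambda>j. f (w j)))"
proof -
  have "u \<in> span (range w)" using assms(1,2) by (simp add: ordered_basis_def)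
  then have "f u \<in> f ` span (range w)" by blast
  then show ?thesis using linear_span_image[OF assms(3), of "range w"] by (simp add: image_image)
qed

lemma blinfun_linear: "linear (blinfun_apply \<phi>)"
  by (simp add: blinfun.bounded_linear_right bounded_linear.linear)

text \<open>
  The two values are multiples of the imaginary and the real part of \<open>\<Omega>\<close> on
  \<open>m\<close> vectors in the image of the tangent space, which has dimension less than
  \<open>m\<close>.
\<close>

lemma evolution_rhs_omega_orthogonal:
  fixes X :: "real ^ 'n::finite \<Rightarrow> real ^ ('k::finite \<Rightarrow> 'n)"
  assumes D: "linear_evolution_data P X" and p: "p \<in> nonsingular_part CARD('k) P"
    and v: "v \<in> tangent_space P p"
  shows "(\<i> *s evolution_rhs X \<phi> p) \<bullet> blinfun_apply \<phi> v = 0"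
    and "evolution_rhs X \<phi> p \<bullet> blinfun_apply \<phi> v = 0"
proof -
  obtain w \<kappa> where w: "ordered_basis (tangent_space P p) w" and "\<kappa> \<noteq> 0"
    and all_rhs: "\<forall>\<phi> c. evolution_rhs X \<phi> p \<bullet> c = \<kappa> * Re_Omega_comp (\<lambda>j. blinfun_apply \<phi> (w j)) c"
    using evolution_rhs_nonsingular[OF D p] .
  note rhs = all_rhs[rule_format]
  have O: "Omega (slots (\<lambda>j. blinfun_apply \<phi> (w j)) (blinfun_apply \<phi> v)) = 0"
    by (rule Omega_slots_span, rule image_of_basis[OF w v blinfun_linear])
  show "(\<i> *s evolution_rhs X \<phi> p) \<bullet> blinfun_apply \<phi> v = 0"
    unfolding inner_ii rhs Re_Omega_comp_ii by (simp add: O)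
  show "evolution_rhs X \<phi> p \<bullet> blinfun_apply \<phi> v = 0"
    unfolding rhs Re_Omega_comp_slots by (simp add: O)
qed

text \<open>
  Isotropic real independent vectors are complex independent, so \<open>\<Omega>\<close> does not
  vanish identically in the remaining slot. Conversely, a real dependence among the images makes
  it vanish.
\<close>

lemma evolution_rhs_nonzero_iff:
  fixes X :: "real ^ 'n::finite \<Rightarrow> real ^ ('k::finite \<Rightarrow> 'n)"
  assumes D: "linear_evolution_data P X" and p: "p \<in> nonsingular_part CARD('k) P"
    and iso: "isotropic (blinfun_apply \<phi> ` tangent_space P p)"
  shows "evolution_rhs X \<phi> p \<noteq> 0 \<longleftrightarrow> inj_on (blinfun_apply \<phi>) (tangent_space P p)"
proof -
  obtain w \<kappa> where w: "ordered_basis (tangent_space P p) w" and \<kappa>: "\<kappa> \<noteq> 0"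
    and all_rhs: "\<forall>\<phi> c. evolution_rhs X \<phi> p \<bullet> c = \<kappa> * Re_Omega_comp (\<lambda>j. blinfun_apply \<phi> (w j)) c"
    using evolution_rhs_nonsingular[OF D p] .
  note rhs = all_rhs[rule_format]
  define a where "a j = blinfun_apply \<phi> (w j)" for j
  have sub: "subspace (tangent_space P p)" by (rule tangent_space_nonsingular[OF p])
  have phisum: "blinfun_apply \<phi> (\<Sum>j\<in>UNIV. r j *\<^sub>R w j) = (\<Sum>j\<in>UNIV. r j *\<^sub>R a j)" for r
    by (simp add: a_def blinfun.sum_right blinfun.scaleR_right)
  have inj_iff: "inj_on (blinfun_apply \<phi>) (tangent_space P p) \<longleftrightarrow>
      (\<forall>x\<in>tangent_space P p. blinfun_apply \<phi> x = 0 \<longrightarrow> x = 0)"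
    using linear_inj_on_iff_eq_0[OF blinfun_linear sub] .
  show ?thesis
  proof
    assume "evolution_rhs X \<phi> p \<noteq> 0"
    then have "\<kappa> * Re_Omega_comp a (evolution_rhs X \<phi> p) \<noteq> 0"
      unfolding a_def rhs[symmetric] by simp
    then have R: "Re_Omega_comp a (evolution_rhs X \<phi> p) \<noteq> 0" by auto
    show "inj_on (blinfun_apply \<phi>) (tangent_space P p)"
      unfolding inj_iff
    proof (intro ballI impI)
      fix x assume x: "x \<in> tangent_space P p" "blinfun_apply \<phi> x = 0"
      obtain r where r: "x = (\<Sum>j\<in>UNIV. r j *\<^sub>R w j)" using ordered_basis_coords[OF w x(1)] .
      then have "(\<Sum>j\<in>UNIV. r j *\<^sub>R a j) = 0" using x(2) phisum by simp
      then have "r j = 0" for j by (rule Re_Omega_comp_nonzero_imp_independent[OF R])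
      then show "x = 0" by (simp add: r)
    qed
  next
    assume inj: "inj_on (blinfun_apply \<phi>) (tangent_space P p)"
    have ind: "\<forall>j. r j = 0" if "(\<Sum>j\<in>UNIV. r j *\<^sub>R a j) = 0" for r
    proof -
      have "(\<Sum>j\<in>UNIV. r j *\<^sub>R w j) \<in> tangent_space P p"
        by (intro subspace_sum[OF sub] subspace_scale[OF sub] ordered_basis_subset[OF w])
      then have "(\<Sum>j\<in>UNIV. r j *\<^sub>R w j) = 0"
        using inj that unfolding inj_iff phisum[symmetric] by blast
      then show ?thesis using ordered_basis_independent[OF w] by blast
    qed
    have "\<exists>c. Omega (slots a c) \<noteq> 0"
    proof (rule Omega_slots_nonzero, intro allI)
      fix z j assume "(\<Sum>j\<in>UNIV. z j *s a j) = 0"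
      then show "z j = 0"
      proof (rule complex_independent_of_isotropic[rotated 2])
        show "(\<i> *s a i) \<bullet> a j = 0" for i j
          using iso ordered_basis_subset[OF w] by (auto simp: isotropic_def a_def)
      qed (rule ind)
    qed
    then obtain c where c: "Omega (slots a c) \<noteq> 0" ..
    \<comment> \<open>rotate the last vector until the value becomes real\<close>
    have "Re_Omega_comp a (cnj (Omega (slots a c)) *s c) = (norm (Omega (slots a c)))\<^sup>2"
      by (simp add: Re_Omega_comp_slots Omega_slots_scale mult.commute flip: complex_norm_square)
    then have "evolution_rhs X \<phi> p \<bullet> (cnj (Omega (slots a c)) *s c) \<noteq> 0"
      using c \<kappa> by (simp add: rhs flip: a_def)
    then show "evolution_rhs X \<phi> p \<noteq> 0" by auto
  qed
qed

text \<open>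
  The time derivative of \<open>\<omega>(\<phi>\<^sub>t u, \<phi>\<^sub>t v)\<close> is the
  exterior derivative of the \<open>1\<close>-form \<open>v \<mapsto> \<omega>(f(x),
  \<phi>\<^sub>t v)\<close>, which vanishes along \<open>P\<close> for any
  \<open>\<phi>\<^sub>t\<close>.
\<close>

lemma isotropy_preserved:
  fixes X :: "real ^ 'n::finite \<Rightarrow> real ^ ('k::finite \<Rightarrow> 'n)"
  assumes D: "linear_evolution_data P X" and sol: "solves_evolution X \<Phi> {-\<epsilon><..<\<epsilon>}"
    and \<Phi>0: "\<Phi> 0 \<in> evolution_maps P" and t: "t \<in> {-\<epsilon><..<\<epsilon>}"
    and p: "p \<in> nonsingular_part CARD('k) P"
  shows "isotropic (blinfun_apply (\<Phi> t) ` tangent_space P p)"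
proof -
  have X: "linear X" using D by (simp add: linear_evolution_data_def)
  have "(\<i> *s blinfun_apply (\<Phi> t) u) \<bullet> blinfun_apply (\<Phi> t) v = 0"
    if u: "u \<in> tangent_space P p" and v: "v \<in> tangent_space P p" for u v
  proof -
    define h where "h t = (\<i> *s blinfun_apply (\<Phi> t) u) \<bullet> blinfun_apply (\<Phi> t) v" for t
    have "(h has_real_derivative 0) (at t)" if t: "t \<in> {-\<epsilon><..<\<epsilon>}" for t
    proof -
      define f where "f = evolution_rhs X (\<Phi> t)"
      define B where "B x y = (\<i> *s f x) \<bullet> blinfun_apply (\<Phi> t) y" for x y
      have lf: "linear (\<lambda>x. \<i> *s f x)"
        using linear_compose[OF evolution_rhs_linear[OF X] linear_ii, of "\<Phi> t"] by (simp add: f_def o_def)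
      have "bounded_bilinear B"
        unfolding B_def[abs_def]
        using bounded_bilinear.comp[OF bounded_bilinear_inner lf[unfolded linear_conv_bounded_linear]
            blinfun.bounded_linear_right] .
      then have "B u v = B v u"
        by (rule vanishing_form_closed[OF _ _ p u v])
          (simp add: B_def f_def evolution_rhs_omega_orthogonal[OF D])
      moreover have "(h has_vector_derivative (\<i> *s blinfun_apply (\<Phi> t) u) \<bullet> f v + (\<i> *s f u) \<bullet> blinfun_apply (\<Phi> t) v) (at t)"
        unfolding h_def f_def
        by (rule bounded_bilinear.has_vector_derivative[OF bounded_bilinear_inner])
          (use sol t linear_ii in \<open>auto simp: solves_evolution_def linear_conv_bounded_linear
            intro!: bounded_linear.has_vector_derivative[of "\<lambda>v. \<i> *s v"]\<close>)
      moreover have "(\<i> *s blinfun_apply (\<Phi> t) u) \<bullet> f v = - B v u"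
        using inner_ii[of "blinfun_apply (\<Phi> t) u" "f v"] by (simp add: B_def inner_commute)
      ultimately show ?thesis
        by (simp add: has_real_derivative_iff_has_vector_derivative B_def)
    qed
    moreover have "0 \<in> {-\<epsilon><..<\<epsilon>}" using t by auto
    ultimately have "h t = h 0"
      using t by (intro DERIV_isconst3[of "-\<epsilon>" \<epsilon>]) auto
    also have "h 0 = 0"
      using evolution_maps_isotropic[OF \<Phi>0 p] u v by (simp add: h_def isotropic_def)
    finally show ?thesis by (simp add: h_def)
  qed
  then show ?thesis by (auto simp: isotropic_def)
qed

lemma tangent_space_in_span:
  assumes "open B" "p \<in> M" "p \<in> B"
  shows "tangent_space M p \<subseteq> span (M \<inter> B)"
proof
  fix v assume "v \<in> tangent_space M p"
  then have "v \<in> tangent_space (M \<inter> B) p"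
    using tangent_space_local[of B p M "M \<inter> B"] assms by auto
  then obtain \<gamma> \<delta> where g: "\<delta> > 0" "\<gamma> ` {-\<delta><..<\<delta>} \<subseteq> M \<inter> B" "(\<gamma> has_vector_derivative v) (at (0::real))"
    unfolding tangent_space_def by blast
  show "v \<in> span (M \<inter> B)"
    by (rule vector_derivative_in_subspace[OF subspace_span g(3,1)])
      (use g(2) in \<open>auto simp: abs_less_iff image_subset_iff intro!: span_base\<close>)
qed

lemma exterior_power_mono: "A \<subseteq> B \<Longrightarrow> exterior_power A \<subseteq> exterior_power B"
  unfolding exterior_power_def by (intro span_mono) blast

text \<open>
  An open set of zeros of the velocity spans an invariant subspace of equilibria; these are
  equilibria for all times, against the injectivity of \<open>\<Phi> 0\<close> on a dense set.
\<close>

lemma nondegeneracy_preserved: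
  fixes X :: "real ^ 'n::finite \<Rightarrow> real ^ ('k::finite \<Rightarrow> 'n)"
  assumes D: "linear_evolution_data P X" and sol: "solves_evolution X \<Phi> {-\<epsilon><..<\<epsilon>}"
    and \<Phi>0: "\<Phi> 0 \<in> evolution_maps P" and t: "t \<in> {-\<epsilon><..<\<epsilon>}"
  shows "P \<subseteq> closure {p \<in> nonsingular_part CARD('k) P. evolution_rhs X (\<Phi> t) p \<noteq> 0}"
proof (rule ccontr)
  let ?R = "nonsingular_part CARD('k) P"
  have X: "linear X" and dense: "P \<subseteq> closure ?R"
    and Xt: "\<And>p. p \<in> ?R \<Longrightarrow> X p \<in> exterior_power (tangent_space P p)"
    using D by (auto simp: linear_evolution_data_def singular_submanifold_def)
  assume "\<not> P \<subseteq> closure {p \<in> ?R. evolution_rhs X (\<Phi> t) p \<noteq> 0}"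
  then obtain q where q: "q \<in> P" "q \<notin> closure {p \<in> ?R. evolution_rhs X (\<Phi> t) p \<noteq> 0}" by blast
  define B where "B = - closure {p \<in> ?R. evolution_rhs X (\<Phi> t) p \<noteq> 0}"
  have B: "open B" "q \<in> B" using q by (auto simp: B_def)
  have B0: "evolution_rhs X (\<Phi> t) p = 0" if "p \<in> ?R" "p \<in> B" for p
    using that closure_subset[of "{p \<in> ?R. evolution_rhs X (\<Phi> t) p \<noteq> 0}"] by (auto simp: B_def)
  define W where "W = span (?R \<inter> B)"
  have W: "subspace W" by (simp add: W_def)
  have XW: "X x \<in> exterior_power W" if "x \<in> W" for x
  proof -
    have sp: "subspace (exterior_power W :: (real ^ ('k \<Rightarrow> 'n)) set)" by (simp add: exterior_power_def)
    have "X p \<in> exterior_power W" if p: "p \<in> ?R \<inter> B" for p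
    proof -
      have "tangent_space P p = tangent_space ?R p"
        using p by (simp add: tangent_space_nonsingular_part)
      also have "\<dots> \<subseteq> W" unfolding W_def using p B by (intro tangent_space_in_span) auto
      finally show ?thesis using Xt[of p] p exterior_power_mono by blast
    qed
    then have "span (?R \<inter> B) \<subseteq> X -` exterior_power W"
      using linear_subspace_vimage[OF X sp] by (intro span_minimal) auto
    then show ?thesis using that by (auto simp: W_def)
  qed
  have W0: "evolution_rhs X (\<Phi> t) x = 0" if "x \<in> W" for x
    using linear_eq_0_on_span[OF evolution_rhs_linear[OF X], of "?R \<inter> B"] B0 that by (auto simp: W_def)
  have "0 \<in> {-\<epsilon><..<\<epsilon>}" using t by auto
  then have zero: "evolution_rhs X (\<Phi> 0) x = 0" if "x \<in> W" for x
    using stationary_subspace[OF X W XW sol t W0 _ that] by blast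
  obtain E where E: "E \<subseteq> ?R" "P \<subseteq> closure E" "\<And>p. p \<in> E \<Longrightarrow> inj_on (blinfun_apply (\<Phi> 0)) (tangent_space P p)"
    using \<Phi>0 unfolding evolution_maps_def by blast
  have "B \<inter> E \<noteq> {}"
    using B q(1) E(2) open_Int_closure_eq_empty[OF B(1), of E] by blast
  then obtain p where p: "p \<in> E" "p \<in> B" by blast
  then have "p \<in> W" using E(1) by (auto simp: W_def intro: span_base)
  moreover have "evolution_rhs X (\<Phi> 0) p \<noteq> 0"
    using evolution_rhs_nonzero_iff[OF D _ evolution_maps_isotropic[OF \<Phi>0]] p E by blast
  ultimately show False using zero by blast
qed

lemma evolution_preserves_maps:
  fixes X :: "real ^ 'n::finite \<Rightarrow> real ^ ('k::finite \<Rightarrow> 'n)"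
  assumes D: "linear_evolution_data P X" and sol: "solves_evolution X \<Phi> {-\<epsilon><..<\<epsilon>}"
    and \<Phi>0: "\<Phi> 0 \<in> evolution_maps P" and t: "t \<in> {-\<epsilon><..<\<epsilon>}"
  shows "\<Phi> t \<in> evolution_maps P"
proof -
  let ?R = "nonsingular_part CARD('k) P"
  let ?D = "{p \<in> ?R. evolution_rhs X (\<Phi> t) p \<noteq> 0}"
  note iso = isotropy_preserved[OF D sol \<Phi>0 t]
  have X: "linear X" using D by (simp add: linear_evolution_data_def)
  have op: "openin (top_of_set P) ?D"
  proof -
    have "open (evolution_rhs X (\<Phi> t) -` (- {0}))"
      using evolution_rhs_linear[OF X, of "\<Phi> t"]
      by (intro open_vimage linear_continuous_on) (auto simp: linear_conv_bounded_linear)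
    moreover have "openin (top_of_set P) ?R"
    proof (subst openin_subopen, intro ballI)
      fix p assume p: "p \<in> ?R"
      then obtain U where U: "open U" "p \<in> U" "P \<inter> U \<subseteq> ?R" by (rule nonsingular_part_nhd)
      then show "\<exists>T. openin (top_of_set P) T \<and> p \<in> T \<and> T \<subseteq> ?R"
        using p nonsingular_part_subset by (intro exI[of _ "P \<inter> U"]) (auto simp: openin_open_Int)
    qed
    moreover have "?D = ?R \<inter> evolution_rhs X (\<Phi> t) -` (- {0})" by auto
    ultimately show ?thesis by (metis openin_Int_open)
  qed
  have k: "kaehler_form (blinfun_apply (\<Phi> t) u) (blinfun_apply (\<Phi> t) v) = 0"
    if "p \<in> ?R" "u \<in> tangent_space P p" "v \<in> tangent_space P p" for p u v
    using iso[OF that(1)] that by (simp add: isotropic_def kaehler_form_inner)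
  have "inj_on (blinfun_apply (\<Phi> t)) (tangent_space P p)" if "p \<in> ?D" for p
    using evolution_rhs_nonzero_iff[OF D _ iso] that by blast
  then have "?D \<subseteq> ?R \<and> openin (top_of_set P) ?D \<and> P \<subseteq> closure ?D \<and>
      (\<forall>p\<in>?D. inj_on (blinfun_apply (\<Phi> t)) (tangent_space P p))"
    using op nondegeneracy_preserved[OF D sol \<Phi>0 t] by blast
  then show ?thesis unfolding evolution_maps_def using k by blast
qed

section \<open>Special Lagrangian planes\<close>

text \<open>
  The unoriented form of the special Lagrangian condition for \<open>m\<close>-dimensional planes.
\<close>

definition special_plane :: "(complex ^ 'm) set \<Rightarrow> bool" where
  "special_plane T \<longleftrightarrow> isotropic T \<and> (\<forall>v. range v \<subseteq> T \<longrightarrow> Im (Omega v) = 0)"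

lemma Omega_change_of_frame:
  fixes e :: "'m::finite \<Rightarrow> complex ^ 'm"
  assumes "\<And>i. v i = (\<Sum>j\<in>UNIV. A $ i $ j *\<^sub>R e j)"
  shows "Omega v = of_real (det A) * Omega e"
proof -
  have "(\<chi> i. v i) = (\<chi> i j. complex_of_real (A $ i $ j)) ** (\<chi> i. e i)"
    by (simp add: assms matrix_matrix_mult_def vec_eq_iff) (simp add: scaleR_conv_of_real)
  moreover have "det (\<chi> i j. complex_of_real (A $ i $ j)) = of_real (det A)"
    by (simp add: det_def)
  ultimately show ?thesis by (simp add: Omega_def det_mul)
qed

text \<open>
  Vectors that are independent over \<open>\<complex>\<close> are so over \<open>\<real>\<close>.
\<close>

lemma basis_of_Omega_nonzero:
  fixes v :: "'m::finite \<Rightarrow> complex ^ 'm"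
  assumes T: "subspace T" "dim T = CARD('m)" and v: "range v \<subseteq> T" and O: "Omega v \<noteq> 0"
  shows "ordered_basis T v"
proof -
  have ind: "\<forall>j. r j = 0" if "(\<Sum>j\<in>UNIV. r j *\<^sub>R v j) = 0" for r :: "'m \<Rightarrow> real"
  proof -
    have "(\<Sum>j\<in>UNIV. complex_of_real (r j) *s v j) = (\<Sum>j\<in>UNIV. r j *\<^sub>R v j)"
      by (simp add: vec_eq_iff) (simp add: scaleR_conv_of_real)
    then have "(\<Sum>j\<in>UNIV. complex_of_real (r j) *s v j) = 0" using that by simp
    then have "complex_of_real (r j) = 0" for j by (rule O[unfolded Omega_nonzero_iff, rule_format])
    then show ?thesis by simp
  qed
  have inj: "inj v"
  proof (rule injI, rule ccontr)
    fix i j assume ij: "v i = v j" "i \<noteq> j"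
    have "(\<Sum>l\<in>UNIV. (if l = i then 1 else if l = j then - 1 else 0 :: real) *\<^sub>R v l)
        = (\<Sum>l\<in>UNIV. (if l = i then v l else 0) - (if l = j then v l else 0))"
      using ij(2) by (intro sum.cong) auto
    also have "\<dots> = v i - v j" by (simp add: sum_subtractf)
    finally have "\<forall>l. (if l = i then 1 else if l = j then - 1 else 0 :: real) = 0"
      using ind[of "\<lambda>l. if l = i then 1 else if l = j then - 1 else 0"] ij(1) by simp
    then show False by (metis zero_neq_one)
  qed
  have indep: "independent (range v)"
  proof (rule independent_if_scalars_zero)
    fix f x assume f: "(\<Sum>x\<in>range v. f x *\<^sub>R x) = 0" "x \<in> range v"
    then have "(\<Sum>j\<in>UNIV. f (v j) *\<^sub>R v j) = 0" using inj by (simp add: sum.reindex)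
    then show "f x = 0" using ind[of "\<lambda>j. f (v j)"] f(2) by auto
  qed simp
  have "card (range v) = dim T" using inj T(2) by (simp add: card_image)
  then have "T \<subseteq> span (range v)"
    using card_eq_dim[OF v] indep by simp
  moreover have "span (range v) \<subseteq> T" using v T(1) by (rule span_minimal)
  ultimately show ?thesis using inj indep by (auto simp: ordered_basis_def)
qed

definition orthonormal_frame :: "('i \<Rightarrow> 'a::real_inner) \<Rightarrow> bool" where
  "orthonormal_frame e \<longleftrightarrow> (\<forall>i j. e i \<bullet> e j = (if i = j then 1 else 0))"

lemma cnj_det: "cnj (det A) = det (\<chi> i j. cnj (A $ i $ j))"
proof -
  have "cnj (of_int (sign p)) = of_int (sign p)" for p :: "'a \<Rightarrow> 'a" by simp
  then show ?thesis by (simp add: det_def)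
qed

text \<open>
  On an isotropic space the real and the Hermitian inner product agree, so the frame is unitary
  and the determinant has modulus \<open>1\<close>.
\<close>

lemma Omega_orthonormal:
  fixes e :: "'m::finite \<Rightarrow> complex ^ 'm"
  assumes "special_plane T" "orthonormal_frame e" "range e \<subseteq> T"
  shows "Omega e = 1 \<or> Omega e = -1"
proof -
  define A where "A = (\<chi> i. e i)"
  have "(\<Sum>l\<in>UNIV. e i $ l * cnj (e j $ l)) = (if i = j then 1 else 0)" for i j
  proof -
    define S where "S = (\<Sum>l\<in>UNIV. e i $ l * cnj (e j $ l))"
    have "Re S = (if i = j then 1 else 0)"
      using assms(2) unfolding S_def inner_complex_vec[symmetric] by (simp add: orthonormal_frame_def)
    moreover have "Im S = 0"
    proof -
      have "(\<i> *s e i) \<bullet> e j = Re (\<i> * S)"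
        by (simp add: inner_complex_vec S_def sum_distrib_left mult.assoc)
      moreover have "e i \<in> T" "e j \<in> T" using assms(3) by auto
      then have "(\<i> *s e i) \<bullet> e j = 0"
        using assms(1) unfolding special_plane_def isotropic_def by blast
      ultimately show ?thesis by simp
    qed
    ultimately have "S = (if i = j then 1 else 0)" by (simp add: complex_eq_iff)
    then show ?thesis by (simp add: S_def)
  qed
  then have "A ** Finite_Cartesian_Product.transpose (\<chi> i j. cnj (A $ i $ j)) = mat 1"
    by (simp add: A_def matrix_matrix_mult_def Finite_Cartesian_Product.transpose_def mat_def vec_eq_iff)
  then have "det A * det (Finite_Cartesian_Product.transpose (\<chi> i j. cnj (A $ i $ j))) = 1"
    by (metis det_I det_mul)
  then have "det A * cnj (det A) = 1" by (simp add: cnj_det)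
  moreover have "Im (det A) = 0" "Omega e = det A"
    using assms(1,3) by (auto simp: special_plane_def A_def Omega_def)
  ultimately have "Re (Omega e) * Re (Omega e) = 1" "Im (Omega e) = 0"
    by (auto simp: complex_eq_iff)
  then show ?thesis by (simp add: complex_eq_iff square_eq_1_iff)
qed

lemma special_plane_positive_frame:
  fixes T :: "(complex ^ 'm::finite) set"
  assumes sp: "special_plane T" and T: "subspace T" "dim T = CARD('m)"
  obtains e :: "'m \<Rightarrow> complex ^ 'm" where "ordered_basis T e" "orthonormal_frame e" "Omega e = 1"
proof -
  obtain B where B: "B \<subseteq> T" "pairwise orthogonal B" "\<forall>x\<in>B. norm x = 1"
      "independent B" "card B = dim T" "span B = T"
    by (rule orthonormal_basis_subspace[OF T(1)], rule that) auto
  have "finite B" using B(4) independent_imp_finite by blast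
  then obtain e :: "'m \<Rightarrow> complex ^ 'm" where e: "bij_betw e UNIV B"
    using B(5) T(2) by (metis bij_betw_iff_card finite_class.finite_UNIV)
  have on: "orthonormal_frame e"
    unfolding orthonormal_frame_def
  proof (intro allI)
    fix i j
    have "e i \<in> B" "e j \<in> B" using e by (auto simp: bij_betw_def)
    moreover have "i \<noteq> j \<Longrightarrow> e i \<noteq> e j" using e by (auto simp: bij_betw_def inj_def)
    ultimately show "e i \<bullet> e j = (if i = j then 1 else 0)"
      using B(2,3) by (auto simp: pairwise_def orthogonal_def norm_eq_1)
  qed
  have eT: "range e \<subseteq> T" using e B(1) by (auto simp: bij_betw_def)
  \<comment> \<open>negating one vector of the frame changes the sign of the value\<close>
  define e' where "e' = (if Omega e = 1 then e else e(undefined := - e undefined))"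
  have "Omega e' = 1"
  proof (cases "Omega e = 1")
    case False
    then have "Omega e = -1" using Omega_orthonormal[OF sp on eT] by blast
    moreover have "Omega (e(undefined := (-1) *s e undefined)) = -1 * Omega (e(undefined := e undefined))"
      by (rule Omega_scale)
    moreover have "(-1) *s e undefined = - e undefined" by (simp add: vec_eq_iff)
    ultimately show ?thesis using False by (simp add: e'_def)
  qed (simp add: e'_def)
  moreover have "orthonormal_frame e'"
    using on by (auto simp: e'_def orthonormal_frame_def)
  moreover have "range e' \<subseteq> T"
    using eT subspace_neg[OF T(1)] by (auto simp: e'_def image_subset_iff)
  ultimately show ?thesis
    using basis_of_Omega_nonzero[OF T, of e'] by (intro that[of e']) auto
qed

definition positive_frames :: "(complex ^ 'm::finite) set \<Rightarrow> ('m \<Rightarrow> complex ^ 'm) set" where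
  "positive_frames T = {f. ordered_basis T f \<and> Re (Omega f) > 0}"

text \<open>
  Relative to a frame with \<open>\<Omega> = 1\<close>, the value of \<open>\<Omega>\<close> on
  another frame is the determinant of the change of basis.
\<close>

lemma positive_frames_orientation:
  assumes "special_plane T" "subspace T" "dim T = CARD('m)"
  shows "vs_orientation T (positive_frames (T :: (complex ^ 'm::finite) set))"
proof -
  obtain e where e: "ordered_basis T e" "Omega e = 1"
    using special_plane_positive_frame[OF assms] by blast
  have "Re (Omega f) > 0 \<longleftrightarrow> (\<exists>A :: real ^ 'm ^ 'm. det A > 0 \<and> (\<forall>i. f i = (\<Sum>j\<in>UNIV. A $ i $ j *\<^sub>R e j)))"
    if f: "ordered_basis T f" for f
  proof -
    have "\<forall>i. \<exists>r. f i = (\<Sum>j\<in>UNIV. r j *\<^sub>R e j)"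
      using ordered_basis_coords[OF e(1)] ordered_basis_subset[OF f] by metis
    then obtain r where "\<And>i. f i = (\<Sum>j\<in>UNIV. r i j *\<^sub>R e j)" by metis
    then have A: "f i = (\<Sum>j\<in>UNIV. (\<chi> i j. r i j) $ i $ j *\<^sub>R e j)" for i by simp
    show ?thesis
    proof
      assume "Re (Omega f) > 0"
      then have "det (\<chi> i j. r i j) > 0" using Omega_change_of_frame[OF A] e(2) by simp
      then show "\<exists>A :: real ^ 'm ^ 'm. det A > 0 \<and> (\<forall>i. f i = (\<Sum>j\<in>UNIV. A $ i $ j *\<^sub>R e j))"
        using A by blast
    next
      assume "\<exists>A :: real ^ 'm ^ 'm. det A > 0 \<and> (\<forall>i. f i = (\<Sum>j\<in>UNIV. A $ i $ j *\<^sub>R e j))"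
      then show "Re (Omega f) > 0" using Omega_change_of_frame[of f _ e] e(2) by auto
    qed
  qed
  then show ?thesis
    unfolding vs_orientation_def positive_frames_def using e(1) by (intro exI[of _ e]) blast
qed

lemma positive_frames_volume_form:
  assumes sp: "special_plane T" and T: "subspace T" "dim T = CARD('m)" and v: "\<And>i. v i \<in> T"
  shows "volume_form (positive_frames T) v = Re (Omega (v :: 'm::finite \<Rightarrow> complex ^ 'm))"
proof -
  define P where "P e \<longleftrightarrow> e \<in> positive_frames T \<and> (\<forall>i j. e i \<bullet> e j = (if i = j then 1 else 0))" for e
  have "\<exists>e. P e"
    using special_plane_positive_frame[OF sp T] unfolding P_def positive_frames_def orthonormal_frame_def
    by (metis (no_types, lifting) mem_Collect_eq one_complex.simps(1) zero_less_one)
  then have "P (SOME e. P e)" by (rule someI_ex)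
  moreover define e where "e = (SOME e. P e)"
  ultimately have e: "ordered_basis T e" "Re (Omega e) > 0" "orthonormal_frame e"
    by (auto simp: P_def positive_frames_def orthonormal_frame_def)
  have vol: "volume_form (positive_frames T) v = det (\<chi> i j. v i \<bullet> e j)"
    by (simp add: volume_form_def e_def P_def)
  have "range e \<subseteq> T" using ordered_basis_subset[OF e(1)] by auto
  then have O: "Omega e = 1" using Omega_orthonormal[OF sp e(3)] e(2) by auto
  have "v i = (\<Sum>j\<in>UNIV. (\<chi> i j. v i \<bullet> e j) $ i $ j *\<^sub>R e j)" for i
  proof -
    obtain r where r: "v i = (\<Sum>j\<in>UNIV. r j *\<^sub>R e j)" using ordered_basis_coords[OF e(1) v] .
    have on: "e j \<bullet> e l = (if j = l then 1 else 0)" for j l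
      using e(3) by (simp add: orthonormal_frame_def)
    have "v i \<bullet> e l = r l" for l
      by (simp add: r inner_sum_left on if_distrib cong: if_cong)
    then show ?thesis by (simp flip: r)
  qed
  from Omega_change_of_frame[OF this] show ?thesis by (simp add: vol O)
qed

lemma continuous_on_Omega:
  assumes "\<And>i. continuous_on A (\<lambda>y. e y i)"
  shows "continuous_on A (\<lambda>y. Omega (e y))"
  unfolding Omega_def det_def
  by (intro continuous_intros assms)

text \<open>
  Positive frames exist in each tangent space, and near each point they can be chosen
  continuously: transport one such frame by the chart and shrink the neighbourhood until \<open>Re
  \<Omega>\<close> stays positive.
\<close>

lemma special_planes_imp_special_lagrangian:
  fixes L :: "(complex ^ 'm::finite) set"
  assumes sub: "submanifold CARD('m) L" and sp: "\<And>x. x \<in> L \<Longrightarrow> special_plane (tangent_space L x)"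
  shows "special_lagrangian L"
proof -
  define Or where "Or x = positive_frames (tangent_space L x)" for x
  have ns: "nonsingular_part CARD('m) L = L" using sub by (simp add: submanifold_def)
  have T: "subspace (tangent_space L x)" "dim (tangent_space L x) = CARD('m)" if "x \<in> L" for x
    using tangent_space_nonsingular[of x "CARD('m)" L] that ns by auto
  have "\<exists>U e. open U \<and> x \<in> U \<and> (\<forall>i. continuous_on (L \<inter> U) (\<lambda>y. e y i)) \<and> (\<forall>y\<in>L \<inter> U. e y \<in> Or y)"
    if x: "x \<in> L" for x
  proof -
    have "x \<in> nonsingular_part CARD('m) L" using x ns by simp
    then obtain U V \<psi> \<psi>' S where xU: "x \<in> U" and c: "slice_chart CARD('m) L U V \<psi> \<psi>' S"
      unfolding nonsingular_part_chart by blast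
    obtain f where f: "ordered_basis (tangent_space L x) f" "Omega f = 1"
      using special_plane_positive_frame[OF sp[OF x] T[OF x]] by blast
    have "f i \<in> frechet_derivative \<psi>' (at (\<psi> x)) ` S" for i
      using ordered_basis_subset[OF f(1)] tangent_space_chart[OF c x xU] by blast
    then have "\<exists>s. s \<in> S \<and> f i = frechet_derivative \<psi>' (at (\<psi> x)) s" for i by blast
    then obtain s where s: "\<And>i. s i \<in> S" "\<And>i. f i = frechet_derivative \<psi>' (at (\<psi> x)) (s i)" by metis
    define e where "e y i = frechet_derivative \<psi>' (at (\<psi> y)) (s i)" for y i
    have ex: "e x = f" by (simp add: e_def s fun_eq_iff)
    have cont: "continuous_on U (\<lambda>y. e y i)" for i
      unfolding e_def by (rule chart_frame_continuous[OF c])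
    have oU: "open U" using c by (simp add: slice_chart_def)
    have "continuous_on U (\<lambda>y. Re (Omega (e y)))"
      by (intro continuous_intros continuous_on_Omega cont)
    then have "open (U \<inter> (\<lambda>y. Re (Omega (e y))) -` {0<..})"
      using oU by (intro continuous_open_preimage) auto
    moreover define U' where "U' = U \<inter> (\<lambda>y. Re (Omega (e y))) -` {0<..}"
    ultimately have U': "open U'" "x \<in> U'" using xU f(2) by (auto simp: ex)
    have "continuous_on (L \<inter> U') (\<lambda>y. e y i)" for i
      by (rule continuous_on_subset[OF cont]) (auto simp: U'_def)
    moreover have "e y \<in> Or y" if y: "y \<in> L \<inter> U'" for y
    proof -
      have yL: "y \<in> L" "y \<in> U" and pos: "Re (Omega (e y)) > 0" using y by (auto simp: U'_def)
      have "range (e y) \<subseteq> tangent_space L y"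
        unfolding tangent_space_chart[OF c yL] using s(1) by (auto simp: e_def)
      then have "ordered_basis (tangent_space L y) (e y)"
        using pos by (intro basis_of_Omega_nonzero T yL) auto
      then show ?thesis using pos by (simp add: Or_def positive_frames_def)
    qed
    ultimately show ?thesis using U' by blast
  qed
  then have "orientation_on L Or"
    unfolding orientation_on_def Or_def using positive_frames_orientation[OF sp T] by blast
  moreover have "Re (Omega v) = volume_form (Or x) v"
    if "x \<in> L" "\<forall>i. v i \<in> tangent_space L x" for x v
    unfolding Or_def using positive_frames_volume_form[OF sp T, of x v] that by simp
  ultimately show ?thesis unfolding special_lagrangian_def using sub by blast
qed

lemma vanishing_on_dense_subset:
  fixes h :: "'a::euclidean_space \<Rightarrow> real"
  assumes h: "continuous_on A h" and x: "x \<in> A" "x \<in> closure (Z \<inter> A)" and z: "\<And>y. y \<in> Z \<inter> A \<Longrightarrow> h y = 0"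
  shows "h x = 0"
proof -
  obtain f where f: "\<And>n. f n \<in> Z \<inter> A" "f \<longlonglongrightarrow> x"
    using x(2) unfolding closure_sequential by blast
  then have "(\<lambda>n. h (f n)) \<longlonglongrightarrow> h x"
    using h x(1) unfolding continuous_on_sequentially by (auto simp: o_def)
  moreover have "(\<lambda>n. h (f n)) = (\<lambda>_. 0)" using f(1) z by auto
  ultimately show ?thesis using LIMSEQ_unique tendsto_const by metis
qed

text \<open>
  A chart provides continuous frames of the tangent spaces, and \<open>\<omega>\<close> and
  \<open>Im \<Omega>\<close> evaluated on them vanish on a dense subset.
\<close>

lemma special_planes_closed:
  fixes N :: "(complex ^ 'm::finite) set"
  assumes dense: "N \<subseteq> closure Z" "Z \<subseteq> N"
    and Z: "\<And>y. y \<in> Z \<Longrightarrow> y \<in> nonsingular_part CARD('m) N \<Longrightarrow> special_plane (tangent_space N y)"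
    and x: "x \<in> nonsingular_part CARD('m) N"
  shows "special_plane (tangent_space N x)"
proof -
  obtain U V \<psi> \<psi>' S where xU: "x \<in> N" "x \<in> U" and c: "slice_chart CARD('m) N U V \<psi> \<psi>' S"
    using x unfolding nonsingular_part_chart by blast
  have oU: "open U" using c by (simp add: slice_chart_def)
  define A where "A = N \<inter> U"
  have xA: "x \<in> A" using xU by (simp add: A_def)
  have "U \<inter> closure Z \<subseteq> closure (U \<inter> Z)" by (rule open_Int_closure_subset[OF oU])
  moreover have "U \<inter> Z = Z \<inter> A" using dense(2) by (auto simp: A_def)
  ultimately have xZ: "x \<in> closure (Z \<inter> A)" using xU dense(1) by auto
  define g where "g s y = frechet_derivative \<psi>' (at (\<psi> y)) s" for s y
  have cont: "continuous_on A (g s)" for s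
    unfolding g_def A_def by (rule continuous_on_subset[OF chart_frame_continuous[OF c]]) auto
  have gT: "g s y \<in> tangent_space N y" if "s \<in> S" "y \<in> A" for s y
    using that tangent_space_chart[OF c, of y] by (auto simp: A_def g_def)
  have sp: "special_plane (tangent_space N y)" if "y \<in> Z \<inter> A" for y
    using that chart_domain_nonsingular[OF c] by (intro Z) (auto simp: A_def)
  have Tx: "tangent_space N x = (\<lambda>s. g s x) ` S"
    using tangent_space_chart[OF c xU] by (simp add: g_def)
  have ii: "bounded_linear (\<lambda>v :: complex ^ 'm. \<i> *s v)"
    using linear_ii by (simp add: linear_conv_bounded_linear)
  have "(\<i> *s g a x) \<bullet> g b x = 0" if "a \<in> S" "b \<in> S" for a b
  proof (rule vanishing_on_dense_subset[OF _ xA xZ, where h = "\<lambda>y. (\<i> *s g a y) \<bullet> g b y"])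
    show "continuous_on A (\<lambda>y. (\<i> *s g a y) \<bullet> g b y)"
      by (intro continuous_intros bounded_linear.continuous_on[OF ii] cont)
    show "(\<i> *s g a y) \<bullet> g b y = 0" if y: "y \<in> Z \<inter> A" for y
      using sp[OF y] gT[OF \<open>a \<in> S\<close>, of y] gT[OF \<open>b \<in> S\<close>, of y] y
      by (simp add: special_plane_def isotropic_def)
  qed
  then have "isotropic (tangent_space N x)" by (auto simp: isotropic_def Tx)
  moreover have "Im (Omega v) = 0" if v: "range v \<subseteq> tangent_space N x" for v
  proof -
    have "\<exists>s. s \<in> S \<and> v i = g s x" for i using v Tx by blast
    then obtain s where s: "\<And>i. s i \<in> S" "\<And>i. v i = g (s i) x" by metis
    have "Im (Omega (\<lambda>i. g (s i) x)) = 0"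
    proof (rule vanishing_on_dense_subset[OF _ xA xZ, where h = "\<lambda>y. Im (Omega (\<lambda>i. g (s i) y))"])
      show "continuous_on A (\<lambda>y. Im (Omega (\<lambda>i. g (s i) y)))"
        by (intro continuous_intros continuous_on_Omega cont)
      show "Im (Omega (\<lambda>i. g (s i) y)) = 0" if y: "y \<in> Z \<inter> A" for y
      proof -
        have "range (\<lambda>i. g (s i) y) \<subseteq> tangent_space N y" using gT[OF s(1), of y] y by auto
        then show ?thesis using sp[OF y] by (simp add: special_plane_def)
      qed
    qed
    moreover have "v = (\<lambda>i. g (s i) x)" using s(2) by auto
    ultimately show ?thesis by simp
  qed
  ultimately show ?thesis by (simp add: special_plane_def)
qed

section \<open>The swept-out set\<close>

lemma real_analytic_curve_smooth:
  fixes \<Phi> :: "real \<Rightarrow> ('n::finite, 'k::finite) hom"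
  assumes "real_analytic_on \<Phi> I" "t \<in> I"
  obtains r where "r > 0" "smooth_on (\<lambda>s. blinfun_apply (\<Phi> (t + s)) p) {-r<..<r}"
proof -
  obtain r c where r: "r > 0" and c: "\<And>s. \<bar>s - t\<bar> < r \<Longrightarrow> (\<lambda>i. (s - t) ^ i *\<^sub>R c i) sums \<Phi> s"
    using assms unfolding real_analytic_on_def by blast
  have "smooth_on (\<lambda>s. blinfun_apply (\<Phi> (t + s)) p) {-r<..<r}"
  proof (rule power_series_smooth)
    fix s assume "\<bar>s\<bar> < r"
    then have "(\<lambda>i. s ^ i *\<^sub>R c i) sums \<Phi> (t + s)" using c[of "t + s"] by simp
    from bounded_linear.sums[OF blinfun.bounded_linear_left this, of p]
    show "(\<lambda>i. s ^ i *\<^sub>R blinfun_apply (c i) p) sums blinfun_apply (\<Phi> (t + s)) p"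
      by (simp add: blinfun.scaleR_left)
  qed
  with r show ?thesis by (rule that)
qed

lemma special_plane_of_frame:
  fixes e :: "'m::finite \<Rightarrow> complex ^ 'm"
  assumes e: "ordered_basis T e" and iso: "\<And>i j. (\<i> *s e i) \<bullet> e j = 0" and im: "Im (Omega e) = 0"
  shows "special_plane T"
  unfolding special_plane_def
proof (intro conjI allI impI)
  show "isotropic T"
    unfolding isotropic_def
  proof (intro ballI)
    fix u v assume "u \<in> T" "v \<in> T"
    then obtain r q where "u = (\<Sum>i\<in>UNIV. r i *\<^sub>R e i)" "v = (\<Sum>i\<in>UNIV. q i *\<^sub>R e i)"
      using ordered_basis_coords[OF e] by metis
    then show "(\<i> *s u) \<bullet> v = 0"
      by (simp only: linear_sum[OF linear_ii] linear_scale[OF linear_ii] inner_sum_left inner_sum_right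
          inner_scaleR_left inner_scaleR_right iso mult_zero_right sum.neutral_const)
  qed
  fix v :: "'m \<Rightarrow> complex ^ 'm" assume v: "range v \<subseteq> T"
  then have "\<forall>i. \<exists>r. v i = (\<Sum>j\<in>UNIV. r j *\<^sub>R e j)"
    using ordered_basis_coords[OF e] by (metis rangeI subsetD)
  then obtain r where "\<And>i. v i = (\<Sum>j\<in>UNIV. r i j *\<^sub>R e j)" by metis
  then have "v i = (\<Sum>j\<in>UNIV. (\<chi> i j. r i j) $ i $ j *\<^sub>R e j)" for i by simp
  from Omega_change_of_frame[OF this] show "Im (Omega v) = 0" using im by simp
qed

text \<open>
  The tangent space of \<open>N\<close> contains the images of a basis of the tangent space of
  \<open>P\<close> and the velocity \<open>f\<close>. By \<open>evolution_rhs_nonsingular\<close>,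
  \<open>\<Omega>\<close> has nonzero real part \<open>g(f, f) / \<kappa>\<close> and imaginary
  part \<open>- g(f, i f) / \<kappa> = 0\<close> on these \<open>m\<close> vectors, which are
  therefore a basis.
\<close>

lemma swept_tangent_plane:
  fixes X :: "real ^ 'n::finite \<Rightarrow> real ^ ('k::finite \<Rightarrow> 'n)"
  assumes D: "linear_evolution_data P X" and sol: "solves_evolution X \<Phi> {-\<epsilon><..<\<epsilon>}"
    and an: "real_analytic_on \<Phi> {-\<epsilon><..<\<epsilon>}" and t: "t \<in> {-\<epsilon><..<\<epsilon>}"
    and p: "p \<in> nonsingular_part CARD('k) P"
    and iso: "isotropic (blinfun_apply (\<Phi> t) ` tangent_space P p)"
    and nz: "evolution_rhs X (\<Phi> t) p \<noteq> 0"
    and N: "N = {blinfun_apply (\<Phi> t) p | t p. t \<in> {-\<epsilon><..<\<epsilon>} \<and> p \<in> P}"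
    and y: "blinfun_apply (\<Phi> t) p \<in> nonsingular_part CARD('k option) N"
  shows "special_plane (tangent_space N (blinfun_apply (\<Phi> t) p))"
proof -
  let ?y = "blinfun_apply (\<Phi> t) p"
  define T where "T = tangent_space N ?y"
  define f where "f = evolution_rhs X (\<Phi> t) p"
  have pP: "p \<in> P" using p nonsingular_part_subset by blast
  obtain w \<kappa> where w: "ordered_basis (tangent_space P p) w" and \<kappa>: "\<kappa> \<noteq> 0"
    and all_rhs: "\<forall>\<phi> c. evolution_rhs X \<phi> p \<bullet> c = \<kappa> * Re_Omega_comp (\<lambda>j. blinfun_apply \<phi> (w j)) c"
    using evolution_rhs_nonsingular[OF D p] .
  note rhs = all_rhs[rule_format]
  define a where "a j = blinfun_apply (\<Phi> t) (w j)" for j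
  have aT: "a j \<in> T" for j
  proof -
    obtain \<gamma> \<delta> where g: "\<delta> > 0" "smooth_on \<gamma> {-\<delta><..<\<delta>}" "\<gamma> ` {-\<delta><..<\<delta>} \<subseteq> P" "\<gamma> 0 = p"
        "(\<gamma> has_vector_derivative w j) (at (0::real))"
      using ordered_basis_subset[OF w, of j] unfolding tangent_space_def by blast
    have "smooth_on (\<lambda>s. blinfun_apply (\<Phi> t) (\<gamma> s)) {-\<delta><..<\<delta>}"
      by (rule smooth_on_linear_compose[OF blinfun_linear _ g(2)]) simp
    moreover have "(\<lambda>s. blinfun_apply (\<Phi> t) (\<gamma> s)) ` {-\<delta><..<\<delta>} \<subseteq> N"
      unfolding N using g(3) t by blast
    moreover have "((\<lambda>s. blinfun_apply (\<Phi> t) (\<gamma> s)) has_vector_derivative a j) (at 0)"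
      unfolding a_def by (rule bounded_linear.has_vector_derivative[OF blinfun.bounded_linear_right g(5)])
    ultimately show ?thesis
      unfolding T_def tangent_space_def using g(1,4) by blast
  qed
  have fT: "f \<in> T"
  proof -
    obtain r where r: "r > 0" "smooth_on (\<lambda>s. blinfun_apply (\<Phi> (t + s)) p) {-r<..<r}"
      using real_analytic_curve_smooth[OF an t] by blast
    define \<delta> where "\<delta> = min r (min (\<epsilon> - t) (t + \<epsilon>))"
    have \<delta>: "\<delta> > 0" "\<delta> \<le> r" "\<delta> \<le> \<epsilon> - t" "\<delta> \<le> t + \<epsilon>" using r t by (auto simp: \<delta>_def)
    have "smooth_on (\<lambda>s. blinfun_apply (\<Phi> (t + s)) p) {-\<delta><..<\<delta>}"
      by (rule smooth_on_subset[OF r(2)]) (use \<delta> in auto)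
    moreover have "(\<lambda>s. blinfun_apply (\<Phi> (t + s)) p) ` {-\<delta><..<\<delta>} \<subseteq> N"
      unfolding N using pP \<delta> by fastforce
    moreover have "((\<lambda>s. blinfun_apply (\<Phi> (t + s)) p) has_vector_derivative f) (at 0)"
    proof -
      have "((\<lambda>s. t + s) has_vector_derivative 1) (at 0)" by (auto intro!: derivative_eq_intros)
      moreover have "((\<lambda>s. blinfun_apply (\<Phi> s) p) has_vector_derivative f) (at (t + 0))"
        using sol t by (simp add: solves_evolution_def f_def)
      ultimately have "((\<lambda>s. blinfun_apply (\<Phi> s) p) \<circ> (\<lambda>s. t + s) has_vector_derivative 1 *\<^sub>R f) (at 0)"
        by (rule vector_diff_chain_at)
      then show ?thesis by (simp add: o_def)
    qed
    ultimately show ?thesis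
      unfolding T_def tangent_space_def using \<delta>(1) by fastforce
  qed
  have f_c: "f \<bullet> c = \<kappa> * Re_Omega_comp a c" for c
    unfolding f_def rhs a_def ..
  have perp: "(\<i> *s f) \<bullet> a j = 0" "f \<bullet> a j = 0" for j
    using evolution_rhs_omega_orthogonal[OF D p ordered_basis_subset[OF w]] by (simp_all add: f_def a_def)
  have aa: "(\<i> *s a i) \<bullet> a j = 0" for i j
    using iso ordered_basis_subset[OF w] by (auto simp: isotropic_def a_def)
  have ff: "(\<i> *s f) \<bullet> f = 0" using inner_ii[of f f] by (simp add: inner_commute)
  have "Re_Omega_comp a f \<noteq> 0" using f_c[of f] nz by (auto simp: f_def)
  then have O: "Omega (slots a f) \<noteq> 0" by (auto simp: Re_Omega_comp_slots)
  have "f \<bullet> (\<i> *s f) = 0" using ff by (simp add: inner_commute)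
  then have im: "Im (Omega (slots a f)) = 0"
    using f_c[of "\<i> *s f"] \<kappa> by (simp add: Re_Omega_comp_ii)
  have rT: "range (slots a f) \<subseteq> T"
  proof clarify
    fix s show "slots a f s \<in> T" using aT fT by (cases s) auto
  qed
  have T: "subspace T" "dim T = CARD('k option)"
    unfolding T_def by (rule tangent_space_nonsingular[OF y])+
  have "(\<i> *s slots a f i) \<bullet> slots a f j = 0" for i j
  proof (cases i; cases j)
    fix l assume "i = Some l" "j = None"
    then show ?thesis using perp(1)[of l] inner_ii[of "a l" f] by (simp add: inner_commute)
  qed (auto simp: aa ff perp(1))
  then show ?thesis
    unfolding T_def[symmetric]
    by (rule special_plane_of_frame[OF basis_of_Omega_nonzero[OF T rT O] _ im])
qed

text \<open>
  The points \<open>\<phi>\<^sub>t(p)\<close> with \<open>p\<close> nonsingular and nonzero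
  velocity are dense in the swept-out set, because each \<open>\<phi>\<^sub>t\<close> is
  continuous.
\<close>

lemma swept_special_lagrangian:
  fixes X :: "real ^ 'n::finite \<Rightarrow> real ^ ('k::finite \<Rightarrow> 'n)"
  assumes D: "linear_evolution_data P X" and sol: "solves_evolution X \<Phi> {-\<epsilon><..<\<epsilon>}"
    and an: "real_analytic_on \<Phi> {-\<epsilon><..<\<epsilon>}" and \<Phi>0: "\<Phi> 0 \<in> evolution_maps P"
  shows "special_lagrangian (nonsingular_part CARD('k option)
    {blinfun_apply (\<Phi> t) p | t p. t \<in> {-\<epsilon><..<\<epsilon>} \<and> p \<in> P})"
proof -
  define N where "N = {blinfun_apply (\<Phi> t) p | t p. t \<in> {-\<epsilon><..<\<epsilon>} \<and> p \<in> P}"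
  define E where "E t = {p \<in> nonsingular_part CARD('k) P. evolution_rhs X (\<Phi> t) p \<noteq> 0}" for t
  define Z where "Z = {blinfun_apply (\<Phi> t) p | t p. t \<in> {-\<epsilon><..<\<epsilon>} \<and> p \<in> E t}"
  let ?L = "nonsingular_part CARD('k option) N"
  have ZN: "Z \<subseteq> N"
    using nonsingular_part_subset[of "CARD('k)" P] by (fastforce simp: Z_def N_def E_def)
  have NZ: "N \<subseteq> closure Z"
  proof
    fix y assume "y \<in> N"
    then obtain t p where t: "t \<in> {-\<epsilon><..<\<epsilon>}" and p: "p \<in> P" and y: "y = blinfun_apply (\<Phi> t) p"
      unfolding N_def by blast
    have "p \<in> closure (E t)"
      using nondegeneracy_preserved[OF D sol \<Phi>0 t] p by (auto simp: E_def)
    moreover have "blinfun_apply (\<Phi> t) ` closure (E t) \<subseteq> closure (blinfun_apply (\<Phi> t) ` E t)"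
      by (rule closure_linear_image_subset[OF blinfun_linear])
    moreover have "closure (blinfun_apply (\<Phi> t) ` E t) \<subseteq> closure Z"
      by (rule closure_mono) (use t in \<open>auto simp: Z_def\<close>)
    ultimately show "y \<in> closure Z" unfolding y by blast
  qed
  have "special_plane (tangent_space N y)" if yZ: "y \<in> Z" and y: "y \<in> ?L" for y
  proof -
    obtain t p where t: "t \<in> {-\<epsilon><..<\<epsilon>}" and p: "p \<in> E t" and yp: "y = blinfun_apply (\<Phi> t) p"
      using yZ unfolding Z_def by blast
    have pn: "p \<in> nonsingular_part CARD('k) P" "evolution_rhs X (\<Phi> t) p \<noteq> 0" using p by (auto simp: E_def)
    show ?thesis
      unfolding yp
      by (rule swept_tangent_plane[OF D sol an t pn(1) isotropy_preserved[OF D sol \<Phi>0 t pn(1)] pn(2) N_def])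
        (use y yp in simp)
  qed
  then have "special_plane (tangent_space N x)" if "x \<in> ?L" for x
    using special_planes_closed[OF NZ ZN _ that] by blast
  then have "special_plane (tangent_space ?L x)" if "x \<in> ?L" for x
    using that by (simp add: tangent_space_nonsingular_part)
  moreover have "submanifold CARD('k option) ?L"
    by (simp add: submanifold_def nonsingular_part_idem)
  ultimately show ?thesis
    unfolding N_def[symmetric] by (intro special_planes_imp_special_lagrangian)
qed

theorem theorem3p3:
  fixes P :: "(real ^ 'n::finite) set"
    and X :: "real ^ 'n \<Rightarrow> real ^ ('k::finite \<Rightarrow> 'n)"
    and \<phi> :: "(real ^ 'n) \<Rightarrow>\<^sub>L (complex ^ ('k option))"
  assumes "2 \<le> CARD('k option)" and "CARD('k option) \<le> CARD('n)"
    and "linear_evolution_data P X"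
    and "\<phi> \<in> evolution_maps P"
  shows "\<exists>\<epsilon>>0. \<exists>\<Phi> :: real \<Rightarrow> (real ^ 'n) \<Rightarrow>\<^sub>L (complex ^ ('k option)).
           evolution_family P X \<phi> \<epsilon> \<Phi> \<and>
           (\<forall>\<Psi>. evolution_family P X \<phi> \<epsilon> \<Psi> \<longrightarrow> (\<forall>t\<in>{-\<epsilon><..<\<epsilon>}. \<Psi> t = \<Phi> t)) \<and>
           special_lagrangian
             (nonsingular_part CARD('k option)
               {blinfun_apply (\<Phi> t) p | t p. t \<in> {-\<epsilon><..<\<epsilon>} \<and> p \<in> P})"
proof -
  have X: "linear X" using assms(3) by (simp add: linear_evolution_data_def)
  have family: "evolution_family P X \<phi> \<epsilon> \<Psi> \<longleftrightarrow>
      real_analytic_on \<Psi> {-\<epsilon><..<\<epsilon>} \<and> (\<forall>t\<in>{-\<epsilon><..<\<epsilon>}. \<Psi> t \<in> evolution_maps P) \<and> \<Psi> 0 = \<phi> \<and>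
      solves_evolution X \<Psi> {-\<epsilon><..<\<epsilon>}" for \<epsilon> \<Psi>
    by (simp add: evolution_family_def solves_evolution_def)
  obtain \<epsilon> \<Phi> where \<epsilon>: "\<epsilon> > 0" and \<Phi>0: "\<Phi> 0 = \<phi>" and an: "real_analytic_on \<Phi> {-\<epsilon><..<\<epsilon>}"
    and sol: "solves_evolution X \<Phi> {-\<epsilon><..<\<epsilon>}"
    using evolution_exists[OF X, of \<phi>] by blast
  have maps: "\<Phi> 0 \<in> evolution_maps P" using \<Phi>0 assms(4) by simp
  have "evolution_family P X \<phi> \<epsilon> \<Phi>"
    unfolding family using an \<Phi>0 sol evolution_preserves_maps[OF assms(3) sol maps] by blast
  moreover have "\<Psi> t = \<Phi> t" if "evolution_family P X \<phi> \<epsilon> \<Psi>" "t \<in> {-\<epsilon><..<\<epsilon>}" for \<Psi> t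
  proof (rule evolution_unique[OF X _ sol])
    show "solves_evolution X \<Psi> {-\<epsilon><..<\<epsilon>}" "\<Psi> 0 = \<Phi> 0"
      using that(1) \<Phi>0 unfolding family by simp_all
    show "0 \<in> {-\<epsilon><..<\<epsilon>}" using \<epsilon> by simp
  qed (rule that(2))
  moreover note swept_special_lagrangian[OF assms(3) sol an maps]
  ultimately show ?thesis
    by (intro exI[of _ \<epsilon>] exI[of _ \<Phi>] conjI \<epsilon> allI impI ballI)
qed

end
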